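(* Let $m,n\in\mathbb N$. The Fourier transformation $$\widehat{\cdot}:L^\infty_{\mathrm{per}}(\mathcal G,\mathbb C^{m\times n})\to\bigoplus_{\rho\in\mathcal E}\mathbb C^{(md_\rho)\times(nd_\rho)},\qquad u\mapsto(\widehat u(\rho))_{\rho\in\mathcal E}$$ is well-defined and bijective. Moreover, the Plancherel formula holds: $$\langle u,v\rangle=\sum_{\rho\in\mathcal E}d_\rho\langle\widehat u(\rho),\widehat v(\rho)\rangle\qquad\text{for all }u,v\in L^\infty_{\mathrm{per}}(\mathcal G,\mathbb C^{m\times n}).$$
   Context: $\mathbb N=\{1,2,\dots\}$. $E(d)=O(d)\ltimes\mathbb R^d$ is the Euclidean group: elements $(A,b)$ with product $(A_1,b_1)(A_2,b_2)=(A_1A_2,b_1+A_1b_2)$. A translation is an element $(I_d,b)$. A $d$-dimensional space group is a discrete subgroup of $E(d)$ containing $d$ translations with linearly independent translation vectors. For $A_1\in O(d_1)$ and $(A_2,b_2)\in E(d_2)$ put $A_1\oplus(A_2,b_2):=\left(\begin{pmatrix}A_1&0\\ 0&A_2\end{pmatrix},\begin{pmatrix}0\\ b_2\end{pmatrix}\right)\in E(d_1+d_2)$. Setting: $d\in\mathbb N$, $d_1,d_2\in\mathbb N_0$ with $d=d_1+d_2$; $\mathcal S$ is a $d_2$-dimensional space group; $\mathcal G$ is a discrete subgroup of $O(d_1)\oplus\mathcal S=\{A\oplus g: A\in O(d_1),g\in\mathcal S\}$ (understood as $O(d)$ if $d_1=d$ and as $\mathcal S$ if $d_1=0$) such that $\pi(\mathcal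 G)=\mathcal S$, where $\pi(A\oplus g)=g$. $\mathcal T_{\mathcal S}$ is the group of translations of $\mathcal S$. $\mathcal T\subset\mathcal G$ is a fixed subset such that $\pi|_{\mathcal T}:\mathcal T\to\mathcal T_{\mathcal S}$ is bijective ($\mathcal T$ need not be a group). For a subset $X$ of a group, $X^n:=\{x^n:x\in X\}$. $M_0:=\{m\in\mathbb N:\mathcal T^m\text{ is a normal subgroup of }\mathcal G\}$; it is nonempty, of the form $m_0\mathbb N$, and $\mathcal G/\mathcal T^N$ is finite for $N\in M_0$. Periodicity: for $N\in M_0$, a function $u$ on $\mathcal G$ is $\mathcal T^N$-periodic if $u(g)=u(gt)$ for all $g\in\mathcal G$, $t\in\mathcal T^N$; $u$ is periodic if it is $\mathcal T^N$-periodic for some $N\in M_0$. $L^\infty_{\mathrm{per}}(\mathcal G,\mathbb C^{m\times n})$ is the vector space of periodic functions $\mathcal G\to\mathbb C^{m\times n}$. $\mathbb C^{m\times n}$ carries the Frobenius inner product $\langle A,B\rangle=\sum_{i,j}a_{ij}\overline{b_{ij}}$. For $N\in M_0$, $\mathcal C_N$ is a set of representatives of $\mathcal G/\mathcal T^N$. For $u,v\in L^\infty_{\mathrm{per}}(\mathcal G,\mathbb C^{m\times n})$, $\langle u,v\rangle:=\frac1{|\mathcal C_N|}\sum_{g\in\mathcal C_N}\langle u(g),v(g)\rangle$ for any $N\in M_0$ such that $u,v$ are $\mathcal T^N$-periodic (independent of choices). Representations are homomorphisms $\rho:\mathcal G\to U(d_\rho)$ into finite-dimensional unitary groups; $\widehat{\mathcal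 G}$ is the set of unitary equivalence classes of irreducible representations. $\mathcal E$ is a set of representatives (one representation from each class) of $\{\rho\in\widehat{\mathcal G}:\rho\text{ is periodic}\}$. For $u\in L^\infty_{\mathrm{per}}(\mathcal G,\mathbb C^{m\times n})$ and a periodic representation $\rho$, $\widehat u(\rho):=\frac1{|\mathcal C_N|}\sum_{g\in\mathcal C_N}u(g)\otimes\rho(g)\in\mathbb C^{(md_\rho)\times(nd_\rho)}$, where $N\in M_0$ is such that $u$ and $\rho$ are $\mathcal T^N$-periodic and $\otimes$ is the Kronecker product. $\bigoplus$ is the algebraic direct sum (finitely many nonzero entries). *)

theory Defs
  imports
    "HOL-Algebra.Coset"
    "HOL-Analysis.Abstract_Metric_Spaces"
    "HOL-Analysis.Infinite_Sum"
    "HOL-Analysis.L2_Norm"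
    "Jordan_Normal_Form.Schur_Decomposition"
    "Jordan_Normal_Form.VS_Connect"
begin

definition orthogonal_matrices :: "nat \<Rightarrow> real mat set" where
  "orthogonal_matrices d = {A \<in> carrier_mat d d. transpose_mat A * A = 1\<^sub>m d}"

definition euclidean_group :: "nat \<Rightarrow> (real mat \<times> real vec) monoid" where
  "euclidean_group d = \<lparr>
     carrier = orthogonal_matrices d \<times> carrier_vec d,
     mult = (\<lambda>(A\<^sub>1, b\<^sub>1) (A\<^sub>2, b\<^sub>2). (A\<^sub>1 * A\<^sub>2, b\<^sub>1 + A\<^sub>1 *\<^sub>v b\<^sub>2)),
     one = (1\<^sub>m d, 0\<^sub>v d)\<rparr>"

text \<open>The standard topology of the Euclidean group is the one inherited from
  \<open>\<real>\<^bsup>d\<times>d\<^esup> \<times> \<real>\<^bsup>d\<^esup>\<close>; it is induced by the metric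
  \<open>\<parallel>A - A'\<parallel> + \<parallel>b - b'\<parallel>\<close> (Frobenius and Euclidean norm).\<close>

definition euclidean_group_dist ::
    "nat \<Rightarrow> real mat \<times> real vec \<Rightarrow> real mat \<times> real vec \<Rightarrow> real" where
  "euclidean_group_dist d x y =
     L2_set (\<lambda>ij. fst x $$ ij - fst y $$ ij) ({..<d} \<times> {..<d}) +
     L2_set (\<lambda>i. snd x $ i - snd y $ i) {..<d}"

definition euclidean_group_topology :: "nat \<Rightarrow> (real mat \<times> real vec) topology" where
  "euclidean_group_topology d =
     Metric_space.mtopology (carrier (euclidean_group d)) (euclidean_group_dist d)"

definition discrete_subgroup :: "nat \<Rightarrow> (real mat \<times> real vec) set \<Rightarrow> bool" where
  "discrete_subgroup d H \<longleftrightarrow> subgroup H (euclidean_group d) \<and>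
     subtopology (euclidean_group_topology d) H = discrete_topology H"

definition translation_subgroup :: "nat \<Rightarrow> (real mat \<times> real vec) set \<Rightarrow> (real mat \<times> real vec) set" where
  "translation_subgroup d H = {g \<in> H. fst g = 1\<^sub>m d}"

definition space_group :: "nat \<Rightarrow> (real mat \<times> real vec) set \<Rightarrow> bool" where
  "space_group d S \<longleftrightarrow> discrete_subgroup d S \<and>
     (\<exists>B \<subseteq> snd ` translation_subgroup d S. finite B \<and> card B = d \<and>
        \<not> LinearCombinations.module.lin_dep class_ring (module_vec TYPE(real) d) B)"

definition oplus :: "real mat \<Rightarrow> real mat \<times> real vec \<Rightarrow> real mat \<times> real vec" where
  "oplus A\<^sub>1 g =
     (four_block_mat A\<^sub>1 (0\<^sub>m (dim_row A\<^sub>1) (dim_col (fst g)))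
        (0\<^sub>m (dim_row (fst g)) (dim_col A\<^sub>1)) (fst g),
      0\<^sub>v (dim_row A\<^sub>1) @\<^sub>v snd g)"

text \<open>\<open>block_proj d\<^sub>1\<close> is the map \<open>A \<oplus> g \<mapsto> g\<close>, see the lemma below. It is only meaningful
  on elements of this form with \<open>A\<close> of size \<open>d\<^sub>1\<close>.\<close>

definition block_proj :: "nat \<Rightarrow> real mat \<times> real vec \<Rightarrow> real mat \<times> real vec" where
  "block_proj d\<^sub>1 x =
     (case split_block (fst x) d\<^sub>1 d\<^sub>1 of (_, _, _, A\<^sub>2) \<Rightarrow> A\<^sub>2,
      vec_last (snd x) (dim_vec (snd x) - d\<^sub>1))"

lemma block_proj_oplus:
  assumes "A \<in> orthogonal_matrices d\<^sub>1" and "g \<in> carrier (euclidean_group d\<^sub>2)"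
  shows "block_proj d\<^sub>1 (oplus A g) = g"
  using assms
  by (cases g) (auto simp: block_proj_def oplus_def split_block_def Let_def vec_last_def
      orthogonal_matrices_def euclidean_group_def intro!: eq_matI eq_vecI)

lemma Metric_space_euclidean_group:
  "Metric_space (carrier (euclidean_group d)) (euclidean_group_dist d)"
proof
  fix x y z :: "real mat \<times> real vec"
  show "0 \<le> euclidean_group_dist d x y"
    by (simp add: euclidean_group_dist_def)
  show "euclidean_group_dist d x y = euclidean_group_dist d y x"
    by (simp add: euclidean_group_dist_def L2_set_def power2_commute case_prod_beta)
  assume xy: "x \<in> carrier (euclidean_group d)" "y \<in> carrier (euclidean_group d)"
  have "euclidean_group_dist d x y = 0 \<longleftrightarrow>
      (\<forall>i<d. \<forall>j<d. fst x $$ (i, j) = fst y $$ (i, j)) \<and> (\<forall>i<d. snd x $ i = snd y $ i)"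
    by (auto simp: euclidean_group_dist_def add_nonneg_eq_0_iff L2_set_eq_0_iff)
  also have "\<dots> \<longleftrightarrow> x = y"
    using xy by (cases x; cases y)
      (auto simp: euclidean_group_def orthogonal_matrices_def intro!: eq_matI eq_vecI)
  finally show "euclidean_group_dist d x y = 0 \<longleftrightarrow> x = y" .
  have 1: "L2_set (\<lambda>ij. fst x $$ ij - fst z $$ ij) ({..<d} \<times> {..<d}) \<le>
     L2_set (\<lambda>ij. fst x $$ ij - fst y $$ ij) ({..<d} \<times> {..<d}) +
     L2_set (\<lambda>ij. fst y $$ ij - fst z $$ ij) ({..<d} \<times> {..<d})"
    using L2_set_triangle_ineq[of "\<lambda>ij. fst x $$ ij - fst y $$ ij"
      "\<lambda>ij. fst y $$ ij - fst z $$ ij" "{..<d} \<times> {..<d}"]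
    by (simp add: case_prod_beta)
  have 2: "L2_set (\<lambda>i. snd x $ i - snd z $ i) {..<d} \<le>
     L2_set (\<lambda>i. snd x $ i - snd y $ i) {..<d} + L2_set (\<lambda>i. snd y $ i - snd z $ i) {..<d}"
    using L2_set_triangle_ineq[of "\<lambda>i. snd x $ i - snd y $ i"
      "\<lambda>i. snd y $ i - snd z $ i" "{..<d}"] by simp
  show "euclidean_group_dist d x z \<le> euclidean_group_dist d x y + euclidean_group_dist d y z"
    using 1 2 by (simp add: euclidean_group_dist_def)
qed

lemma group_euclidean_group: "group (euclidean_group d)"
proof (rule groupI)
  fix x y
  assume "x \<in> carrier (euclidean_group d)" and "y \<in> carrier (euclidean_group d)"
  then obtain A a B b where xy: "x = (A, a)" "y = (B, b)"
    and c: "A \<in> carrier_mat d d" "B \<in> carrier_mat d d" "a \<in> carrier_vec d" "b \<in> carrier_vec d"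
    and o: "transpose_mat A * A = 1\<^sub>m d" "transpose_mat B * B = 1\<^sub>m d"
    by (auto simp: euclidean_group_def orthogonal_matrices_def)
  have "transpose_mat (A * B) * (A * B) = transpose_mat B * (transpose_mat A * A) * B"
    using c by (simp add: transpose_mult assoc_mult_mat[of _ d d _ d _ d])
  also have "\<dots> = 1\<^sub>m d"
    using c o by simp
  finally show "x \<otimes>\<^bsub>euclidean_group d\<^esub> y \<in> carrier (euclidean_group d)"
    using c by (auto simp: xy euclidean_group_def orthogonal_matrices_def)
next
  fix x y z
  assume "x \<in> carrier (euclidean_group d)" "y \<in> carrier (euclidean_group d)"
    "z \<in> carrier (euclidean_group d)"
  then show "x \<otimes>\<^bsub>euclidean_group d\<^esub> y \<otimes>\<^bsub>euclidean_group d\<^esub> z =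
      x \<otimes>\<^bsub>euclidean_group d\<^esub> (y \<otimes>\<^bsub>euclidean_group d\<^esub> z)"
    by (auto simp: euclidean_group_def orthogonal_matrices_def mult_add_distrib_mat_vec[of _ d d]
        assoc_mult_mat[of _ d d _ d _ d] assoc_mult_mat_vec[of _ d d _ d]
        assoc_add_vec[of _ d])
next
  fix x
  assume x: "x \<in> carrier (euclidean_group d)"
  then obtain A a where xA: "x = (A, a)"
    and c: "A \<in> carrier_mat d d" "a \<in> carrier_vec d" and o: "transpose_mat A * A = 1\<^sub>m d"
    by (auto simp: euclidean_group_def orthogonal_matrices_def)
  have t: "transpose_mat A \<in> carrier_mat d d" using c by simp
  from mat_mult_left_right_inverse[OF t c(1) o] have o': "A * transpose_mat A = 1\<^sub>m d" .
  have v: "transpose_mat A *\<^sub>v a \<in> carrier_vec d" using t c by simp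
  show "\<exists>y \<in> carrier (euclidean_group d). y \<otimes>\<^bsub>euclidean_group d\<^esub> x = \<one>\<^bsub>euclidean_group d\<^esub>"
    using c o o' v by (intro bexI[of _ "(transpose_mat A, - (transpose_mat A *\<^sub>v a))"])
      (auto simp: xA euclidean_group_def orthogonal_matrices_def)
qed (auto simp: euclidean_group_def orthogonal_matrices_def)

definition representatives :: "'a set \<Rightarrow> 'a set set \<Rightarrow> bool" where
  "representatives R \<C> \<longleftrightarrow> R \<subseteq> \<Union>\<C> \<and> (\<forall>c \<in> \<C>. \<exists>!r. r \<in> R \<inter> c)"

definition set_pow :: "('a, 'b) monoid_scheme \<Rightarrow> 'a set \<Rightarrow> nat \<Rightarrow> 'a set" where
  "set_pow \<Gamma> X n = (\<lambda>x. x [^]\<^bsub>\<Gamma>\<^esub> n) ` X"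

definition normal_exponents :: "('a, 'b) monoid_scheme \<Rightarrow> 'a set \<Rightarrow> nat set" where
  "normal_exponents \<Gamma> T = {m. 1 \<le> m \<and> set_pow \<Gamma> T m \<lhd> \<Gamma>}"

definition periodic_wrt ::
    "('a, 'b) monoid_scheme \<Rightarrow> 'a set \<Rightarrow> nat \<Rightarrow> ('a \<Rightarrow> 'c) \<Rightarrow> bool" where
  "periodic_wrt \<Gamma> T N u \<longleftrightarrow>
     (\<forall>g \<in> carrier \<Gamma>. \<forall>t \<in> set_pow \<Gamma> T N. u g = u (g \<otimes>\<^bsub>\<Gamma>\<^esub> t))"

definition periodic :: "('a, 'b) monoid_scheme \<Rightarrow> 'a set \<Rightarrow> ('a \<Rightarrow> 'c) \<Rightarrow> bool" where
  "periodic \<Gamma> T u \<longleftrightarrow> (\<exists>N \<in> normal_exponents \<Gamma> T. periodic_wrt \<Gamma> T N u)"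

definition L_per ::
    "('a, 'b) monoid_scheme \<Rightarrow> 'a set \<Rightarrow> nat \<Rightarrow> nat \<Rightarrow> ('a \<Rightarrow> complex mat) set" where
  "L_per \<Gamma> T m n = {u \<in> carrier \<Gamma> \<rightarrow>\<^sub>E carrier_mat m n. periodic \<Gamma> T u}"

definition frobenius :: "complex mat \<Rightarrow> complex mat \<Rightarrow> complex" where
  "frobenius A B = (\<Sum>i<dim_row A. \<Sum>j<dim_col A. A $$ (i, j) * cnj (B $$ (i, j)))"

text \<open>The mean over \<open>\<Gamma>/T\<^sup>N\<close> does not depend on \<open>N\<close> and on the representatives, so the inner
  product is introduced as the unique value arising from some admissible choice. The
  Fourier transform below is treated in the same way.\<close>

definition is_inner_per ::
    "('a, 'b) monoid_scheme \<Rightarrow> 'a set \<Rightarrow> ('a \<Rightarrow> complex mat) \<Rightarrow> ('a \<Rightarrow> complex mat) \<Rightarrow> complex \<Rightarrow> bool"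
  where
  "is_inner_per \<Gamma> T u v c \<longleftrightarrow>
     (\<exists>N \<in> normal_exponents \<Gamma> T. \<exists>C. periodic_wrt \<Gamma> T N u \<and> periodic_wrt \<Gamma> T N v \<and>
        representatives C (carrier (\<Gamma> Mod set_pow \<Gamma> T N)) \<and>
        c = 1 / of_nat (card C) * (\<Sum>g\<in>C. frobenius (u g) (v g)))"

definition inner_per ::
    "('a, 'b) monoid_scheme \<Rightarrow> 'a set \<Rightarrow> ('a \<Rightarrow> complex mat) \<Rightarrow> ('a \<Rightarrow> complex mat) \<Rightarrow> complex" where
  "inner_per \<Gamma> T u v = (THE c. is_inner_per \<Gamma> T u v c)"

definition unitary_group :: "nat \<Rightarrow> complex mat monoid" where
  "unitary_group n = \<lparr>
     carrier = {U \<in> carrier_mat n n. mat_adjoint U * U = 1\<^sub>m n}, mult = (*), one = 1\<^sub>m n\<rparr>"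

text \<open>Representations are extensional functions, so that equality of representations is equality
  on the group.\<close>

definition unitary_rep :: "('a, 'b) monoid_scheme \<Rightarrow> nat \<Rightarrow> ('a \<Rightarrow> complex mat) \<Rightarrow> bool" where
  "unitary_rep \<Gamma> n \<rho> \<longleftrightarrow> \<rho> \<in> hom \<Gamma> (unitary_group n) \<and> \<rho> \<in> extensional (carrier \<Gamma>)"

definition rep_dim :: "('a, 'b) monoid_scheme \<Rightarrow> ('a \<Rightarrow> complex mat) \<Rightarrow> nat" where
  "rep_dim \<Gamma> \<rho> = dim_row (\<rho> \<one>\<^bsub>\<Gamma>\<^esub>)"

definition irreducible_rep :: "('a, 'b) monoid_scheme \<Rightarrow> nat \<Rightarrow> ('a \<Rightarrow> complex mat) \<Rightarrow> bool" where
  "irreducible_rep \<Gamma> n \<rho> \<longleftrightarrow> unitary_rep \<Gamma> n \<rho> \<and> 1 \<le> n \<and>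
     (\<forall>W. VectorSpace.subspace class_ring W (module_vec TYPE(complex) n) \<and>
          (\<forall>g \<in> carrier \<Gamma>. \<forall>w \<in> W. \<rho> g *\<^sub>v w \<in> W)
        \<longrightarrow> W = {0\<^sub>v n} \<or> W = carrier_vec n)"

definition irreducible_reps :: "('a, 'b) monoid_scheme \<Rightarrow> ('a \<Rightarrow> complex mat) set" where
  "irreducible_reps \<Gamma> = {\<rho>. \<exists>n. irreducible_rep \<Gamma> n \<rho>}"

definition unitary_equivalence ::
    "('a, 'b) monoid_scheme \<Rightarrow> (('a \<Rightarrow> complex mat) \<times> ('a \<Rightarrow> complex mat)) set" where
  "unitary_equivalence \<Gamma> = {(\<rho>, \<sigma>). \<exists>n. unitary_rep \<Gamma> n \<rho> \<and> unitary_rep \<Gamma> n \<sigma> \<and>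
     (\<exists>U \<in> carrier (unitary_group n). \<forall>g \<in> carrier \<Gamma>. \<sigma> g = mat_adjoint U * \<rho> g * U)}"

definition unitary_dual :: "('a, 'b) monoid_scheme \<Rightarrow> ('a \<Rightarrow> complex mat) set set" where
  "unitary_dual \<Gamma> = irreducible_reps \<Gamma> // unitary_equivalence \<Gamma>"

text \<open>Periodicity is invariant under unitary equivalence, so a class may be called periodic
  if one of its members is.\<close>

definition periodic_dual ::
    "('a, 'b) monoid_scheme \<Rightarrow> 'a set \<Rightarrow> ('a \<Rightarrow> complex mat) set set" where
  "periodic_dual \<Gamma> T = {c \<in> unitary_dual \<Gamma>. \<exists>\<rho> \<in> c. periodic \<Gamma> T \<rho>}"

definition kronecker :: "complex mat \<Rightarrow> complex mat \<Rightarrow> complex mat" where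
  "kronecker A B = mat (dim_row A * dim_row B) (dim_col A * dim_col B)
     (\<lambda>(i, j). A $$ (i div dim_row B, j div dim_col B) * B $$ (i mod dim_row B, j mod dim_col B))"

text \<open>The type of matrices of arbitrary size is not an additive monoid, hence the
  sum of matrices is formed entrywise.\<close>

definition is_fourier ::
    "('a, 'b) monoid_scheme \<Rightarrow> 'a set \<Rightarrow> nat \<Rightarrow> nat \<Rightarrow> ('a \<Rightarrow> complex mat) \<Rightarrow>
     ('a \<Rightarrow> complex mat) \<Rightarrow> complex mat \<Rightarrow> bool" where
  "is_fourier \<Gamma> T m n u \<rho> X \<longleftrightarrow>
     (\<exists>N \<in> normal_exponents \<Gamma> T. \<exists>C. periodic_wrt \<Gamma> T N u \<and> periodic_wrt \<Gamma> T N \<rho> \<and>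
        representatives C (carrier (\<Gamma> Mod set_pow \<Gamma> T N)) \<and>
        X = mat (m * rep_dim \<Gamma> \<rho>) (n * rep_dim \<Gamma> \<rho>)
              (\<lambda>ij. 1 / of_nat (card C) * (\<Sum>g\<in>C. kronecker (u g) (\<rho> g) $$ ij)))"

definition fourier ::
    "('a, 'b) monoid_scheme \<Rightarrow> 'a set \<Rightarrow> nat \<Rightarrow> nat \<Rightarrow> ('a \<Rightarrow> complex mat) \<Rightarrow>
     ('a \<Rightarrow> complex mat) \<Rightarrow> complex mat" where
  "fourier \<Gamma> T m n u \<rho> = (THE X. is_fourier \<Gamma> T m n u \<rho> X)"

definition fourier_codomain ::
    "('a, 'b) monoid_scheme \<Rightarrow> ('a \<Rightarrow> complex mat) set \<Rightarrow> nat \<Rightarrow> nat \<Rightarrow>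
     (('a \<Rightarrow> complex mat) \<Rightarrow> complex mat) set" where
  "fourier_codomain \<Gamma> \<E> m n =
     {X \<in> (\<Pi>\<^sub>E \<rho>\<in>\<E>. carrier_mat (m * rep_dim \<Gamma> \<rho>) (n * rep_dim \<Gamma> \<rho>)).
        finite {\<rho> \<in> \<E>. X \<rho> \<noteq> 0\<^sub>m (m * rep_dim \<Gamma> \<rho>) (n * rep_dim \<Gamma> \<rho>)}}"

end

theory Submission
  imports Defs "HOL-Algebra.Multiplicative_Group" "Jordan_Normal_Form.Spectral_Radius"
begin

text \<open>
  The preimage \<open>H\<close> of the translations of \<open>\<S>\<close> in \<open>\<G>\<close> is an extension of an abelian group by the finite
  group \<open>F = ker \<pi>\<close>. Hence for sufficiently divisible \<open>N\<close> the map \<open>x \<mapsto> x\<^sup>N\<close> is a homomorphism on \<open>H\<close>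
  that is constant on the cosets of \<open>F\<close>, so that \<open>\<T>\<^sup>N\<close>, the set of all \<open>N\<close>-th powers in \<open>H\<close>, is a normal
  subgroup. It has finite index since every coset meets a fixed bounded part of the discrete group \<open>\<G>\<close>.

  The groups \<open>\<T>\<^sup>N\<close> with \<open>N \<in> M\<^sub>0\<close> thus form a directed family of normal subgroups of finite index, and the
  theorem reduces to Fourier analysis on the finite groups \<open>\<G>/\<T>\<^sup>N\<close>: the matrix coefficients of
  inequivalent irreducible representations are orthogonal by Schur's lemma. They are complete since otherwise
  their orthogonal complement would contain a minimal nonzero translation invariant subspace, but such a space
  consists of matrix coefficients of the irreducible representation on it.
\<close>

text \<open>\<open>T\<close> is only a set of lifts: products of lifts may leave it, and their
  commutators lie in a kernel that may fail to be central. Normality of the powers is therefore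
  forced by divisibility of the exponent alone. In general no single exponent serves all functions
  and all representations. For this reason functions remain functions on the group that are
  invariant under a varying subgroup \<open>K\<close>, instead of becoming functions on a quotient;
  changing the period then costs no more than the fact that means are stable under refinement. The
  transform pairs u with \<rho> without a conjugate, whereas orthogonality relations carry one.
  Hence inversion produces conjugated matrix coefficients and comes from expanding the conjugate of
  u. The matrix-valued statement is scalar in disguise: the entry of the transform in row
  \<open>a * d + i\<close> and column \<open>b * d + j\<close>, with d the dimension of \<rho>, is
  the (i, j) coefficient of the scalar function u_ab. Dimensions of function spaces are measured by
  lengths of orthonormal systems. The bound |G/K| on these lengths yields minimal invariant spaces,
  and also the finite support of the transform.\<close>

no_notation Finite_Cartesian_Product.vec_nth (infixl \<open>$\<close> 90)

section \<open>Powers in finite-by-abelian groups\<close>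

text \<open>Pigeonhole: the conjugates of \<open>f\<close> by the powers of \<open>x\<close> with
  exponents 0 to |F| are |F| + 1 elements of \<open>F\<close>, so two of them coincide and some
  power of \<open>x\<close> with exponent between 1 and |F| commutes with \<open>f\<close>. That
  exponent depends on \<open>x\<close> and \<open>f\<close>, but it always divides |F|!.\<close>

lemma (in group) fact_pow_commutes_with_finite_normal:
  assumes "F \<lhd> G" and "finite F" and x: "x \<in> carrier G" and f: "f \<in> F"
  shows "x [^] (fact (card F) :: nat) \<otimes> f = f \<otimes> x [^] (fact (card F) :: nat)"
proof -
  interpret F: normal F G by fact
  have fG: "f \<in> carrier G" using f F.subset by blast
  let ?c = "\<lambda>i :: nat. x [^] i \<otimes> f \<otimes> inv (x [^] i)"
  have "?c ` {..card F} \<subseteq> F"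
    using F.inv_op_closed2 f x by auto
  then have "card (?c ` {..card F}) < card {..card F}"
    using card_mono[OF \<open>finite F\<close>] by (metis card_atMost le_imp_less_Suc)
  then have "\<not> inj_on ?c {..card F}"
    by (rule pigeonhole)
  then obtain i j where ij: "i < j" "j \<le> card F" "?c i = ?c j"
    unfolding inj_on_def by (metis atMost_iff nat_neq_iff)
  define p where "p = j - i"
  have p: "1 \<le> p" "p \<le> card F" using ij by (auto simp: p_def)
  have xj: "x [^] j = x [^] i \<otimes> x [^] p"
    using ij x by (simp add: nat_pow_mult p_def)
  have "x [^] i \<otimes> (f \<otimes> inv (x [^] i)) = x [^] i \<otimes> (x [^] p \<otimes> f \<otimes> inv (x [^] p) \<otimes> inv (x [^] i))"
    using ij(3) x fG by (simp add: xj inv_mult_group m_assoc)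
  then have "f \<otimes> inv (x [^] i) = (x [^] p \<otimes> f \<otimes> inv (x [^] p)) \<otimes> inv (x [^] i)"
    using x fG by (subst (asm) Units_l_cancel) auto
  then have "f = x [^] p \<otimes> f \<otimes> inv (x [^] p)"
    using x fG by (subst (asm) right_cancel) auto
  then have comm: "x [^] p \<otimes> f = f \<otimes> x [^] p"
    using x fG by (metis inv_solve_right m_closed nat_pow_closed)
  have "p dvd fact (card F)" using p by (simp add: dvd_fact)
  then obtain q where q: "fact (card F) = p * q" by blast
  have "(x [^] p) [^] q \<otimes> f = f \<otimes> (x [^] p) [^] q" for q :: nat
  proof (induction q)
    case (Suc q)
    then show ?case using comm x fG by simp (metis m_assoc nat_pow_closed)
  qed (use fG in simp)
  then show ?thesis using x by (simp add: q nat_pow_pow)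
qed

lemma (in group) pow_card_subgroup:
  assumes "subgroup F G" and "finite F" and "f \<in> F"
  shows "f [^] card F = \<one>"
proof -
  interpret F: subgroup F G by fact
  have "group (G\<lparr>carrier := F\<rparr>)" using F.subgroup_is_group by (simp add: is_group)
  then have "f [^]\<^bsub>G\<lparr>carrier := F\<rparr>\<^esub> card F = \<one>"
    using group.pow_order_eq_1[of "G\<lparr>carrier := F\<rparr>" f] assms by (simp add: Coset.order_def)
  then show ?thesis by (simp add: nat_pow_consistent[symmetric])
qed

text \<open>With \<open>e = |F|!\<close> and \<open>k = |F|\<close>: \<open>x\<^sup>e\<close> commutes with \<open>F\<close>, hence
  \<open>x\<close> to the power \<open>e k\<close> only depends on \<open>x F\<close> and is central in \<open>H\<close>. The \<open>e k\<close>-th power of \<open>x y\<close>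
  then agrees with the product of the powers up to an element of \<open>F\<close>, which a further \<open>k\<close>-th power removes.\<close>

lemma (in group) finite_by_abelian_power_hom:
  assumes "H \<lhd> G" and "F \<lhd> G" and "F \<subseteq> H" and "finite F"
    and comm: "\<And>x y. \<lbrakk>x \<in> H; y \<in> H\<rbrakk> \<Longrightarrow> \<exists>f\<in>F. x \<otimes> y = y \<otimes> x \<otimes> f"
  obtains M :: nat where "M \<ge> 1"
    "\<And>x y N. \<lbrakk>x \<in> H; y \<in> H; M dvd N\<rbrakk> \<Longrightarrow> (x \<otimes> y) [^] N = x [^] N \<otimes> y [^] N"
    "\<And>x f N. \<lbrakk>x \<in> H; f \<in> F; M dvd N\<rbrakk> \<Longrightarrow> (x \<otimes> f) [^] N = x [^] N"
proof -
  interpret F: normal F G by fact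
  interpret H: normal H G by fact
  define k e where "k = card F" and "e = (fact (card F) :: nat)"
  have HG: "x \<in> carrier G" if "x \<in> H" for x using that H.subset by blast
  have FG: "x \<in> carrier G" if "x \<in> F" for x using that F.subset by blast
  have Hpow: "x [^] n \<in> H" if "x \<in> H" for x and n :: nat
    using that by (induction n) auto
  have k: "k \<ge> 1" using \<open>finite F\<close> F.one_closed unfolding k_def by (metis One_nat_def Suc_leI card_gt_0_iff empty_iff)
  have fk: "f [^] k = \<one>" if "f \<in> F" for f
    using pow_card_subgroup[OF F.subgroup_axioms \<open>finite F\<close> that] by (simp add: k_def)
  have cF: "x [^] e \<otimes> f = f \<otimes> x [^] e" if "x \<in> carrier G" "f \<in> F" for x f
    using fact_pow_commutes_with_finite_normal[OF \<open>F \<lhd> G\<close> \<open>finite F\<close>] that by (simp add: e_def)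
  \<comment> \<open>Modulo the normal subgroup \<open>F\<close> the elements
    \<open>x \<otimes> f\<close> and \<open>x\<close> agree, hence so do their powers.\<close>
  have mod_F: "\<exists>h\<in>F. (x \<otimes> f) [^] n = x [^] n \<otimes> h" if "x \<in> carrier G" "f \<in> F" for x f and n :: nat
  proof (induction n)
    case (Suc n)
    then obtain h where h: "h \<in> F" "(x \<otimes> f) [^] n = x [^] n \<otimes> h" by blast
    have "inv x \<otimes> h \<otimes> x \<otimes> f \<in> F" using h that by (auto intro: F.inv_op_closed1)
    moreover have "(x \<otimes> f) [^] Suc n = x [^] Suc n \<otimes> (inv x \<otimes> h \<otimes> x \<otimes> f)"
      using h that FG by (simp add: m_assoc) (simp add: m_assoc[symmetric])
    ultimately show ?case by blast
  qed (auto intro: bexI[of _ \<one>])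
  have kill: "(x [^] e \<otimes> f) [^] k = x [^] (e * k)" if "x \<in> carrier G" "f \<in> F" for x f
    using that FG cF fk by (simp add: pow_mult_distrib nat_pow_pow)
  have pow_cong: "(x \<otimes> f) [^] (e * k) = x [^] (e * k)" if xf: "x \<in> carrier G" "f \<in> F" for x f
  proof -
    obtain h where "h \<in> F" "(x \<otimes> f) [^] e = x [^] e \<otimes> h" using mod_F[OF xf] by blast
    then have "((x \<otimes> f) [^] e) [^] k = x [^] (e * k)" using kill xf by simp
    then show ?thesis using nat_pow_pow[of "x \<otimes> f" e k] m_closed[of x f] xf FG by metis
  qed
  \<comment> \<open>Conjugating \<open>x\<close> by \<open>y\<close> multiplies it by a commutator,
    an element of \<open>F\<close>, to which the power \<open>e * k\<close> is insensitive.\<close>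
  have central: "x [^] (e * k) \<otimes> y = y \<otimes> x [^] (e * k)" if xy: "x \<in> H" "y \<in> H" for x y
  proof -
    have c: "x \<in> carrier G" "y \<in> carrier G" using xy HG by auto
    have conj: "(inv y \<otimes> x \<otimes> y) [^] n = inv y \<otimes> x [^] n \<otimes> y" for n :: nat
    proof (induction n)
      case (Suc n)
      then show ?case using c by (simp add: m_assoc) (simp add: m_assoc[symmetric])
    qed (use c in simp)
    obtain f where f: "f \<in> F" "x \<otimes> y = y \<otimes> x \<otimes> f" using comm xy by blast
    have "inv y \<otimes> x \<otimes> y = x \<otimes> f"
      using c f FG by (simp add: m_assoc) (simp add: m_assoc[symmetric])
    then have "inv y \<otimes> x [^] (e * k) \<otimes> y = x [^] (e * k)"
      using pow_cong[OF c(1) f(1)] conj by metis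
    then have "y \<otimes> x [^] (e * k) = y \<otimes> (inv y \<otimes> x [^] (e * k) \<otimes> y)" by simp
    also have "\<dots> = x [^] (e * k) \<otimes> y" using c by (simp add: m_assoc[symmetric])
    finally show ?thesis by simp
  qed
  \<comment> \<open>Powers are multiplicative in the abelian quotient H/F. The induction keeps track
    of the error term in \<open>F\<close> without forming the quotient.\<close>
  have ab: "\<exists>f\<in>F. (x \<otimes> y) [^] n = x [^] n \<otimes> y [^] n \<otimes> f" if xy: "x \<in> H" "y \<in> H" for x y and n :: nat
  proof (induction n)
    case (Suc n)
    have c: "x \<in> carrier G" "y \<in> carrier G" using xy HG by auto
    obtain f where f: "f \<in> F" "(x \<otimes> y) [^] n = x [^] n \<otimes> y [^] n \<otimes> f" using Suc by blast
    obtain h where h: "h \<in> F" "y [^] n \<otimes> x = x \<otimes> y [^] n \<otimes> h"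
      using comm[of "y [^] n" x] xy Hpow by blast
    define z where "z = inv (x \<otimes> y) \<otimes> f \<otimes> (x \<otimes> y)"
    have z: "z \<in> F" using f c unfolding z_def by (intro F.inv_op_closed1) auto
    define w where "w = inv y \<otimes> h \<otimes> y"
    have w: "w \<in> F" using h c unfolding w_def by (intro F.inv_op_closed1) auto
    have "(x \<otimes> y) [^] Suc n = x [^] n \<otimes> y [^] n \<otimes> (f \<otimes> (x \<otimes> y))"
      using f c FG by (simp add: m_assoc)
    also have "f \<otimes> (x \<otimes> y) = x \<otimes> y \<otimes> z"
      using f c FG by (simp add: z_def m_assoc[symmetric] inv_mult_group) (simp add: m_assoc)
    also have "x [^] n \<otimes> y [^] n \<otimes> (x \<otimes> y \<otimes> z) = x [^] n \<otimes> (y [^] n \<otimes> x) \<otimes> y \<otimes> z"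
      using c z FG by (simp add: m_assoc)
    also have "\<dots> = x [^] n \<otimes> (x \<otimes> y [^] n \<otimes> h) \<otimes> y \<otimes> z" by (simp add: h)
    also have "\<dots> = x [^] n \<otimes> (x \<otimes> y [^] n) \<otimes> (h \<otimes> y) \<otimes> z"
      using c z h FG by (simp add: m_assoc)
    also have "h \<otimes> y = y \<otimes> w"
      using c h FG by (simp add: w_def m_assoc[symmetric])
    also have "x [^] n \<otimes> (x \<otimes> y [^] n) \<otimes> (y \<otimes> w) \<otimes> z = x [^] Suc n \<otimes> y [^] Suc n \<otimes> (w \<otimes> z)"
      using c z w FG by (simp add: m_assoc)
    finally show ?case using w z by blast
  qed (auto intro: bexI[of _ \<one>])
  \<comment> \<open>\<open>e * k\<close> makes powers central in \<open>H\<close> and blind to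
    \<open>F\<close>; the last factor \<open>k\<close> kills the error term from
    \<open>ab\<close>.\<close>
  define M where "M = e * k * k"
  have M_hom: "(x \<otimes> y) [^] M = x [^] M \<otimes> y [^] M" if xy: "x \<in> H" "y \<in> H" for x y
  proof -
    have c: "x \<in> carrier G" "y \<in> carrier G" using xy HG by auto
    define a b where "a = x [^] (e * k)" and "b = y [^] (e * k)"
    have aH: "a \<in> H" "b \<in> H"
      using xy Hpow by (auto simp: a_def b_def)
    note aG = this[THEN HG]
    obtain f where f: "f \<in> F" "(x \<otimes> y) [^] (e * k) = a \<otimes> b \<otimes> f"
      using ab[OF xy] unfolding a_def b_def by blast
    have fH: "f \<in> H" using f \<open>F \<subseteq> H\<close> by blast
    have "a \<otimes> b \<otimes> f = f \<otimes> (a \<otimes> b)"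
      using central[OF xy(1) fH] central[OF xy(2) fH] aG HG[OF fH]
      unfolding a_def[symmetric] b_def[symmetric] by (metis m_assoc)
    then have "(a \<otimes> b \<otimes> f) [^] k = (a \<otimes> b) [^] k \<otimes> f [^] k"
      using aG FG[OF f(1)] by (intro pow_mult_distrib) auto
    moreover have "(a \<otimes> b) [^] k = a [^] k \<otimes> b [^] k"
      using aG central[OF xy(1) aH(2)] by (intro pow_mult_distrib) (auto simp: a_def)
    ultimately have "(a \<otimes> b \<otimes> f) [^] k = a [^] k \<otimes> b [^] k"
      using aG fk[OF f(1)] by simp
    then have "((x \<otimes> y) [^] (e * k)) [^] k = (x [^] (e * k)) [^] k \<otimes> (y [^] (e * k)) [^] k"
      by (simp add: f a_def b_def)
    then show ?thesis using c by (simp add: nat_pow_pow M_def)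
  qed
  have M_F: "(x \<otimes> f) [^] M = x [^] M" if "x \<in> H" "f \<in> F" for x f
    using pow_cong[of x f] HG FG that unfolding M_def by (metis m_closed nat_pow_pow)
  show ?thesis
  proof
    show "M \<ge> 1" using k by (simp add: M_def e_def)
    fix x y and N :: nat assume xy: "x \<in> H" "y \<in> H" and "M dvd N"
    then obtain q where q: "N = M * q" by blast
    have c: "x \<in> carrier G" "y \<in> carrier G" using xy HG by auto
    have "x [^] M \<otimes> y [^] M = y [^] M \<otimes> x [^] M"
      using central[OF Hpow[OF xy(1), of k] Hpow[OF xy(2), of M]] c
      by (simp add: nat_pow_pow M_def mult.commute mult.left_commute)
    then show "(x \<otimes> y) [^] N = x [^] N \<otimes> y [^] N"
      using M_hom[OF xy] c unfolding q by (metis m_closed nat_pow_closed nat_pow_pow pow_mult_distrib)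
  next
    fix x f and N :: nat assume xf: "x \<in> H" "f \<in> F" and "M dvd N"
    then obtain q where q: "N = M * q" by blast
    show "(x \<otimes> f) [^] N = x [^] N"
      using M_F[OF xf] HG FG xf unfolding q by (metis m_closed nat_pow_pow)
  qed
qed

text \<open>Since \<open>T\<close> meets every coset of \<open>F\<close> in \<open>H\<close> and
  N-th powers do not see \<open>F\<close>, the N-th powers of \<open>T\<close> are those of all of
  \<open>H\<close>. They form the image of a homomorphism, and conjugation, which commutes with
  taking powers, preserves them because \<open>H\<close> is normal.\<close>

lemma (in group) normal_powers_of_transversal:
  assumes "H \<lhd> G" and "F \<lhd> G" and "F \<subseteq> H" and "finite F"
    and comm: "\<And>x y. \<lbrakk>x \<in> H; y \<in> H\<rbrakk> \<Longrightarrow> \<exists>f\<in>F. x \<otimes> y = y \<otimes> x \<otimes> f"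
    and "T \<subseteq> H" and T: "\<And>x. x \<in> H \<Longrightarrow> \<exists>t\<in>T. \<exists>f\<in>F. x = t \<otimes> f"
  obtains M :: nat where "M \<ge> 1" "\<And>N. M dvd N \<Longrightarrow> set_pow G T N \<lhd> G"
proof -
  interpret H: normal H G by fact
  have HG: "x \<in> carrier G" if "x \<in> H" for x using that H.subset by blast
  obtain M :: nat where M: "M \<ge> 1"
    and hom: "\<And>x y N. \<lbrakk>x \<in> H; y \<in> H; M dvd N\<rbrakk> \<Longrightarrow> (x \<otimes> y) [^] N = x [^] N \<otimes> y [^] N"
    and F: "\<And>x f N. \<lbrakk>x \<in> H; f \<in> F; M dvd N\<rbrakk> \<Longrightarrow> (x \<otimes> f) [^] N = x [^] N"
    using finite_by_abelian_power_hom[OF assms(1-4) comm] by blast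
  have "set_pow G T N \<lhd> G" if N: "M dvd N" for N
  proof -
    have "(\<lambda>x. x [^] N) ` T = (\<lambda>x. x [^] N) ` H"
    proof (intro equalityI subsetI)
      fix y assume "y \<in> (\<lambda>x. x [^] N) ` H"
      then obtain x where x: "x \<in> H" "y = x [^] N" by blast
      obtain t f where "t \<in> T" "f \<in> F" "x = t \<otimes> f" using T x by blast
      then show "y \<in> (\<lambda>x. x [^] N) ` T" using F[of t f N] N x \<open>T \<subseteq> H\<close> by auto
    qed (use \<open>T \<subseteq> H\<close> in auto)
    then have eq: "set_pow G T N = (\<lambda>x. x [^] N) ` H" by (simp add: set_pow_def)
    have sub: "subgroup ((\<lambda>x. x [^] N) ` H) G"
    proof
      show "(\<lambda>x. x [^] N) ` H \<subseteq> carrier G" using HG by auto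
      show "\<one> \<in> (\<lambda>x. x [^] N) ` H" by (rule image_eqI[of _ _ \<one>]) auto
      show "x \<otimes> y \<in> (\<lambda>x. x [^] N) ` H" if xy: "x \<in> (\<lambda>x. x [^] N) ` H" "y \<in> (\<lambda>x. x [^] N) ` H" for x y
      proof -
        obtain x' y' where "x' \<in> H" "y' \<in> H" "x = x' [^] N" "y = y' [^] N" using xy by blast
        then show ?thesis using hom[OF _ _ N] H.m_closed by (intro image_eqI[of _ _ "x' \<otimes> y'"]) auto
      qed
      show "inv x \<in> (\<lambda>x. x [^] N) ` H" if "x \<in> (\<lambda>x. x [^] N) ` H" for x
        using that HG by (auto simp: nat_pow_inv intro!: image_eqI[OF _ H.m_inv_closed])
    qed
    moreover have "g \<otimes> x [^] N \<otimes> inv g \<in> (\<lambda>x. x [^] N) ` H" if "g \<in> carrier G" "x \<in> H" for g x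
    proof (rule image_eqI)
      have xG: "x \<in> carrier G" using that HG by blast
      show "g \<otimes> x [^] N \<otimes> inv g = (g \<otimes> x \<otimes> inv g) [^] N"
      proof (induction N)
        case (Suc n)
        from this[symmetric] show ?case
          using that xG by (simp add: m_assoc) (simp add: m_assoc[symmetric])
      qed (use that in simp)
    qed (use that H.inv_op_closed2 in auto)
    ultimately show ?thesis unfolding eq normal_inv_iff by auto
  qed
  with M show ?thesis using that by blast
qed

section \<open>Means over cosets\<close>

text \<open>Periodicity with respect to an arbitrary set \<open>K\<close>, so that the harmonic
  analysis can proceed without reference to exponents and to \<open>T\<close>.\<close>

definition right_invariant :: "('a, 'b) monoid_scheme \<Rightarrow> 'a set \<Rightarrow> ('a \<Rightarrow> 'c) \<Rightarrow> bool" where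
  "right_invariant \<Gamma> K f \<longleftrightarrow> (\<forall>g\<in>carrier \<Gamma>. \<forall>t\<in>K. f g = f (g \<otimes>\<^bsub>\<Gamma>\<^esub> t))"

definition coset_reps :: "('a, 'b) monoid_scheme \<Rightarrow> 'a set \<Rightarrow> 'a set" where
  "coset_reps \<Gamma> K = (\<lambda>q. SOME g. g \<in> q) ` carrier (\<Gamma> Mod K)"

definition coset_mean :: "('a, 'b) monoid_scheme \<Rightarrow> 'a set \<Rightarrow> ('a \<Rightarrow> complex) \<Rightarrow> complex" where
  "coset_mean \<Gamma> K f = 1 / of_nat (card (coset_reps \<Gamma> K)) * (\<Sum>g\<in>coset_reps \<Gamma> K. f g)"

lemma right_invariantD:
  "right_invariant \<Gamma> K f \<Longrightarrow> g \<in> carrier \<Gamma> \<Longrightarrow> t \<in> K \<Longrightarrow> f (g \<otimes>\<^bsub>\<Gamma>\<^esub> t) = f g"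
  by (simp add: right_invariant_def)

lemma right_invariant_subset: "right_invariant \<Gamma> K f \<Longrightarrow> L \<subseteq> K \<Longrightarrow> right_invariant \<Gamma> L f"
  unfolding right_invariant_def by blast

lemma right_invariant_entry:
  fixes \<rho> :: "'a \<Rightarrow> complex mat"
  shows "right_invariant \<Gamma> K \<rho> \<Longrightarrow> right_invariant \<Gamma> K (\<lambda>g. \<rho> g $$ (i, j))"
  by (simp add: right_invariant_def)

text \<open>The setting of a finite group G/K whose functions are represented by right-invariant
  functions on \<open>G\<close>.\<close>

locale finite_index_normal = normal K G for K and G (structure) +
  assumes finite_index: "finite (carrier (G Mod K))"
begin

text \<open>Factor groups are built from cosets \<open>K #> x\<close>, while periodicity concerns
  multiplication by \<open>K\<close> on the right, that is cosets \<open>x <# K\<close>. Normality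
  identifies the two.\<close>

lemma mem_coset_iff:
  assumes "x \<in> carrier G" and "r \<in> carrier G"
  shows "r \<in> K #> x \<longleftrightarrow> inv x \<otimes> r \<in> K"
proof -
  have "r \<in> K #> x \<longleftrightarrow> r \<in> x <# K" using assms coset_eq by simp
  also have "\<dots> \<longleftrightarrow> inv x \<otimes> r \<in> K"
  proof
    assume "r \<in> x <# K"
    then obtain k where "k \<in> K" "r = x \<otimes> k" by (auto simp: l_coset_def)
    then show "inv x \<otimes> r \<in> K" using assms subset by (auto simp: m_assoc[symmetric])
  next
    assume k: "inv x \<otimes> r \<in> K"
    have "r = x \<otimes> (inv x \<otimes> r)" using assms by (simp add: m_assoc[symmetric])
    then show "r \<in> x <# K" using k unfolding l_coset_def by blast
  qed
  finally show ?thesis .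
qed

lemma representatives_iff:
  "representatives C (carrier (G Mod K)) \<longleftrightarrow>
     C \<subseteq> carrier G \<and> (\<forall>x\<in>carrier G. \<exists>!r. r \<in> C \<and> inv x \<otimes> r \<in> K)"
proof -
  have U: "\<Union> (carrier (G Mod K)) = carrier G"
    using rcosets_part_G[OF subgroup_axioms] by (simp add: FactGroup_def)
  have "(\<forall>c\<in>carrier (G Mod K). \<exists>!r. r \<in> C \<inter> c) \<longleftrightarrow> (\<forall>x\<in>carrier G. \<exists>!r. r \<in> C \<and> r \<in> K #> x)"
    by (auto simp: FactGroup_def RCOSETS_def)
  also have "\<dots> \<longleftrightarrow> (\<forall>x\<in>carrier G. \<exists>!r. r \<in> C \<and> inv x \<otimes> r \<in> K)" if "C \<subseteq> carrier G"
    using that mem_coset_iff by (intro ball_cong refl arg_cong[where f = Ex1] ext) blast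
  finally show ?thesis unfolding representatives_def U by (intro conj_cong refl)
qed

lemma representativesD:
  "representatives C (carrier (G Mod K)) \<Longrightarrow> x \<in> carrier G \<Longrightarrow> \<exists>!r. r \<in> C \<and> inv x \<otimes> r \<in> K"
  by (simp add: representatives_iff)

lemma coset_some: "q \<in> carrier (G Mod K) \<Longrightarrow> (SOME g. g \<in> q) \<in> q"
  by (rule someI_ex) (use rcosets_non_empty in \<open>auto simp: FactGroup_def\<close>)

lemma coset_unique:
  assumes "p \<in> carrier (G Mod K)" "q \<in> carrier (G Mod K)" "x \<in> p" "x \<in> q"
  shows "p = q"
  using assms rcos_disjoint[OF subgroup_axioms] by (auto simp: FactGroup_def pairwise_def disjnt_def)

lemma representatives_coset_reps: "representatives (coset_reps G K) (carrier (G Mod K))"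
  unfolding representatives_def coset_reps_def
proof (intro conjI ballI)
  show "(\<lambda>q. SOME g. g \<in> q) ` carrier (G Mod K) \<subseteq> \<Union> (carrier (G Mod K))"
    using coset_some by blast
  fix c assume c: "c \<in> carrier (G Mod K)"
  show "\<exists>!r. r \<in> (\<lambda>q. SOME g. g \<in> q) ` carrier (G Mod K) \<inter> c"
  proof
    show "(SOME g. g \<in> c) \<in> (\<lambda>q. SOME g. g \<in> q) ` carrier (G Mod K) \<inter> c"
      using c coset_some by blast
    fix r assume "r \<in> (\<lambda>q. SOME g. g \<in> q) ` carrier (G Mod K) \<inter> c"
    then show "r = (SOME g. g \<in> c)" using c coset_some coset_unique by blast
  qed
qed

text \<open>\<open>h\<close> sends an element of \<open>C\<close> to the unique element of
  \<open>D\<close> in the same coset. One bijection thus compares both the cardinalities and the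
  sums.\<close>

lemma sum_representatives:
  fixes f :: "'a \<Rightarrow> 'c :: comm_monoid_add"
  assumes C: "representatives C (carrier (G Mod K))" and D: "representatives D (carrier (G Mod K))"
    and f: "right_invariant G K f"
  obtains h where "bij_betw h C D" "\<And>x. x \<in> C \<Longrightarrow> f (h x) = f x"
proof -
  have CG: "C \<subseteq> carrier G" "D \<subseteq> carrier G" using C D by (auto simp: representatives_iff)
  define h where "h x = (THE r. r \<in> D \<and> inv x \<otimes> r \<in> K)" for x
  have h: "h x \<in> D" "inv x \<otimes> h x \<in> K" if "x \<in> carrier G" for x
    using theI'[of "\<lambda>r. r \<in> D \<and> inv x \<otimes> r \<in> K"] D that by (auto simp: representatives_iff h_def)
  have sym: "inv y \<otimes> x \<in> K" if "x \<in> carrier G" "y \<in> carrier G" "inv x \<otimes> y \<in> K" for x y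
  proof -
    have "inv (inv x \<otimes> y) \<in> K" using that by blast
    then show ?thesis using that by (simp add: inv_mult_group)
  qed
  have tr: "inv x \<otimes> z \<in> K"
    if "x \<in> carrier G" "y \<in> carrier G" "z \<in> carrier G" "inv x \<otimes> y \<in> K" "inv y \<otimes> z \<in> K" for x y z
  proof -
    have "(inv x \<otimes> y) \<otimes> (inv y \<otimes> z) \<in> K" using that by blast
    moreover have "(inv x \<otimes> y) \<otimes> (inv y \<otimes> z) = inv x \<otimes> (y \<otimes> inv y) \<otimes> z"
      using that by (simp only: m_assoc m_closed inv_closed)
    ultimately show ?thesis using that by simp
  qed
  have inj: "x = y" if "x \<in> C" "y \<in> C" "h x = h y" for x y
  proof -
    have xy: "x \<in> carrier G" "y \<in> carrier G" using that CG by auto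
    have "inv x \<otimes> y \<in> K"
      using tr[of x "h x" y] sym[of y "h y"] h(2)[OF xy(1)] h(2)[OF xy(2)] h(1)[OF xy(1)] that(3) xy CG by auto
    moreover have "inv x \<otimes> x \<in> K" using xy by simp
    ultimately show ?thesis using C xy that by (auto simp: representatives_iff)
  qed
  have surj: "\<exists>x\<in>C. h x = d" if "d \<in> D" for d
  proof -
    have d: "d \<in> carrier G" using that CG by auto
    then obtain x where x: "x \<in> C" "inv d \<otimes> x \<in> K" using C by (auto simp: representatives_iff)
    have xG: "x \<in> carrier G" using x CG by auto
    have "inv x \<otimes> d \<in> K" using sym[OF d xG x(2)] .
    then have "h x = d" using h[OF xG] D xG that by (auto simp: representatives_iff)
    then show ?thesis using x by blast
  qed
  have "bij_betw h C D"
    unfolding bij_betw_def inj_on_def using inj surj h CG by blast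
  moreover have "f (h x) = f x" if "x \<in> C" for x
  proof -
    have x: "x \<in> carrier G" using that CG by auto
    have "h x = x \<otimes> (inv x \<otimes> h x)" using x h[OF x] CG by (auto simp: m_assoc[symmetric])
    then show ?thesis using right_invariantD[OF f x h(2)[OF x]] by simp
  qed
  ultimately show ?thesis using that by blast
qed

abbreviation "Cs \<equiv> coset_reps G K"
abbreviation "mean \<equiv> coset_mean G K"

lemma finite_Cs [simp]: "finite Cs"
  using finite_index by (simp add: coset_reps_def)

lemma Cs_carrier: "g \<in> Cs \<Longrightarrow> g \<in> carrier G"
  using representatives_coset_reps by (auto simp: representatives_iff)

lemma card_Cs_pos: "card Cs > 0"
proof -
  have "\<exists>r. r \<in> Cs" using representatives_coset_reps one_closed unfolding representatives_iff by blast
  then show ?thesis by (auto simp: card_gt_0_iff)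
qed

lemma mean_representatives:
  assumes "representatives C (carrier (G Mod K))" and "right_invariant G K f"
  shows "mean f = 1 / of_nat (card C) * (\<Sum>g\<in>C. f g)"
proof -
  obtain h where h: "bij_betw h C Cs" "\<And>x. x \<in> C \<Longrightarrow> f (h x) = f x"
    using sum_representatives[OF assms(1) representatives_coset_reps assms(2)] by blast
  have "(\<Sum>g\<in>Cs. f g) = (\<Sum>g\<in>C. f g)" using sum.reindex_bij_betw[OF h(1), of f] h(2) by simp
  then show ?thesis using bij_betw_same_card[OF h(1)] by (simp add: coset_mean_def)
qed

lemma representatives_left:
  assumes C: "representatives C (carrier (G Mod K))" and h: "h \<in> carrier G"
  shows "representatives ((\<lambda>g. h \<otimes> g) ` C) (carrier (G Mod K))"
  unfolding representatives_iff
proof (intro conjI ballI)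
  have CG: "C \<subseteq> carrier G" using C by (auto simp: representatives_iff)
  then show "(\<lambda>g. h \<otimes> g) ` C \<subseteq> carrier G" using h by auto
  fix x assume x: "x \<in> carrier G"
  have eq: "inv x \<otimes> (h \<otimes> c) = inv (inv h \<otimes> x) \<otimes> c" if "c \<in> C" for c
    using that CG x h by (auto simp: inv_mult_group m_assoc)
  have "\<exists>!c. c \<in> C \<and> inv (inv h \<otimes> x) \<otimes> c \<in> K"
    using x h by (intro representativesD[OF C]) simp
  then obtain c where c: "c \<in> C" "inv (inv h \<otimes> x) \<otimes> c \<in> K"
    and u: "\<And>c'. c' \<in> C \<Longrightarrow> inv (inv h \<otimes> x) \<otimes> c' \<in> K \<Longrightarrow> c' = c"
    by blast
  show "\<exists>!r. r \<in> (\<lambda>g. h \<otimes> g) ` C \<and> inv x \<otimes> r \<in> K"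
  proof (rule ex1I)
    show "h \<otimes> c \<in> (\<lambda>g. h \<otimes> g) ` C \<and> inv x \<otimes> (h \<otimes> c) \<in> K" using c eq[OF c(1)] by auto
    fix r assume r: "r \<in> (\<lambda>g. h \<otimes> g) ` C \<and> inv x \<otimes> r \<in> K"
    then obtain c' where c': "c' \<in> C" "r = h \<otimes> c'" by blast
    then show "r = h \<otimes> c" using u[OF c'(1)] eq[OF c'(1)] r by auto
  qed
qed

text \<open>Here normality enters: \<open>inv x \<otimes> (c \<otimes> h)\<close> and
  \<open>h \<otimes> inv x \<otimes> c\<close> are conjugate under \<open>h\<close>, so
  \<open>c \<otimes> h\<close> represents the coset of \<open>x\<close> exactly if \<open>c\<close>
  represents that of \<open>x \<otimes> inv h\<close>.\<close>

lemma representatives_right: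
  assumes C: "representatives C (carrier (G Mod K))" and h: "h \<in> carrier G"
  shows "representatives ((\<lambda>g. g \<otimes> h) ` C) (carrier (G Mod K))"
  unfolding representatives_iff
proof (intro conjI ballI)
  have CG: "C \<subseteq> carrier G" using C by (auto simp: representatives_iff)
  then show "(\<lambda>g. g \<otimes> h) ` C \<subseteq> carrier G" using h by auto
  fix x assume x: "x \<in> carrier G"
  have eq: "inv x \<otimes> (c \<otimes> h) \<in> K \<longleftrightarrow> inv (x \<otimes> inv h) \<otimes> c \<in> K" if "c \<in> C" for c
  proof -
    have c: "c \<in> carrier G" using that CG by auto
    have "h \<otimes> (inv x \<otimes> (c \<otimes> h)) \<otimes> inv h = h \<otimes> inv x \<otimes> c \<otimes> (h \<otimes> inv h)"
      using x h c by (simp only: m_assoc m_closed inv_closed)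
    then have 1: "h \<otimes> (inv x \<otimes> (c \<otimes> h)) \<otimes> inv h = inv (x \<otimes> inv h) \<otimes> c"
      using x h c by (simp add: inv_mult_group)
    have "inv h \<otimes> (inv (x \<otimes> inv h) \<otimes> c) \<otimes> h = inv h \<otimes> h \<otimes> inv x \<otimes> (c \<otimes> h)"
      using x h c by (simp only: inv_mult_group inv_inv m_assoc m_closed inv_closed)
    then have 2: "inv h \<otimes> (inv (x \<otimes> inv h) \<otimes> c) \<otimes> h = inv x \<otimes> (c \<otimes> h)"
      using x h c by simp
    show ?thesis using inv_op_closed2[OF h] inv_op_closed1[OF h] 1 2 by metis
  qed
  have "\<exists>!c. c \<in> C \<and> inv (x \<otimes> inv h) \<otimes> c \<in> K"
    using x h by (intro representativesD[OF C]) simp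
  then obtain c where c: "c \<in> C" "inv (x \<otimes> inv h) \<otimes> c \<in> K"
    and u: "\<And>c'. c' \<in> C \<Longrightarrow> inv (x \<otimes> inv h) \<otimes> c' \<in> K \<Longrightarrow> c' = c"
    by blast
  show "\<exists>!r. r \<in> (\<lambda>g. g \<otimes> h) ` C \<and> inv x \<otimes> r \<in> K"
  proof (rule ex1I)
    show "c \<otimes> h \<in> (\<lambda>g. g \<otimes> h) ` C \<and> inv x \<otimes> (c \<otimes> h) \<in> K" using c eq[OF c(1)] by auto
    fix r assume r: "r \<in> (\<lambda>g. g \<otimes> h) ` C \<and> inv x \<otimes> r \<in> K"
    then obtain c' where c': "c' \<in> C" "r = c' \<otimes> h" by blast
    then show "r = c \<otimes> h" using u[OF c'(1)] eq[OF c'(1)] r by auto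
  qed
qed

lemma mean_left:
  assumes "right_invariant G K f" and "h \<in> carrier G"
  shows "mean (\<lambda>g. f (h \<otimes> g)) = mean f"
proof -
  have inj: "inj_on (\<lambda>g. h \<otimes> g) Cs"
    by (rule inj_on_subset[OF inj_on_cmult[OF assms(2)]]) (use Cs_carrier in blast)
  show ?thesis
    using mean_representatives[OF representatives_left[OF representatives_coset_reps assms(2)] assms(1)]
    by (simp only: sum.reindex[OF inj] card_image[OF inj] coset_mean_def o_def)
qed

lemma mean_right:
  assumes "right_invariant G K f" and "h \<in> carrier G"
  shows "mean (\<lambda>g. f (g \<otimes> h)) = mean f"
proof -
  have inj: "inj_on (\<lambda>g. g \<otimes> h) Cs"
    by (rule inj_on_subset[OF inj_on_multc[OF assms(2)]]) (use Cs_carrier in blast)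
  show ?thesis
    using mean_representatives[OF representatives_right[OF representatives_coset_reps assms(2)] assms(1)]
    by (simp only: sum.reindex[OF inj] card_image[OF inj] coset_mean_def o_def)
qed

lemma mean_cong: "(\<And>g. g \<in> carrier G \<Longrightarrow> f g = f' g) \<Longrightarrow> mean f = mean f'"
  unfolding coset_mean_def using Cs_carrier by (intro arg_cong2[where f = "(*)"] sum.cong) auto

lemma mean_add: "mean (\<lambda>g. f g + f' g) = mean f + mean f'"
  by (simp add: coset_mean_def sum.distrib distrib_left)

lemma mean_diff: "mean (\<lambda>g. f g - f' g) = mean f - mean f'"
  by (simp add: coset_mean_def sum_subtractf right_diff_distrib)

lemma mean_cmult: "mean (\<lambda>g. c * f g) = c * mean f"
  by (simp add: coset_mean_def sum_distrib_left[symmetric])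

lemma mean_multc: "mean (\<lambda>g. f g * c) = mean f * c"
  by (simp add: coset_mean_def sum_distrib_right[symmetric])

lemma mean_sum: "mean (\<lambda>g. \<Sum>i\<in>I. f i g) = (\<Sum>i\<in>I. mean (f i))"
  unfolding coset_mean_def by (subst sum.swap) (simp add: sum_divide_distrib)

lemma mean_cnj: "mean (\<lambda>g. cnj (f g)) = cnj (mean f)"
  by (simp add: coset_mean_def)

lemma mean_const [simp]: "mean (\<lambda>g. c) = c"
  using card_Cs_pos by (auto simp: coset_mean_def)

text \<open>A vanishing sum of squares forces \<open>f\<close> to vanish on the representatives, and
  invariance spreads this to the whole group.\<close>

lemma mean_norm_sq_eq_0:
  assumes "right_invariant G K f" and "mean (\<lambda>g. f g * cnj (f g)) = 0" and x: "x \<in> carrier G"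
  shows "f x = 0"
proof -
  have "complex_of_real (\<Sum>g\<in>Cs. (cmod (f g))\<^sup>2) = 0"
    using assms(2) card_Cs_pos by (auto simp: coset_mean_def complex_norm_square simp del: of_real_power)
  then have "(\<Sum>g\<in>Cs. (cmod (f g))\<^sup>2) = 0" using of_real_eq_0_iff by blast
  then have z: "f g = 0" if "g \<in> Cs" for g using that by (simp add: sum_nonneg_eq_0_iff)
  obtain r where r: "r \<in> Cs" "inv x \<otimes> r \<in> K"
    using representatives_coset_reps x unfolding representatives_iff by blast
  have "r = x \<otimes> (inv x \<otimes> r)" using x r Cs_carrier by (simp add: m_assoc[symmetric])
  then show ?thesis using right_invariantD[OF assms(1) x r(2)] z[OF r(1)] by simp
qed

lemma right_invariant_left_shift:
  assumes "right_invariant G K f" and "h \<in> carrier G"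
  shows "right_invariant G K (\<lambda>g. f (h \<otimes> g))"
  using assms subset unfolding right_invariant_def by (auto simp: m_assoc[symmetric])

text \<open>The period \<open>t\<close> is moved past \<open>h\<close> as
  \<open>t \<otimes> h = h \<otimes> (inv h \<otimes> t \<otimes> h)\<close>, whose second factor is
  again in \<open>K\<close> by normality.\<close>

lemma right_invariant_right_shift:
  assumes f: "right_invariant G K f" and h: "h \<in> carrier G"
  shows "right_invariant G K (\<lambda>g. f (g \<otimes> h))"
  unfolding right_invariant_def
proof (intro ballI)
  fix g t assume g: "g \<in> carrier G" and t: "t \<in> K"
  have tG: "t \<in> carrier G" using t subset by auto
  have "g \<otimes> h \<otimes> (inv h \<otimes> t \<otimes> h) = g \<otimes> (h \<otimes> inv h) \<otimes> t \<otimes> h"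
    using g h tG by (simp only: m_assoc m_closed inv_closed)
  then have "g \<otimes> h \<otimes> (inv h \<otimes> t \<otimes> h) = g \<otimes> t \<otimes> h" using g h tG by simp
  then show "f (g \<otimes> h) = f (g \<otimes> t \<otimes> h)"
    using right_invariantD[OF f, of "g \<otimes> h" "inv h \<otimes> t \<otimes> h"] inv_op_closed1[OF h t] g h by simp
qed

end

text \<open>The mean of a \<open>K\<close>-invariant function over \<open>G/L\<close> is, by invariance, the mean over \<open>G/L\<close>
  of its means over right translates by representatives of \<open>G/K\<close>, and the latter are constant.\<close>

lemma coset_mean_subset:
  assumes "finite_index_normal K G" and "finite_index_normal L G" and "L \<subseteq> K"
    and f: "right_invariant G K f"
  shows "coset_mean G L f = coset_mean G K f"
proof -
  interpret K: finite_index_normal K G by fact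
  interpret L: finite_index_normal L G by fact
  have fL: "right_invariant G L f" by (rule right_invariant_subset[OF f \<open>L \<subseteq> K\<close>])
  have "K.mean (\<lambda>h. L.mean (\<lambda>g. f (g \<otimes>\<^bsub>G\<^esub> h))) = K.mean (\<lambda>h. L.mean f)"
    by (rule K.mean_cong) (rule L.mean_right[OF fL])
  moreover have "L.mean (\<lambda>g. K.mean (\<lambda>h. f (g \<otimes>\<^bsub>G\<^esub> h))) = L.mean (\<lambda>g. K.mean f)"
    by (rule L.mean_cong) (rule K.mean_left[OF f])
  moreover have "K.mean (\<lambda>h. L.mean (\<lambda>g. f (g \<otimes>\<^bsub>G\<^esub> h))) = L.mean (\<lambda>g. K.mean (\<lambda>h. f (g \<otimes>\<^bsub>G\<^esub> h)))"
    unfolding coset_mean_def sum_distrib_left by (subst sum.swap) (simp add: mult_ac)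
  ultimately show ?thesis by simp
qed

section \<open>Schur orthogonality\<close>

lemma mat_adjoint_dim [simp]: "dim_row (mat_adjoint A) = dim_col A" "dim_col (mat_adjoint A) = dim_row A"
  unfolding mat_adjoint_def by auto

lemma mat_adjoint_carrier [simp]: "A \<in> carrier_mat m n \<Longrightarrow> mat_adjoint A \<in> carrier_mat n m"
  unfolding mat_adjoint_def by auto

lemma mat_adjoint_index [simp]:
  fixes A :: "complex mat"
  assumes "A \<in> carrier_mat m n" and "i < n" and "j < m"
  shows "mat_adjoint A $$ (i, j) = cnj (A $$ (j, i))"
  using assms unfolding mat_adjoint_def by (auto simp: mat_of_rows_index)

lemma mat_mult_index:
  assumes "A \<in> carrier_mat m n" "B \<in> carrier_mat n k" "i < m" "j < k"
  shows "(A * B) $$ (i, j) = (\<Sum>l<n. A $$ (i, l) * B $$ (l, j))"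
  using assms by (simp add: scalar_prod_def lessThan_atLeast0)

lemma mat_adjoint_adjoint [simp]:
  fixes A :: "complex mat"
  assumes A: "A \<in> carrier_mat m n"
  shows "mat_adjoint (mat_adjoint A) = A"
  by (rule eq_matI) (use A mat_adjoint_carrier[OF A] in \<open>auto simp: mat_adjoint_index[of _ n m]\<close>)

lemma mat_adjoint_mult:
  fixes A B :: "complex mat"
  assumes A: "A \<in> carrier_mat m n" and B: "B \<in> carrier_mat n k"
  shows "mat_adjoint (A * B) = mat_adjoint B * mat_adjoint A"
proof (rule eq_matI)
  note c = mat_adjoint_carrier[OF A] mat_adjoint_carrier[OF B] mat_adjoint_carrier[OF mult_carrier_mat[OF A B]]
  fix i j assume "i < dim_row (mat_adjoint B * mat_adjoint A)" "j < dim_col (mat_adjoint B * mat_adjoint A)"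
  then have ij: "i < k" "j < m" using c by auto
  have "mat_adjoint (A * B) $$ (i, j) = cnj ((A * B) $$ (j, i))"
    by (rule mat_adjoint_index) (use A B ij in auto)
  also have "\<dots> = (\<Sum>l<n. mat_adjoint B $$ (i, l) * mat_adjoint A $$ (l, j))"
    using ij by (simp add: mat_mult_index[OF A B] mat_adjoint_index[OF A] mat_adjoint_index[OF B] mult.commute)
  also have "\<dots> = (mat_adjoint B * mat_adjoint A) $$ (i, j)"
    using ij by (simp add: mat_mult_index[OF c(2,1)])
  finally show "mat_adjoint (A * B) $$ (i, j) = (mat_adjoint B * mat_adjoint A) $$ (i, j)" .
qed (use A B mat_adjoint_carrier[OF A] mat_adjoint_carrier[OF B] mat_adjoint_carrier[OF mult_carrier_mat[OF A B]] in auto)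

lemma unitary_group_iff:
  "U \<in> carrier (unitary_group n) \<longleftrightarrow> U \<in> carrier_mat n n \<and> mat_adjoint U * U = 1\<^sub>m n"
  by (simp add: unitary_group_def)

lemma unitary_mult_adjoint:
  assumes "U \<in> carrier (unitary_group n)"
  shows "U * mat_adjoint U = 1\<^sub>m n"
proof -
  have U: "U \<in> carrier_mat n n" "mat_adjoint U * U = 1\<^sub>m n" using assms by (auto simp: unitary_group_iff)
  show ?thesis by (rule mat_mult_left_right_inverse[OF mat_adjoint_carrier[OF U(1)] U])
qed

lemma subspace_vec_iff:
  fixes W :: "complex vec set"
  shows "VectorSpace.subspace class_ring W (module_vec TYPE(complex) n) \<longleftrightarrow>
    W \<subseteq> carrier_vec n \<and> 0\<^sub>v n \<in> W \<and> (\<forall>v\<in>W. \<forall>w\<in>W. v + w \<in> W) \<and> (\<forall>c. \<forall>v\<in>W. c \<cdot>\<^sub>v v \<in> W)"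
proof -
  interpret V: vec_space "TYPE(complex)" n .
  have "VectorSpace.subspace class_ring W (module_vec TYPE(complex) n) \<longleftrightarrow>
      submodule class_ring W (module_vec TYPE(complex) n)"
    unfolding VectorSpace.subspace_def using V.vectorspace_axioms by blast
  also have "\<dots> \<longleftrightarrow> W \<subseteq> carrier_vec n \<and> 0\<^sub>v n \<in> W \<and> (\<forall>v\<in>W. \<forall>w\<in>W. v + w \<in> W) \<and> (\<forall>c. \<forall>v\<in>W. c \<cdot>\<^sub>v v \<in> W)"
    unfolding submodule_def using V.module_axioms by (auto simp: module_vec_def)
  finally show ?thesis .
qed

section \<open>Unitary representations and Schur's lemma\<close>

context group
begin

lemma unitary_rep_carrier: "unitary_rep G n \<rho> \<Longrightarrow> g \<in> carrier G \<Longrightarrow> \<rho> g \<in> carrier_mat n n"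
  by (auto simp: unitary_rep_def hom_def unitary_group_def Pi_def)

lemma unitary_rep_unitary: "unitary_rep G n \<rho> \<Longrightarrow> g \<in> carrier G \<Longrightarrow> \<rho> g \<in> carrier (unitary_group n)"
  by (auto simp: unitary_rep_def hom_def Pi_def)

lemma unitary_rep_mult:
  "unitary_rep G n \<rho> \<Longrightarrow> g \<in> carrier G \<Longrightarrow> h \<in> carrier G \<Longrightarrow> \<rho> (g \<otimes> h) = \<rho> g * \<rho> h"
  by (auto simp: unitary_rep_def hom_def unitary_group_def)

text \<open>An idempotent with a left inverse, here its adjoint, is the identity.\<close>

lemma unitary_rep_one:
  assumes "unitary_rep G n \<rho>"
  shows "\<rho> \<one> = 1\<^sub>m n"
proof -
  have c: "\<rho> \<one> \<in> carrier_mat n n" "mat_adjoint (\<rho> \<one>) * \<rho> \<one> = 1\<^sub>m n"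
    using unitary_rep_unitary[OF assms one_closed] by (auto simp: unitary_group_iff)
  have "\<rho> \<one> = mat_adjoint (\<rho> \<one>) * \<rho> \<one> * \<rho> \<one>" using c by simp
  also have "\<dots> = mat_adjoint (\<rho> \<one>) * (\<rho> \<one> * \<rho> \<one>)"
    using c by (intro assoc_mult_mat[of _ n n _ n _ n]) auto
  also have "\<rho> \<one> * \<rho> \<one> = \<rho> \<one>" using unitary_rep_mult[OF assms one_closed one_closed] by simp
  finally show ?thesis using c by simp
qed

lemma unitary_rep_inv:
  assumes \<rho>: "unitary_rep G n \<rho>" and g: "g \<in> carrier G"
  shows "\<rho> (inv g) = mat_adjoint (\<rho> g)"
proof -
  have c: "\<rho> g \<in> carrier_mat n n" "mat_adjoint (\<rho> g) * \<rho> g = 1\<^sub>m n"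
    using unitary_rep_unitary[OF assms] by (auto simp: unitary_group_iff)
  have i: "\<rho> (inv g) \<in> carrier_mat n n" using unitary_rep_carrier[OF \<rho>] g by simp
  have "\<rho> g * \<rho> (inv g) = 1\<^sub>m n"
    using unitary_rep_mult[OF \<rho> g, of "inv g"] g unitary_rep_one[OF \<rho>] by simp
  then have "mat_adjoint (\<rho> g) = mat_adjoint (\<rho> g) * (\<rho> g * \<rho> (inv g))"
    using c by (simp add: right_mult_one_mat')
  also have "\<dots> = mat_adjoint (\<rho> g) * \<rho> g * \<rho> (inv g)"
    using c i by (intro assoc_mult_mat[symmetric, of _ n n _ n _ n]) auto
  finally show ?thesis using c i by simp
qed

lemma rep_dim_unitary_rep: "unitary_rep G n \<rho> \<Longrightarrow> rep_dim G \<rho> = n"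
  by (simp add: rep_dim_def unitary_rep_one)

lemma unitary_rep_mult_index:
  assumes "unitary_rep G n \<rho>" "g \<in> carrier G" "h \<in> carrier G" "i < n" "j < n"
  shows "\<rho> (g \<otimes> h) $$ (i, j) = (\<Sum>k<n. \<rho> g $$ (i, k) * \<rho> h $$ (k, j))"
  using assms by (simp add: unitary_rep_mult mat_mult_index[of _ n n _ n] unitary_rep_carrier)

lemma unitary_rep_inv_index:
  assumes "unitary_rep G n \<rho>" "g \<in> carrier G" "i < n" "j < n"
  shows "\<rho> (inv g) $$ (i, j) = cnj (\<rho> g $$ (j, i))"
  using assms by (simp add: unitary_rep_inv mat_adjoint_index[of _ n n] unitary_rep_carrier)

lemma unitary_rep_orthonormal_rows:
  assumes "unitary_rep G n \<rho>" "g \<in> carrier G" "i < n" "j < n"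
  shows "(\<Sum>k<n. \<rho> g $$ (i, k) * cnj (\<rho> g $$ (j, k))) = (if i = j then 1 else 0)"
proof -
  have "(\<Sum>k<n. \<rho> g $$ (i, k) * cnj (\<rho> g $$ (j, k))) = \<rho> (g \<otimes> inv g) $$ (i, j)"
    by (subst unitary_rep_mult_index[OF assms(1,2)]) (use assms in \<open>simp_all add: unitary_rep_inv_index\<close>)
  then show ?thesis using assms by (simp add: unitary_rep_one)
qed

text \<open>Over the complex numbers \<open>P\<close> has an eigenvalue. Its eigenspace is nonzero
  and stable under \<rho> because \<open>P\<close> commutes with \<rho>, so by irreducibility it is
  the whole space.\<close>

lemma irreducible_commuting_scalar:
  assumes irr: "irreducible_rep G n \<rho>" and P: "P \<in> carrier_mat n n"
    and comm: "\<And>g. g \<in> carrier G \<Longrightarrow> P * \<rho> g = \<rho> g * P"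
  obtains c where "P = c \<cdot>\<^sub>m 1\<^sub>m n"
proof -
  have \<rho>: "unitary_rep G n \<rho>" and n: "n \<ge> 1" using irr by (auto simp: irreducible_rep_def)
  obtain c where "eigenvalue P c"
    using spectrum_non_empty[OF P] n by (auto simp: spectrum_def)
  then obtain v where v: "v \<in> carrier_vec n" "v \<noteq> 0\<^sub>v n" "P *\<^sub>v v = c \<cdot>\<^sub>v v"
    using P by (auto simp: eigenvalue_def eigenvector_def)
  define W where "W = {w \<in> carrier_vec n. P *\<^sub>v w = c \<cdot>\<^sub>v w}"
  have "P *\<^sub>v 0\<^sub>v n = 0\<^sub>v n" using P by (intro eq_vecI) auto
  then have "VectorSpace.subspace class_ring W (module_vec TYPE(complex) n)"
    using P by (auto simp: subspace_vec_iff W_def mult_add_distrib_mat_vec[of _ n n]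
        smult_add_distrib_vec[of _ n] mult_mat_vec[of _ n n] smult_smult_assoc mult.commute)
  moreover have "\<rho> g *\<^sub>v w \<in> W" if g: "g \<in> carrier G" and w: "w \<in> W" for g w
  proof -
    have wc: "w \<in> carrier_vec n" "P *\<^sub>v w = c \<cdot>\<^sub>v w" using w by (auto simp: W_def)
    have \<rho>g: "\<rho> g \<in> carrier_mat n n" by (rule unitary_rep_carrier[OF \<rho> g])
    have "P *\<^sub>v (\<rho> g *\<^sub>v w) = (P * \<rho> g) *\<^sub>v w"
      using P \<rho>g wc by (simp add: assoc_mult_mat_vec[of _ n n _ n])
    also have "\<dots> = \<rho> g *\<^sub>v (P *\<^sub>v w)"
      using P \<rho>g wc comm[OF g] by (simp add: assoc_mult_mat_vec[of _ n n _ n])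
    also have "\<dots> = c \<cdot>\<^sub>v (\<rho> g *\<^sub>v w)" using \<rho>g wc by (simp add: mult_mat_vec[of _ n n])
    finally show ?thesis using \<rho>g wc by (simp add: W_def)
  qed
  ultimately have "W = {0\<^sub>v n} \<or> W = carrier_vec n"
    using irr unfolding irreducible_rep_def by blast
  moreover have "v \<in> W" using v by (simp add: W_def)
  ultimately have W: "W = carrier_vec n" using v by auto
  have "P = c \<cdot>\<^sub>m 1\<^sub>m n"
  proof (rule eq_matI)
    fix i j assume "i < dim_row (c \<cdot>\<^sub>m 1\<^sub>m n)" "j < dim_col (c \<cdot>\<^sub>m 1\<^sub>m n)"
    then have ij: "i < n" "j < n" by auto
    have "unit_vec n j \<in> W" using W by simp
    then have "(P *\<^sub>v unit_vec n j) $ i = (c \<cdot>\<^sub>v unit_vec n j) $ i" by (simp add: W_def)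
    then show "P $$ (i, j) = (c \<cdot>\<^sub>m 1\<^sub>m n) $$ (i, j)"
      using ij P by (simp add: scalar_prod_right_unit)
  qed (use P in auto)
  then show ?thesis using that by blast
qed

text \<open>For an intertwiner \<open>P\<close> both \<open>P P\<^sup>*\<close> and \<open>P\<^sup>* P\<close> are scalar; comparing
  \<open>P P\<^sup>* P\<close> and the traces shows that \<open>P\<close> is zero or a multiple of a unitary matrix.\<close>

lemma irreducible_intertwiner:
  assumes irr: "irreducible_rep G n \<rho>" "irreducible_rep G k \<sigma>" and P: "P \<in> carrier_mat n k"
    and comm: "\<And>g. g \<in> carrier G \<Longrightarrow> \<rho> g * P = P * \<sigma> g"
    and neq: "(\<rho>, \<sigma>) \<notin> unitary_equivalence G"
  shows "P = 0\<^sub>m n k"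
proof (rule ccontr)
  assume nz: "P \<noteq> 0\<^sub>m n k"
  have \<rho>: "unitary_rep G n \<rho>" and \<sigma>: "unitary_rep G k \<sigma>" using irr by (auto simp: irreducible_rep_def)
  note c\<rho> = unitary_rep_carrier[OF \<rho>] and c\<sigma> = unitary_rep_carrier[OF \<sigma>]
  let ?P = "mat_adjoint P"
  note P' = mat_adjoint_carrier[OF P]
  \<comment> \<open>The adjoint of the intertwining relation at \<open>inv g\<close>, where
    unitarity turns adjoints into values at \<open>g\<close>.\<close>
  have comm': "\<sigma> g * ?P = ?P * \<rho> g" if g: "g \<in> carrier G" for g
  proof -
    have "mat_adjoint (\<rho> (inv g) * P) = mat_adjoint (P * \<sigma> (inv g))"
      using comm[of "inv g"] g by simp
    then have "?P * mat_adjoint (\<rho> (inv g)) = mat_adjoint (\<sigma> (inv g)) * ?P"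
      using g by (simp add: mat_adjoint_mult[OF c\<rho> P] mat_adjoint_mult[OF P c\<sigma>])
    then show ?thesis
      using unitary_rep_inv[OF \<rho>, of "inv g"] unitary_rep_inv[OF \<sigma>, of "inv g"] g by simp
  qed
  have "P * ?P * \<rho> g = \<rho> g * (P * ?P)" if g: "g \<in> carrier G" for g
  proof -
    have "P * ?P * \<rho> g = P * (?P * \<rho> g)"
      by (rule assoc_mult_mat[OF P P' c\<rho>[OF g]])
    also have "\<dots> = P * (\<sigma> g * ?P)" by (simp add: comm'[OF g])
    also have "\<dots> = P * \<sigma> g * ?P" by (rule assoc_mult_mat[OF P c\<sigma>[OF g] P', symmetric])
    also have "\<dots> = \<rho> g * P * ?P" by (simp add: comm[OF g])
    also have "\<dots> = \<rho> g * (P * ?P)" by (rule assoc_mult_mat[OF c\<rho>[OF g] P P'])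
    finally show ?thesis .
  qed
  then obtain a where a: "P * ?P = a \<cdot>\<^sub>m 1\<^sub>m n"
    using irreducible_commuting_scalar[OF irr(1) mult_carrier_mat[OF P P']] by blast
  have "?P * P * \<sigma> g = \<sigma> g * (?P * P)" if g: "g \<in> carrier G" for g
  proof -
    have "?P * P * \<sigma> g = ?P * (P * \<sigma> g)"
      by (rule assoc_mult_mat[OF P' P c\<sigma>[OF g]])
    also have "\<dots> = ?P * (\<rho> g * P)" by (simp add: comm[OF g])
    also have "\<dots> = ?P * \<rho> g * P" by (rule assoc_mult_mat[OF P' c\<rho>[OF g] P, symmetric])
    also have "\<dots> = \<sigma> g * ?P * P" by (simp add: comm'[OF g])
    also have "\<dots> = \<sigma> g * (?P * P)" by (rule assoc_mult_mat[OF c\<sigma>[OF g] P' P])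
    finally show ?thesis .
  qed
  then obtain b where b: "?P * P = b \<cdot>\<^sub>m 1\<^sub>m k"
    using irreducible_commuting_scalar[OF irr(2) mult_carrier_mat[OF P' P]] by blast
  obtain i0 j0 where ij0: "i0 < n" "j0 < k" "P $$ (i0, j0) \<noteq> 0"
    using nz P by (metis eq_matI index_zero_mat carrier_matD)
  \<comment> \<open>\<open>b\<close> is the squared norm of a nonzero column of \<open>P\<close>,
    hence real and positive; this is what permits normalizing \<open>P\<close> below.\<close>
  have b_eq: "b = of_real (\<Sum>l<n. (cmod (P $$ (l, j0)))\<^sup>2)"
  proof -
    have "b = (?P * P) $$ (j0, j0)" using ij0 by (simp add: b)
    also have "\<dots> = (\<Sum>l<n. cnj (P $$ (l, j0)) * P $$ (l, j0))"
      using ij0 by (simp add: mat_mult_index[OF P' P] mat_adjoint_index[OF P])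
    finally show ?thesis by (simp add: complex_norm_square mult.commute del: of_real_power)
  qed
  define B where "B = (\<Sum>l<n. (cmod (P $$ (l, j0)))\<^sup>2)"
  have B: "B > 0"
  proof -
    have "0 < (cmod (P $$ (i0, j0)))\<^sup>2" using ij0 by simp
    also have "\<dots> \<le> B" unfolding B_def using ij0 by (intro member_le_sum) auto
    finally show ?thesis .
  qed
  have b': "b = of_real B" by (simp add: b_eq B_def)
  have "a \<cdot>\<^sub>m P = b \<cdot>\<^sub>m P"
  proof -
    have "a \<cdot>\<^sub>m P = a \<cdot>\<^sub>m 1\<^sub>m n * P" using P by (simp add: mult_smult_assoc_mat[OF one_carrier_mat P])
    also have "\<dots> = P * (?P * P)" unfolding a[symmetric] by (rule assoc_mult_mat[OF P P' P])
    also have "\<dots> = b \<cdot>\<^sub>m P" using P by (simp add: b mult_smult_distrib[OF P one_carrier_mat])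
    finally show ?thesis .
  qed
  then have "(a \<cdot>\<^sub>m P) $$ (i0, j0) = (b \<cdot>\<^sub>m P) $$ (i0, j0)" by simp
  then have ab: "a = b" using ij0 P by simp
  \<comment> \<open>Equal traces give n a = k b; as a = b is nonzero, \<open>P\<close> is
    square.\<close>
  have "(\<Sum>i<n. (P * ?P) $$ (i, i)) = (\<Sum>j<k. (?P * P) $$ (j, j))"
  proof -
    have "(\<Sum>i<n. (P * ?P) $$ (i, i)) = (\<Sum>i<n. \<Sum>j<k. P $$ (i, j) * cnj (P $$ (i, j)))"
      by (simp add: mat_mult_index[OF P P'] mat_adjoint_index[OF P])
    also have "\<dots> = (\<Sum>j<k. \<Sum>i<n. P $$ (i, j) * cnj (P $$ (i, j)))" by (rule sum.swap)
    also have "\<dots> = (\<Sum>j<k. (?P * P) $$ (j, j))"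
      by (simp add: mat_mult_index[OF P' P] mat_adjoint_index[OF P] mult.commute)
    finally show ?thesis .
  qed
  then have "of_nat n * a = of_nat k * b" by (simp add: a b)
  then have nk: "n = k" using ab b' B by simp
  \<comment> \<open>With s^2 = 1 / B the product of the adjoint of \<open>U\<close> with
    \<open>U\<close> becomes s^2 b = 1 times the identity.\<close>
  define s where "s = 1 / sqrt B"
  have ss: "s * s = 1 / B" using B by (simp add: s_def)
  define U where "U = complex_of_real s \<cdot>\<^sub>m P"
  have Pn: "P \<in> carrier_mat n n" "?P \<in> carrier_mat n n" using P P' nk by auto
  have Uc: "U \<in> carrier_mat n n" using Pn by (simp add: U_def)
  have U': "mat_adjoint U = complex_of_real s \<cdot>\<^sub>m ?P"
    using Pn Uc mat_adjoint_carrier[OF Uc]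
    by (intro eq_matI) (auto simp: mat_adjoint_index[OF Uc] mat_adjoint_index[OF Pn(1)], simp add: U_def)
  have "mat_adjoint U * U = 1\<^sub>m n"
  proof (rule eq_matI)
    fix i j assume ij: "i < dim_row (1\<^sub>m n :: complex mat)" "j < dim_col (1\<^sub>m n :: complex mat)"
    have "(mat_adjoint U * U) $$ (i, j) = (\<Sum>l<n. mat_adjoint U $$ (i, l) * U $$ (l, j))"
      using ij by (simp add: mat_mult_index[OF mat_adjoint_carrier[OF Uc] Uc])
    also have "\<dots> = (\<Sum>l<n. complex_of_real (s * s) * (?P $$ (i, l) * P $$ (l, j)))"
      unfolding U' unfolding U_def using ij Pn by (intro sum.cong) auto
    also have "\<dots> = complex_of_real (s * s) * (?P * P) $$ (i, j)"
      using ij by (simp add: mat_mult_index[OF Pn(2,1)] sum_distrib_left)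
    also have "s * s = 1 / B" by (rule ss)
    also have "complex_of_real (1 / B) * (?P * P) $$ (i, j) = (1\<^sub>m n :: complex mat) $$ (i, j)"
      using ij B nk by (simp add: b b')
    finally show "(mat_adjoint U * U) $$ (i, j) = (1\<^sub>m n :: complex mat) $$ (i, j)" .
  qed (use Uc mat_adjoint_carrier[OF Uc] in auto)
  then have U: "U \<in> carrier (unitary_group n)" using Uc by (simp add: unitary_group_iff)
  have "\<sigma> g = mat_adjoint U * \<rho> g * U" if g: "g \<in> carrier G" for g
  proof -
    have \<sigma>g: "\<sigma> g \<in> carrier_mat n n" "\<rho> g \<in> carrier_mat n n" using c\<sigma>[OF g] c\<rho>[OF g] nk by auto
    have "\<rho> g * U = U * \<sigma> g"
      using comm[OF g] Pn \<sigma>g by (simp add: U_def mult_smult_distrib[of _ n n _ n] mult_smult_assoc_mat[of _ n n _ n])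
    then have "mat_adjoint U * (\<rho> g * U) = mat_adjoint U * U * \<sigma> g"
      using assoc_mult_mat[OF mat_adjoint_carrier[OF Uc] Uc \<sigma>g(1)] by simp
    then show ?thesis
      using U \<sigma>g assoc_mult_mat[OF mat_adjoint_carrier[OF Uc] \<sigma>g(2) Uc] by (simp add: unitary_group_iff)
  qed
  then have "(\<rho>, \<sigma>) \<in> unitary_equivalence G"
    using \<rho> \<sigma> U nk by (auto simp: unitary_equivalence_def)
  then show False using neq by blast
qed

end

section \<open>Orthogonality relations for matrix coefficients\<close>

context finite_index_normal
begin

text \<open>\<open>P\<close> is the mean of \<open>\<rho> g * E * mat_adjoint (\<sigma> g)\<close>,
  where \<open>E\<close> is the matrix unit at (j, b). Averaging over the group makes any such
  matrix an intertwiner; for matrix units the entries are the means to be computed.\<close>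

lemma mean_coeff_intertwines:
  assumes \<rho>: "unitary_rep G n \<rho>" "right_invariant G K \<rho>" and \<sigma>: "unitary_rep G k \<sigma>" "right_invariant G K \<sigma>"
    and j: "j < n" and b: "b < k" and h: "h \<in> carrier G"
  defines "P \<equiv> mat n k (\<lambda>(i, a). mean (\<lambda>g. \<rho> g $$ (i, j) * cnj (\<sigma> g $$ (a, b))))"
  shows "\<rho> h * P = P * \<sigma> h"
proof (rule eq_matI)
  have P: "P \<in> carrier_mat n k" by (simp add: P_def)
  have P_index: "P $$ (l, m) = mean (\<lambda>g. \<rho> g $$ (l, j) * cnj (\<sigma> g $$ (m, b)))" if "l < n" "m < k" for l m
    using that by (simp add: P_def)
  note c = unitary_rep_carrier[OF \<rho>(1) h] unitary_rep_carrier[OF \<sigma>(1) h]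
  fix i a assume "i < dim_row (P * \<sigma> h)" "a < dim_col (P * \<sigma> h)"
  then have ia: "i < n" "a < k" using P c by auto
  \<comment> \<open>Chosen such that \<open>f (h \<otimes> g)\<close> averages to the entry of
    \<open>\<rho> h * P\<close> and \<open>f g\<close> to that of \<open>P * \<sigma> h\<close>;
    left invariance of the mean then equates them.\<close>
  define f where "f g = \<rho> g $$ (i, j) * cnj (\<sigma> (inv h \<otimes> g) $$ (a, b))" for g
  have f: "right_invariant G K f"
    unfolding right_invariant_def f_def
  proof (intro ballI)
    fix g t assume gt: "g \<in> carrier G" "t \<in> K"
    show "\<rho> g $$ (i, j) * cnj (\<sigma> (inv h \<otimes> g) $$ (a, b))
        = \<rho> (g \<otimes> t) $$ (i, j) * cnj (\<sigma> (inv h \<otimes> (g \<otimes> t)) $$ (a, b))"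
      using right_invariantD[OF \<rho>(2) gt]
        right_invariantD[OF right_invariant_left_shift[OF \<sigma>(2) inv_closed[OF h]] gt] by simp
  qed
  have "(\<rho> h * P) $$ (i, a) = (\<Sum>l<n. mean (\<lambda>g. \<rho> h $$ (i, l) * (\<rho> g $$ (l, j) * cnj (\<sigma> g $$ (a, b)))))"
    using ia by (simp add: mat_mult_index[OF c(1) P] P_index mean_cmult)
  also have "\<dots> = mean (\<lambda>g. f (h \<otimes> g))"
    unfolding mean_sum[symmetric]
  proof (rule mean_cong)
    fix g assume g: "g \<in> carrier G"
    have "inv h \<otimes> (h \<otimes> g) = g" using g h by (simp add: m_assoc[symmetric])
    then show "(\<Sum>l<n. \<rho> h $$ (i, l) * (\<rho> g $$ (l, j) * cnj (\<sigma> g $$ (a, b)))) = f (h \<otimes> g)"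
      using g h ia j unitary_rep_mult_index[OF \<rho>(1) h g ia(1) j]
      by (simp add: f_def sum_distrib_right mult.assoc)
  qed
  also have "\<dots> = mean f" by (rule mean_left[OF f h])
  also have "\<dots> = (\<Sum>l<k. mean (\<lambda>g. \<rho> g $$ (i, j) * cnj (\<sigma> g $$ (l, b)) * \<sigma> h $$ (l, a)))"
    unfolding mean_sum[symmetric]
  proof (rule mean_cong)
    fix g assume g: "g \<in> carrier G"
    have "cnj (\<sigma> (inv h \<otimes> g) $$ (a, b)) = (\<Sum>l<k. \<sigma> h $$ (l, a) * cnj (\<sigma> g $$ (l, b)))"
      using unitary_rep_mult_index[OF \<sigma>(1) inv_closed[OF h] g ia(2) b] unitary_rep_inv_index[OF \<sigma>(1) h ia(2)]
      by simp
    then show "f g = (\<Sum>l<k. \<rho> g $$ (i, j) * cnj (\<sigma> g $$ (l, b)) * \<sigma> h $$ (l, a))"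
      by (simp add: f_def sum_distrib_left mult_ac)
  qed
  also have "\<dots> = (P * \<sigma> h) $$ (i, a)"
    using ia by (simp add: mat_mult_index[OF P c(2)] P_index mean_multc)
  finally show "(\<rho> h * P) $$ (i, a) = (P * \<sigma> h) $$ (i, a)" .
qed (use unitary_rep_carrier[OF \<rho>(1) h] unitary_rep_carrier[OF \<sigma>(1) h] in \<open>auto simp: P_def\<close>)

lemma schur_orthogonality_inequivalent:
  assumes \<rho>: "irreducible_rep G n \<rho>" "right_invariant G K \<rho>" and \<sigma>: "irreducible_rep G k \<sigma>" "right_invariant G K \<sigma>"
    and "(\<rho>, \<sigma>) \<notin> unitary_equivalence G" and "i < n" "j < n" "a < k" "b < k"
  shows "mean (\<lambda>g. \<rho> g $$ (i, j) * cnj (\<sigma> g $$ (a, b))) = 0"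
proof -
  have u: "unitary_rep G n \<rho>" "unitary_rep G k \<sigma>" using \<rho> \<sigma> by (auto simp: irreducible_rep_def)
  define P where "P = mat n k (\<lambda>(i, a). mean (\<lambda>g. \<rho> g $$ (i, j) * cnj (\<sigma> g $$ (a, b))))"
  have "P = 0\<^sub>m n k"
    using mean_coeff_intertwines[OF u(1) \<rho>(2) u(2) \<sigma>(2)] assms
    by (intro irreducible_intertwiner[OF \<rho>(1) \<sigma>(1)]) (auto simp: P_def)
  then have "P $$ (i, a) = 0" using assms by simp
  then show ?thesis using assms by (simp add: P_def)
qed

text \<open>The averaged intertwiner is a scalar \<open>c\<close> by Schur's lemma. Its trace n c is
  the mean of the inner product of columns \<open>j\<close> and \<open>b\<close> of a unitary
  matrix, which determines \<open>c\<close>.\<close>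

lemma schur_orthogonality:
  assumes \<rho>: "irreducible_rep G n \<rho>" "right_invariant G K \<rho>" and ij: "i < n" "j < n" "a < n" "b < n"
  shows "mean (\<lambda>g. \<rho> g $$ (i, j) * cnj (\<rho> g $$ (a, b))) = (if i = a \<and> j = b then 1 / of_nat n else 0)"
proof -
  have u: "unitary_rep G n \<rho>" using \<rho> by (auto simp: irreducible_rep_def)
  define P where "P = mat n n (\<lambda>(i, a). mean (\<lambda>g. \<rho> g $$ (i, j) * cnj (\<rho> g $$ (a, b))))"
  have Pc: "P \<in> carrier_mat n n" by (simp add: P_def)
  have "P * \<rho> g = \<rho> g * P" if "g \<in> carrier G" for g
    unfolding P_def by (rule mean_coeff_intertwines[OF u \<rho>(2) u \<rho>(2) ij(2,4) that, symmetric])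
  then obtain c where c: "P = c \<cdot>\<^sub>m 1\<^sub>m n"
    using irreducible_commuting_scalar[OF \<rho>(1) Pc] by blast
  have "of_nat n * c = (\<Sum>l<n. P $$ (l, l))" by (simp add: c)
  also have "\<dots> = mean (\<lambda>g. \<Sum>l<n. \<rho> g $$ (l, j) * cnj (\<rho> g $$ (l, b)))"
    unfolding mean_sum by (simp add: P_def)
  also have "\<dots> = mean (\<lambda>g. if j = b then 1 else 0)"
  proof (rule mean_cong)
    fix g assume g: "g \<in> carrier G"
    \<comment> \<open>Columns of \<open>\<rho> g\<close> are conjugated rows of
      \<open>\<rho> (inv g)\<close>, so orthonormality of rows applies.\<close>
    have "(\<Sum>l<n. \<rho> g $$ (l, j) * cnj (\<rho> g $$ (l, b)))
        = (\<Sum>l<n. \<rho> (inv g) $$ (b, l) * cnj (\<rho> (inv g) $$ (j, l)))"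
      using ij g by (simp add: unitary_rep_inv_index[OF u] mult.commute)
    also have "\<dots> = (if b = j then 1 else 0)" by (rule unitary_rep_orthonormal_rows[OF u]) (use ij g in auto)
    finally show "(\<Sum>l<n. \<rho> g $$ (l, j) * cnj (\<rho> g $$ (l, b))) = (if j = b then 1 else 0)" by simp
  qed
  finally have "of_nat n * c = (if j = b then 1 else 0)" by simp
  then have "c = (if j = b then 1 / of_nat n else 0)"
    using ij by (auto simp: field_simps split: if_splits)
  moreover have "mean (\<lambda>g. \<rho> g $$ (i, j) * cnj (\<rho> g $$ (a, b))) = P $$ (i, a)"
    using ij by (simp add: P_def)
  ultimately show ?thesis using ij by (simp add: c)
qed

end

section \<open>Completeness of the matrix coefficients\<close>

context finite_index_normal
begin

lemma right_invariant_mult_cnj: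
  assumes "right_invariant G K f" and "right_invariant G K h"
  shows "right_invariant G K (\<lambda>g. f g * cnj (h g))"
  unfolding right_invariant_def
proof (intro ballI)
  fix g t assume gt: "g \<in> carrier G" "t \<in> K"
  show "f g * cnj (h g) = f (g \<otimes> t) * cnj (h (g \<otimes> t))"
    using right_invariantD[OF assms(1) gt] right_invariantD[OF assms(2) gt] by simp
qed

definition ip :: "('a \<Rightarrow> complex) \<Rightarrow> ('a \<Rightarrow> complex) \<Rightarrow> complex" where
  "ip f h = mean (\<lambda>g. f g * cnj (h g))"

lemma ip_sum_left: "ip (\<lambda>g. \<Sum>i\<in>I. c i * f i g) h = (\<Sum>i\<in>I. c i * ip (f i) h)"
proof -
  have "ip (\<lambda>g. \<Sum>i\<in>I. c i * f i g) h = mean (\<lambda>g. \<Sum>i\<in>I. c i * (f i g * cnj (h g)))"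
    by (simp add: ip_def sum_distrib_right mult.assoc)
  then show ?thesis by (simp add: mean_sum mean_cmult ip_def)
qed

lemma ip_commute: "ip h f = cnj (ip f h)"
  by (simp add: ip_def mean_cnj[symmetric] mult.commute)

lemma ip_cong: "(\<And>g. g \<in> carrier G \<Longrightarrow> f g = f' g) \<Longrightarrow> ip f h = ip f' h"
  unfolding ip_def by (intro mean_cong) simp

lemma ip_self: "ip f f = of_real ((\<Sum>g\<in>Cs. (cmod (f g))\<^sup>2) / card Cs)"
  by (simp add: ip_def coset_mean_def complex_norm_square del: of_real_power)

text \<open>Spaces of functions on G/K that are stable under the right regular representation. Their
  elements are total functions, and invariance constrains values on \<open>carrier G\<close> only;
  identities between elements are accordingly proved on \<open>carrier G\<close>.\<close>

definition invariant_space :: "('a \<Rightarrow> complex) set \<Rightarrow> bool" where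
  "invariant_space V \<longleftrightarrow> (\<forall>f\<in>V. right_invariant G K f) \<and> (\<lambda>g. 0) \<in> V \<and>
     (\<forall>f\<in>V. \<forall>h\<in>V. (\<lambda>g. f g + h g) \<in> V) \<and> (\<forall>c. \<forall>f\<in>V. (\<lambda>g. c * f g) \<in> V) \<and>
     (\<forall>f\<in>V. \<forall>h\<in>carrier G. (\<lambda>g. f (g \<otimes> h)) \<in> V)"

text \<open>Systems are indexed by initial segments of the naturals: shortening a system means
  lowering \<open>k\<close>, extending it means updating \<open>e\<close> at
  \<open>k\<close>.\<close>

definition orthonormal_in :: "('a \<Rightarrow> complex) set \<Rightarrow> nat \<Rightarrow> (nat \<Rightarrow> 'a \<Rightarrow> complex) \<Rightarrow> bool" where
  "orthonormal_in V k e \<longleftrightarrow> (\<forall>i<k. e i \<in> V) \<and> (\<forall>i<k. \<forall>j<k. ip (e i) (e j) = (if i = j then 1 else 0))"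

lemma invariant_space_add: "invariant_space V \<Longrightarrow> f \<in> V \<Longrightarrow> h \<in> V \<Longrightarrow> (\<lambda>g. f g + h g) \<in> V"
  unfolding invariant_space_def by simp

lemma invariant_space_cmult: "invariant_space V \<Longrightarrow> f \<in> V \<Longrightarrow> (\<lambda>g. c * f g) \<in> V"
  unfolding invariant_space_def by simp

lemma invariant_space_sum:
  assumes "invariant_space V" and "\<And>i. i \<in> I \<Longrightarrow> f i \<in> V" and "finite I"
  shows "(\<lambda>g. \<Sum>i\<in>I. c i * f i g) \<in> V"
  using assms(3,2)
proof (induction I)
  case empty
  then show ?case using assms(1) by (simp add: invariant_space_def)
next
  case (insert i I)
  have "(\<lambda>g. c i * f i g) \<in> V" "(\<lambda>g. \<Sum>i\<in>I. c i * f i g) \<in> V"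
    using insert by (auto intro: invariant_space_cmult[OF assms(1)])
  then have "(\<lambda>g. c i * f i g + (\<Sum>i\<in>I. c i * f i g)) \<in> V"
    by (rule invariant_space_add[OF assms(1)])
  then show ?case using insert by simp
qed

lemma ip_orthonormal_sum:
  assumes "orthonormal_in V k e" and "i < k"
  shows "ip (\<lambda>g. \<Sum>j<k. c j * e j g) (e i) = c i"
proof -
  have "ip (\<lambda>g. \<Sum>j<k. c j * e j g) (e i) = (\<Sum>j<k. c j * (if j = i then 1 else 0))"
    unfolding ip_sum_left using assms by (intro sum.cong) (auto simp: orthonormal_in_def)
  then show ?thesis using assms by (simp add: if_distrib cong: if_cong)
qed

text \<open>The square of the value at \<open>g\<close> of \<open>\<Sum>\<^sub>i cnj (e\<^sub>i g) e\<^sub>i\<close> is bounded by \<open>|G/K|\<close> times its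
  squared norm, which is that same value; summing the resulting bound over \<open>g\<close> gives the claim.\<close>

lemma orthonormal_bound:
  assumes "orthonormal_in V k e"
  shows "k \<le> card Cs"
proof -
  have N: "real (card Cs) > 0" using card_Cs_pos by simp
  have bound: "(\<Sum>i<k. (cmod (e i g))\<^sup>2) \<le> card Cs" if g: "g \<in> Cs" for g
  proof -
    \<comment> \<open>The reproducing kernel at \<open>g\<close> of the span of the system:
      \<open>ip w h\<close> is \<open>w g\<close> for every \<open>w\<close> in that span.\<close>
    define h where "h x = (\<Sum>i<k. cnj (e i g) * e i x)" for x
    define s where "s = (\<Sum>i<k. (cmod (e i g))\<^sup>2)"
    have hg: "h g = of_real s"
      by (simp add: h_def s_def complex_norm_square mult.commute del: of_real_power)
    have "ip h h' = (\<Sum>i<k. cnj (e i g) * ip (e i) h')" for h'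
      unfolding h_def by (rule ip_sum_left)
    then have "ip h h = (\<Sum>i<k. cnj (e i g) * cnj (ip h (e i)))"
      by (simp only: ip_commute[of "e _" h])
    also have "\<dots> = (\<Sum>i<k. cnj (e i g) * e i g)"
      using ip_orthonormal_sum[OF assms, of _ "\<lambda>i. cnj (e i g)"]
      by (intro sum.cong refl) (simp add: h_def[abs_def])
    also have "\<dots> = of_real s"
      by (simp add: s_def complex_norm_square mult.commute del: of_real_power)
    finally have "s = (\<Sum>x\<in>Cs. (cmod (h x))\<^sup>2) / card Cs"
      unfolding ip_self by (simp only: of_real_eq_iff)
    moreover have "s\<^sup>2 \<le> (\<Sum>x\<in>Cs. (cmod (h x))\<^sup>2)"
      using member_le_sum[OF g, of "\<lambda>x. (cmod (h x))\<^sup>2"] by (simp add: hg)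
    ultimately have "s * s \<le> s * card Cs" using N by (simp add: field_simps power2_eq_square)
    moreover have "s \<ge> 0" by (simp add: s_def sum_nonneg)
    ultimately show ?thesis unfolding s_def[symmetric] using N by (cases "s = 0") auto
  qed
  have "real k * card Cs = (\<Sum>i<k. real (card Cs))" by simp
  also have "\<dots> = (\<Sum>i<k. \<Sum>g\<in>Cs. (cmod (e i g))\<^sup>2)"
  proof (rule sum.cong)
    fix i assume "i \<in> {..<k}"
    then have "ip (e i) (e i) = 1" using assms by (simp add: orthonormal_in_def)
    then have "(\<Sum>g\<in>Cs. (cmod (e i g))\<^sup>2) / card Cs = 1" unfolding ip_self by (simp only: of_real_eq_1_iff)
    then show "real (card Cs) = (\<Sum>g\<in>Cs. (cmod (e i g))\<^sup>2)" using N by simp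
  qed simp
  also have "\<dots> = (\<Sum>g\<in>Cs. \<Sum>i<k. (cmod (e i g))\<^sup>2)" by (rule sum.swap)
  also have "\<dots> \<le> (\<Sum>g\<in>Cs. real (card Cs))" by (rule sum_mono) (rule bound)
  finally show ?thesis using N by simp
qed

text \<open>Otherwise the residual of \<open>w\<close> after projection onto the system is a nonzero
  element of \<open>V\<close> orthogonal to it, and after normalization it would lengthen the
  system.\<close>

lemma orthonormal_maximal_spans:
  assumes V: "invariant_space V" and e: "orthonormal_in V k e" and max: "\<And>e'. \<not> orthonormal_in V (Suc k) e'"
    and w: "w \<in> V" and g: "g \<in> carrier G"
  shows "w g = (\<Sum>i<k. ip w (e i) * e i g)"
proof (rule ccontr)
  assume neq: "w g \<noteq> (\<Sum>i<k. ip w (e i) * e i g)"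
  define p where "p x = (\<Sum>i<k. ip w (e i) * e i x)" for x
  define r where "r x = w x - p x" for x
  have pV: "p \<in> V"
    unfolding p_def using e by (intro invariant_space_sum[OF V]) (auto simp: orthonormal_in_def)
  have "(\<lambda>x. w x + (- 1) * p x) \<in> V"
    by (intro invariant_space_add[OF V] invariant_space_cmult[OF V] w pV)
  moreover have "r = (\<lambda>x. w x + (- 1) * p x)" by (simp add: r_def fun_eq_iff)
  ultimately have rV: "r \<in> V" by simp
  have re: "ip r (e i) = 0" if "i < k" for i
  proof -
    have "ip r (e i) = ip w (e i) - ip p (e i)"
      by (simp add: ip_def r_def left_diff_distrib mean_diff)
    also have "ip p (e i) = ip w (e i)" unfolding p_def by (rule ip_orthonormal_sum[OF e that])
    finally show ?thesis by simp
  qed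
  define B where "B = (\<Sum>x\<in>Cs. (cmod (r x))\<^sup>2) / card Cs"
  have ipB: "ip r r = of_real B" by (simp only: ip_self B_def)
  have "B \<noteq> 0"
  proof
    assume "B = 0"
    then have "mean (\<lambda>g. r g * cnj (r g)) = 0" using ipB by (simp add: ip_def)
    moreover have "right_invariant G K r" using V rV by (simp add: invariant_space_def)
    ultimately have "r g = 0" using mean_norm_sq_eq_0 g by blast
    then show False using neq by (simp add: r_def p_def)
  qed
  moreover have "B \<ge> 0" by (simp add: B_def sum_nonneg)
  ultimately have B: "B > 0" by simp
  define s where "s = complex_of_real (1 / sqrt B)"
  define u where "u x = s * r x" for x
  have uV: "u \<in> V" using invariant_space_cmult[OF V rV, of s] by (simp add: u_def[abs_def])
  have ue: "ip u (e i) = 0" "ip (e i) u = 0" if "i < k" for i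
  proof -
    show 1: "ip u (e i) = 0" using re[OF that] by (simp add: ip_def u_def mean_cmult mult.assoc)
    show "ip (e i) u = 0" using 1 ip_commute[of "e i" u] by simp
  qed
  have uu: "ip u u = 1"
  proof -
    have "ip u u = mean (\<lambda>x. (s * cnj s) * (r x * cnj (r x)))"
      by (simp add: ip_def u_def mult_ac)
    also have "\<dots> = s * cnj s * ip r r" by (simp only: mean_cmult ip_def)
    also have "\<dots> = complex_of_real (1 / sqrt B * (1 / sqrt B) * B)"
      by (simp only: s_def ipB complex_cnj_complex_of_real of_real_mult)
    also have "1 / sqrt B * (1 / sqrt B) * B = 1" using B by simp
    finally show ?thesis by simp
  qed
  have "orthonormal_in V (Suc k) (e(k := u))"
    using e uV ue uu by (auto simp: orthonormal_in_def less_Suc_eq)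
  then show False using max by blast
qed

text \<open>The dimension, defined as the maximal length of an orthonormal system. The maximum
  exists because lengths are bounded by the index of \<open>K\<close>.\<close>

definition space_dim :: "('a \<Rightarrow> complex) set \<Rightarrow> nat" where
  "space_dim V = (GREATEST k. \<exists>e. orthonormal_in V k e)"

lemma space_dim:
  obtains e where "orthonormal_in V (space_dim V) e"
    and "\<And>k e. orthonormal_in V k e \<Longrightarrow> k \<le> space_dim V"
proof -
  have "\<exists>e. orthonormal_in V 0 e" by (simp add: orthonormal_in_def)
  then have "\<exists>e. orthonormal_in V (space_dim V) e"
    unfolding space_dim_def by (rule GreatestI_nat) (use orthonormal_bound in blast)
  moreover have "k \<le> space_dim V" if "orthonormal_in V k e" for k e
    unfolding space_dim_def by (rule Greatest_le_nat) (use orthonormal_bound that in blast)+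
  ultimately show ?thesis using that by blast
qed

definition nonzero_space :: "('a \<Rightarrow> complex) set \<Rightarrow> bool" where
  "nonzero_space V \<longleftrightarrow> (\<exists>f\<in>V. \<exists>g\<in>carrier G. f g \<noteq> 0)"

text \<open>An orthonormal basis of a minimal nonzero right-translation invariant space \<open>W\<close> turns right translation
  into an irreducible unitary representation \<open>\<rho>\<close>. Evaluation of \<open>e\<^sub>j (x g) = \<Sum>\<^sub>i \<rho>\<^sub>i\<^sub>j(g) e\<^sub>i(x)\<close>
  at \<open>x = 1\<close> shows that \<open>W\<close> consists of matrix coefficients of \<open>\<rho>\<close>.\<close>

lemma minimal_space_representation:
  assumes W: "invariant_space W" "nonzero_space W"
    and min: "\<And>U. \<lbrakk>invariant_space U; nonzero_space U; U \<subseteq> W\<rbrakk> \<Longrightarrow> space_dim W \<le> space_dim U"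
  obtains n \<rho> where "irreducible_rep G n \<rho>" "right_invariant G K \<rho>"
    "\<And>f. f \<in> W \<Longrightarrow> \<exists>c. \<forall>g\<in>carrier G. f g = (\<Sum>i<n. \<Sum>j<n. c i j * \<rho> g $$ (i, j))"
proof -
  define n where "n = space_dim W"
  obtain e where e: "orthonormal_in W n e" and max: "\<And>k e. orthonormal_in W k e \<Longrightarrow> k \<le> n"
    unfolding n_def using space_dim by blast
  \<comment> \<open>Stated for every orthonormal system of full length, not only for
    \<open>e\<close>: irreducibility below uses it for a system taken from a subspace.\<close>
  have spans: "w g = (\<Sum>i<n. ip w (e' i) * e' i g)"
    if "orthonormal_in W n e'" "w \<in> W" "g \<in> carrier G" for e' w g
    using orthonormal_maximal_spans[OF W(1) that(1) _ that(2,3)] max[of "Suc n"] by fastforce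
  have eW: "e i \<in> W" if "i < n" for i using e that by (simp add: orthonormal_in_def)
  have inv: "right_invariant G K f" if "f \<in> W" for f using W that by (simp add: invariant_space_def)
  have trans: "(\<lambda>x. f (x \<otimes> h)) \<in> W" if "f \<in> W" "h \<in> carrier G" for f h
    using W that by (simp add: invariant_space_def)
  have n: "n \<ge> 1"
  proof (rule ccontr)
    assume "\<not> n \<ge> 1"
    then have "{..<n} = {}" by auto
    then have "w g = 0" if "w \<in> W" "g \<in> carrier G" for w g using spans[OF e that] by simp
    then show False using W by (auto simp: nonzero_space_def)
  qed
  \<comment> \<open>The matrix of right translation by \<open>g\<close> in the basis
    \<open>e\<close>. Right translations compose in the order of the group, so no inverse is
    required for a homomorphism.\<close>
  define \<tau> where "\<tau> g i j = ip (\<lambda>x. e j (x \<otimes> g)) (e i)" for g i j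
  define \<rho> where "\<rho> = (\<lambda>g\<in>carrier G. mat n n (\<lambda>(i, j). \<tau> g i j))"
  have \<rho>_index: "\<rho> g $$ (i, j) = \<tau> g i j" if "g \<in> carrier G" "i < n" "j < n" for g i j
    using that by (simp add: \<rho>_def)
  have \<rho>_carrier: "\<rho> g \<in> carrier_mat n n" if "g \<in> carrier G" for g
    using that by (simp add: \<rho>_def)
  have shift: "e j (x \<otimes> g) = (\<Sum>i<n. \<tau> g i j * e i x)"
    if "j < n" "x \<in> carrier G" "g \<in> carrier G" for j x g
    unfolding \<tau>_def by (rule spans[OF e trans[OF eW[OF that(1)] that(3)] that(2)])
  have mult: "\<tau> (g \<otimes> h) i j = (\<Sum>k<n. \<tau> g i k * \<tau> h k j)"
    if "g \<in> carrier G" "h \<in> carrier G" "i < n" "j < n" for g h i j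
  proof -
    have "\<tau> (g \<otimes> h) i j = ip (\<lambda>x. \<Sum>k<n. \<tau> h k j * e k (x \<otimes> g)) (e i)"
      unfolding \<tau>_def[of "g \<otimes> h"]
    proof (rule ip_cong)
      fix x assume "x \<in> carrier G"
      then show "e j (x \<otimes> (g \<otimes> h)) = (\<Sum>k<n. \<tau> h k j * e k (x \<otimes> g))"
        using shift[of j "x \<otimes> g" h] that by (simp add: m_assoc)
    qed
    also have "\<dots> = (\<Sum>k<n. \<tau> h k j * \<tau> g i k)" by (simp only: ip_sum_left \<tau>_def)
    finally show ?thesis by (simp add: mult.commute)
  qed
  have parseval: "ip w w' = (\<Sum>i<n. ip w (e i) * cnj (ip w' (e i)))" if "w \<in> W" "w' \<in> W" for w w'
  proof -
    have "ip w w' = ip (\<lambda>x. \<Sum>i<n. ip w (e i) * e i x) w'" by (rule ip_cong) (rule spans[OF e that(1)])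
    then show ?thesis by (simp add: ip_sum_left ip_commute[of "e _" w'])
  qed
  \<comment> \<open>By Parseval the entries are inner products of translated basis functions, and
    right translation preserves the mean.\<close>
  have unitary: "mat_adjoint (\<rho> g) * \<rho> g = 1\<^sub>m n" if g: "g \<in> carrier G" for g
  proof (rule eq_matI)
    note c = \<rho>_carrier[OF g]
    fix l j assume "l < dim_row (1\<^sub>m n :: complex mat)" "j < dim_col (1\<^sub>m n :: complex mat)"
    then have lj: "l < n" "j < n" by auto
    have "(mat_adjoint (\<rho> g) * \<rho> g) $$ (l, j) = (\<Sum>i<n. cnj (\<tau> g i l) * \<tau> g i j)"
      using lj g by (simp add: mat_mult_index[OF mat_adjoint_carrier[OF c] c] mat_adjoint_index[OF c] \<rho>_index)
    also have "\<dots> = ip (\<lambda>x. e j (x \<otimes> g)) (\<lambda>x. e l (x \<otimes> g))"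
      using parseval[OF trans[OF eW[OF lj(2)] g] trans[OF eW[OF lj(1)] g]] by (simp add: \<tau>_def mult.commute)
    also have "\<dots> = ip (e j) (e l)"
    proof -
      have "right_invariant G K (\<lambda>x. e j x * cnj (e l x))"
        by (intro right_invariant_mult_cnj inv eW lj)
      then show ?thesis unfolding ip_def by (rule mean_right) (rule g)
    qed
    also have "\<dots> = (1\<^sub>m n :: complex mat) $$ (l, j)" using e lj by (auto simp: orthonormal_in_def)
    finally show "(mat_adjoint (\<rho> g) * \<rho> g) $$ (l, j) = (1\<^sub>m n :: complex mat) $$ (l, j)" .
  qed (use \<rho>_carrier[OF g] in auto)
  have rep: "unitary_rep G n \<rho>"
    unfolding unitary_rep_def
  proof
    show "\<rho> \<in> hom G (unitary_group n)"
    proof (rule homI)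
      show "\<rho> g \<in> carrier (unitary_group n)" if "g \<in> carrier G" for g
        using unitary \<rho>_carrier that by (simp add: unitary_group_iff)
      fix g h assume gh: "g \<in> carrier G" "h \<in> carrier G"
      have "\<rho> (g \<otimes> h) = \<rho> g * \<rho> h"
      proof (rule eq_matI)
        fix i j assume "i < dim_row (\<rho> g * \<rho> h)" "j < dim_col (\<rho> g * \<rho> h)"
        then have ij: "i < n" "j < n" using \<rho>_carrier gh by auto
        show "\<rho> (g \<otimes> h) $$ (i, j) = (\<rho> g * \<rho> h) $$ (i, j)"
          using ij gh mult[OF gh ij] by (simp add: mat_mult_index[OF \<rho>_carrier[OF gh(1)] \<rho>_carrier[OF gh(2)]] \<rho>_index)
      qed (use gh in \<open>simp_all add: \<rho>_def\<close>)
      then show "\<rho> (g \<otimes> h) = \<rho> g \<otimes>\<^bsub>unitary_group n\<^esub> \<rho> h" by (simp add: unitary_group_def)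
    qed
  qed (simp add: \<rho>_def)
  have periodic: "right_invariant G K \<rho>"
    unfolding right_invariant_def
  proof (intro ballI)
    fix g t assume g: "g \<in> carrier G" and t: "t \<in> K"
    have tG: "t \<in> carrier G" using t subset by auto
    have "\<tau> g i j = \<tau> (g \<otimes> t) i j" if "i < n" "j < n" for i j
      unfolding \<tau>_def
    proof (rule ip_cong)
      fix x assume "x \<in> carrier G"
      then show "e j (x \<otimes> g) = e j (x \<otimes> (g \<otimes> t))"
        using right_invariantD[OF inv[OF eW[OF that(2)]], of "x \<otimes> g" t] g t tG by (simp add: m_assoc)
    qed
    then show "\<rho> g = \<rho> (g \<otimes> t)"
      using g tG by (intro eq_matI) (auto simp: \<rho>_def)
  qed
  \<comment> \<open>Coordinates with respect to \<open>e\<close>. They turn right translation by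
    \<open>h\<close> into multiplication by \<open>\<rho> h\<close> and thus relate subspaces of the
    vector space to subspaces of \<open>W\<close>.\<close>
  define coef where "coef f = vec n (\<lambda>i. ip f (e i))" for f
  have coef_shift: "coef (\<lambda>x. f (x \<otimes> h)) = \<rho> h *\<^sub>v coef f" if f: "f \<in> W" and h: "h \<in> carrier G" for f h
  proof (rule eq_vecI)
    fix i assume "i < dim_vec (\<rho> h *\<^sub>v coef f)"
    then have i: "i < n" using \<rho>_carrier[OF h] by simp
    have "ip (\<lambda>x. f (x \<otimes> h)) (e i) = ip (\<lambda>x. \<Sum>j<n. ip f (e j) * e j (x \<otimes> h)) (e i)"
      by (rule ip_cong) (rule spans[OF e f], use h in simp)
    also have "\<dots> = (\<Sum>j<n. \<tau> h i j * ip f (e j))" by (simp only: ip_sum_left \<tau>_def mult.commute)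
    finally show "coef (\<lambda>x. f (x \<otimes> h)) $ i = (\<rho> h *\<^sub>v coef f) $ i"
      using i \<rho>_carrier[OF h] h by (simp add: coef_def scalar_prod_def lessThan_atLeast0 \<rho>_index)
  qed (use \<rho>_carrier[OF h] in \<open>simp add: coef_def\<close>)
  have coef_lin: "coef (\<lambda>x. f x + f' x) = coef f + coef f'" "coef (\<lambda>x. c * f x) = c \<cdot>\<^sub>v coef f"
    "coef (\<lambda>x. 0) = 0\<^sub>v n" for f f' c
    by (auto simp: coef_def ip_def distrib_right mean_add mean_cmult mult.assoc)
  have comb: "(\<lambda>x. \<Sum>j<n. v $ j * e j x) \<in> W" "coef (\<lambda>x. \<Sum>j<n. v $ j * e j x) = v"
    if "v \<in> carrier_vec n" for v
  proof -
    show "(\<lambda>x. \<Sum>j<n. v $ j * e j x) \<in> W" by (rule invariant_space_sum[OF W(1)]) (use eW in auto)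
    show "coef (\<lambda>x. \<Sum>j<n. v $ j * e j x) = v"
      using that by (intro eq_vecI) (auto simp: coef_def ip_orthonormal_sum[OF e])
  qed
  have irr: "irreducible_rep G n \<rho>"
    unfolding irreducible_rep_def
  proof (intro conjI allI impI)
    fix X assume X: "VectorSpace.subspace class_ring X (module_vec TYPE(complex) n) \<and>
      (\<forall>g\<in>carrier G. \<forall>w\<in>X. \<rho> g *\<^sub>v w \<in> X)"
    then have Xc: "X \<subseteq> carrier_vec n" and X0: "0\<^sub>v n \<in> X"
      and Xadd: "\<And>v w. v \<in> X \<Longrightarrow> w \<in> X \<Longrightarrow> v + w \<in> X" and Xsm: "\<And>c v. v \<in> X \<Longrightarrow> c \<cdot>\<^sub>v v \<in> X"
      and X\<rho>: "\<And>g v. g \<in> carrier G \<Longrightarrow> v \<in> X \<Longrightarrow> \<rho> g *\<^sub>v v \<in> X"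
      unfolding subspace_vec_iff by auto
    \<comment> \<open>The function space with coordinates in the invariant subspace
      \<open>X\<close>. Minimality of \<open>W\<close> is applied to it.\<close>
    define U where "U = {f \<in> W. coef f \<in> X}"
    have "X = carrier_vec n" if ne: "X \<noteq> {0\<^sub>v n}"
    proof -
      obtain v where v: "v \<in> X" "v \<noteq> 0\<^sub>v n" using ne X0 by blast
      have vc: "v \<in> carrier_vec n" using v Xc by blast
      have "nonzero_space U"
      proof (rule ccontr)
        assume "\<not> nonzero_space U"
        then have zero: "f g = 0" if "f \<in> U" "g \<in> carrier G" for f g
          using that by (auto simp: nonzero_space_def)
        have "(\<lambda>x. \<Sum>j<n. v $ j * e j x) \<in> U" using comb[OF vc] v by (simp add: U_def)
        from zero[OF this]
        have "coef (\<lambda>x. \<Sum>j<n. v $ j * e j x) = coef (\<lambda>x. 0)"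
          unfolding coef_def by (intro arg_cong[where f = "vec n"] ext ip_cong) simp
        then show False using comb(2)[OF vc] coef_lin(3) v by simp
      qed
      moreover have "invariant_space U"
        using W(1) X0 Xadd Xsm X\<rho> coef_shift
        by (auto simp: invariant_space_def U_def coef_lin)
      moreover have "U \<subseteq> W" by (auto simp: U_def)
      \<comment> \<open>Hence \<open>U\<close> contains an orthonormal system of length
        \<open>n\<close>, which is one of full length in \<open>W\<close> and spans it. Every vector
        is then the coordinate vector of an element of \<open>U\<close>, and so lies in
        \<open>X\<close>.\<close>
      ultimately have le: "n \<le> space_dim U" unfolding n_def using min by blast
      obtain e' where e': "orthonormal_in U (space_dim U) e'" using space_dim[of U] by blast
      then have e'U: "orthonormal_in U n e'" using le by (auto simp: orthonormal_in_def)
      then have e'W: "orthonormal_in W n e'" by (auto simp: orthonormal_in_def U_def)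
      have "v \<in> X" if v: "v \<in> carrier_vec n" for v
      proof -
        define f where "f x = (\<Sum>j<n. v $ j * e j x)" for x
        define f' where "f' x = (\<Sum>j<n. ip f (e' j) * e' j x)" for x
        have f: "f \<in> W" "coef f = v" using comb[OF v] unfolding f_def by auto
        have "f' \<in> U"
          unfolding f'_def using e'U by (intro invariant_space_sum \<open>invariant_space U\<close>) (auto simp: orthonormal_in_def)
        moreover have "coef f = coef f'"
          unfolding coef_def f'_def by (intro arg_cong[where f = "vec n"] ext ip_cong) (rule spans[OF e'W f(1)])
        ultimately show ?thesis using f by (simp add: U_def)
      qed
      then show ?thesis using Xc by blast
    qed
    then show "X = {0\<^sub>v n} \<or> X = carrier_vec n" by blast
  qed (use rep n in auto)
  have coeffs: "\<exists>c. \<forall>g\<in>carrier G. f g = (\<Sum>i<n. \<Sum>j<n. c i j * \<rho> g $$ (i, j))" if f: "f \<in> W" for f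
  proof (intro exI ballI)
    fix g assume g: "g \<in> carrier G"
    have "f g = (\<Sum>j<n. ip f (e j) * e j (\<one> \<otimes> g))" using spans[OF e f g] g by simp
    also have "\<dots> = (\<Sum>j<n. ip f (e j) * (\<Sum>i<n. \<tau> g i j * e i \<one>))"
      using g by (intro sum.cong refl, subst shift) auto
    also have "\<dots> = (\<Sum>i<n. \<Sum>j<n. (ip f (e j) * e i \<one>) * \<rho> g $$ (i, j))"
      using g by (subst sum.swap) (simp add: sum_distrib_left \<rho>_index mult_ac)
    finally show "f g = (\<Sum>i<n. \<Sum>j<n. (ip f (e j) * e i \<one>) * \<rho> g $$ (i, j))" .
  qed
  show ?thesis using that[OF irr periodic coeffs] by blast
qed

text \<open>A minimal space inside the orthogonal complement would contain a nonzero function that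
  is both a combination of matrix coefficients and orthogonal to all of them, so its norm would be
  zero.\<close>

lemma matrix_coefficients_complete:
  assumes f: "right_invariant G K f"
    and orth: "\<And>n \<rho> i j. \<lbrakk>irreducible_rep G n \<rho>; right_invariant G K \<rho>; i < n; j < n\<rbrakk>
      \<Longrightarrow> mean (\<lambda>g. f g * cnj (\<rho> g $$ (i, j))) = 0"
    and g: "g \<in> carrier G"
  shows "f g = 0"
proof (rule ccontr)
  assume nz: "f g \<noteq> 0"
  \<comment> \<open>The complement is taken with respect to all irreducible representations, so that
    it applies to whichever representation the minimal space produces.\<close>
  define V where "V = {f. right_invariant G K f \<and>
    (\<forall>n \<rho> i j. irreducible_rep G n \<rho> \<longrightarrow> right_invariant G K \<rho> \<longrightarrow> i < n \<longrightarrow> j < n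
      \<longrightarrow> ip f (\<lambda>g. \<rho> g $$ (i, j)) = 0)}"
  have "invariant_space V"
    unfolding invariant_space_def
  proof (intro conjI ballI allI)
    fix f h assume fV: "f \<in> V" and h: "h \<in> carrier G"
    have "ip (\<lambda>g. f (g \<otimes> h)) (\<lambda>g. \<rho> g $$ (i, j)) = 0"
      if \<rho>: "irreducible_rep G n \<rho>" "right_invariant G K \<rho>" and ij: "i < n" "j < n" for n \<rho> i j
    proof -
      have u: "unitary_rep G n \<rho>" using \<rho> by (simp add: irreducible_rep_def)
      have "right_invariant G K (\<lambda>g. f (g \<otimes> h) * cnj (\<rho> g $$ (i, j)))"
        using fV h by (intro right_invariant_mult_cnj right_invariant_right_shift right_invariant_entry \<rho>(2))
          (simp_all add: V_def)
      \<comment> \<open>Substituting \<open>g \<otimes> inv h\<close> for \<open>g\<close> moves the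
        translation from \<open>f\<close> to the coefficient, which becomes a combination of the
        coefficients in the same row \<open>i\<close>, all orthogonal to \<open>f\<close>.\<close>
      from mean_right[OF this inv_closed[OF h]]
      have "ip (\<lambda>g. f (g \<otimes> h)) (\<lambda>g. \<rho> g $$ (i, j))
          = mean (\<lambda>g. f (g \<otimes> inv h \<otimes> h) * cnj (\<rho> (g \<otimes> inv h) $$ (i, j)))"
        by (simp add: ip_def)
      also have "\<dots> = mean (\<lambda>g. \<Sum>k<n. \<rho> h $$ (j, k) * (f g * cnj (\<rho> g $$ (i, k))))"
      proof (rule mean_cong)
        fix g assume g: "g \<in> carrier G"
        have "cnj (\<rho> (g \<otimes> inv h) $$ (i, j)) = (\<Sum>k<n. cnj (\<rho> g $$ (i, k)) * \<rho> h $$ (j, k))"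
          using unitary_rep_mult_index[OF u g inv_closed[OF h] ij] unitary_rep_inv_index[OF u h _ ij(2)] by simp
        moreover have "g \<otimes> inv h \<otimes> h = g" using g h by (simp add: m_assoc)
        ultimately show "f (g \<otimes> inv h \<otimes> h) * cnj (\<rho> (g \<otimes> inv h) $$ (i, j))
            = (\<Sum>k<n. \<rho> h $$ (j, k) * (f g * cnj (\<rho> g $$ (i, k))))"
          by (simp add: sum_distrib_left mult_ac)
      qed
      also have "\<dots> = (\<Sum>k<n. \<rho> h $$ (j, k) * ip f (\<lambda>g. \<rho> g $$ (i, k)))"
        by (simp add: mean_sum mean_cmult ip_def)
      also have "\<dots> = 0" using fV \<rho> ij by (simp add: V_def)
      finally show ?thesis .
    qed
    then show "(\<lambda>g. f (g \<otimes> h)) \<in> V"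
      using fV h by (simp add: V_def right_invariant_right_shift)
  next
    fix f h assume "f \<in> V" "h \<in> V"
    moreover from this have "right_invariant G K (\<lambda>g. f g + h g)"
      unfolding right_invariant_def V_def by (metis (mono_tags, lifting) mem_Collect_eq)
    ultimately show "(\<lambda>g. f g + h g) \<in> V"
      by (simp add: V_def ip_def distrib_right mean_add)
  next
    fix c f assume "f \<in> V"
    moreover from this have "right_invariant G K (\<lambda>g. c * f g)"
      unfolding right_invariant_def V_def by (metis (mono_tags, lifting) mem_Collect_eq)
    ultimately show "(\<lambda>g. c * f g) \<in> V"
      by (simp add: V_def ip_def mean_cmult mult.assoc)
  qed (auto simp: V_def right_invariant_def ip_def)
  moreover have "f \<in> V" using f orth by (simp add: V_def ip_def)
  then have "nonzero_space V" using nz g by (auto simp: nonzero_space_def)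
  \<comment> \<open>Minimality with respect to dimension, a natural number, suffices for a minimal
    space to exist.\<close>
  ultimately have "\<exists>W. (invariant_space W \<and> nonzero_space W \<and> W \<subseteq> V) \<and>
      (\<forall>U. invariant_space U \<and> nonzero_space U \<and> U \<subseteq> V \<longrightarrow> space_dim W \<le> space_dim U)"
    using ex_has_least_nat[of "\<lambda>W. invariant_space W \<and> nonzero_space W \<and> W \<subseteq> V" V space_dim] by blast
  then obtain W where W: "invariant_space W" "nonzero_space W" "W \<subseteq> V"
    and min: "\<And>U. \<lbrakk>invariant_space U; nonzero_space U; U \<subseteq> W\<rbrakk> \<Longrightarrow> space_dim W \<le> space_dim U"
    by (meson subset_trans)
  obtain n \<rho> where \<rho>: "irreducible_rep G n \<rho>" "right_invariant G K \<rho>"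
    and coeffs: "\<And>f. f \<in> W \<Longrightarrow> \<exists>c. \<forall>g\<in>carrier G. f g = (\<Sum>i<n. \<Sum>j<n. c i j * \<rho> g $$ (i, j))"
    using minimal_space_representation[OF W(1,2) min] by blast
  obtain w x where w: "w \<in> W" "x \<in> carrier G" "w x \<noteq> 0" using W(2) by (auto simp: nonzero_space_def)
  obtain c where c: "\<And>g. g \<in> carrier G \<Longrightarrow> w g = (\<Sum>i<n. \<Sum>j<n. c i j * \<rho> g $$ (i, j))"
    using coeffs[OF w(1)] by blast
  have wV: "w \<in> V" using w W by blast
  have "ip w w = ip (\<lambda>g. \<Sum>i<n. \<Sum>j<n. c i j * \<rho> g $$ (i, j)) w" by (rule ip_cong) (rule c)
  also have "\<dots> = (\<Sum>i<n. ip (\<lambda>g. \<Sum>j<n. c i j * \<rho> g $$ (i, j)) w)"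
    using ip_sum_left[of "\<lambda>_. 1"] by simp
  also have "\<dots> = (\<Sum>i<n. \<Sum>j<n. c i j * cnj (ip w (\<lambda>g. \<rho> g $$ (i, j))))"
    by (simp only: ip_sum_left ip_commute[of _ w])
  also have "\<dots> = 0" using wV \<rho> by (intro sum.neutral ballI) (simp add: V_def)
  finally have "mean (\<lambda>g. w g * cnj (w g)) = 0" by (simp add: ip_def)
  then show False using mean_norm_sq_eq_0[of w x] W w by (auto simp: invariant_space_def)
qed

end

section \<open>Fourier analysis of periodic functions\<close>

context group
begin

lemma unitary_equivalence_refl:
  assumes "unitary_rep G n \<rho>"
  shows "(\<rho>, \<rho>) \<in> unitary_equivalence G"
proof -
  have id: "mat_adjoint (1\<^sub>m n) = (1\<^sub>m n :: complex mat)"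
    by (rule eq_matI) (auto simp: mat_adjoint_index[of _ n n])
  then have "1\<^sub>m n \<in> carrier (unitary_group n)" by (simp add: unitary_group_iff)
  moreover have "\<rho> g = mat_adjoint (1\<^sub>m n) * \<rho> g * 1\<^sub>m n" if "g \<in> carrier G" for g
    using unitary_rep_carrier[OF assms that] by (simp add: id)
  ultimately show ?thesis using assms by (auto simp: unitary_equivalence_def)
qed

lemma unitary_equivalence_cases:
  assumes "(\<rho>, \<sigma>) \<in> unitary_equivalence G"
  obtains n U where "unitary_rep G n \<rho>" "unitary_rep G n \<sigma>" "U \<in> carrier_mat n n"
    "mat_adjoint U * U = 1\<^sub>m n" "U * mat_adjoint U = 1\<^sub>m n"
    "\<And>g. g \<in> carrier G \<Longrightarrow> \<sigma> g = mat_adjoint U * \<rho> g * U"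
    "\<And>g. g \<in> carrier G \<Longrightarrow> \<rho> g = U * \<sigma> g * mat_adjoint U"
proof -
  obtain n U where r: "unitary_rep G n \<rho>" "unitary_rep G n \<sigma>" and U: "U \<in> carrier (unitary_group n)"
    and eq: "\<And>g. g \<in> carrier G \<Longrightarrow> \<sigma> g = mat_adjoint U * \<rho> g * U"
    using assms by (auto simp: unitary_equivalence_def)
  have Uc: "U \<in> carrier_mat n n" "mat_adjoint U * U = 1\<^sub>m n" using U by (auto simp: unitary_group_iff)
  have U': "mat_adjoint U \<in> carrier_mat n n" "U * mat_adjoint U = 1\<^sub>m n"
    using Uc unitary_mult_adjoint[OF U] by auto
  have "\<rho> g = U * \<sigma> g * mat_adjoint U" if g: "g \<in> carrier G" for g
  proof -
    note c = unitary_rep_carrier[OF r(1) g]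
    have "U * (mat_adjoint U * \<rho> g * U) * mat_adjoint U
        = (U * mat_adjoint U) * \<rho> g * (U * mat_adjoint U)"
      using Uc(1) U'(1) c by (simp add: assoc_mult_mat[of _ n n _ n _ n] mult_carrier_mat[of _ n n _ n])
    then show ?thesis using eq[OF g] c by (simp add: U'(2))
  qed
  then show ?thesis using that[OF r Uc U'(2) eq] by blast
qed

lemma unitary_equivalence_sym:
  assumes "(\<rho>, \<sigma>) \<in> unitary_equivalence G"
  shows "(\<sigma>, \<rho>) \<in> unitary_equivalence G"
proof -
  obtain n U where U: "unitary_rep G n \<rho>" "unitary_rep G n \<sigma>" "U \<in> carrier_mat n n"
    "mat_adjoint U * U = 1\<^sub>m n" "U * mat_adjoint U = 1\<^sub>m n"
    "\<And>g. g \<in> carrier G \<Longrightarrow> \<sigma> g = mat_adjoint U * \<rho> g * U"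
    "\<And>g. g \<in> carrier G \<Longrightarrow> \<rho> g = U * \<sigma> g * mat_adjoint U"
    using unitary_equivalence_cases[OF assms] by blast
  have "mat_adjoint U \<in> carrier (unitary_group n)"
    using U by (simp add: unitary_group_iff)
  moreover have "\<forall>g\<in>carrier G. \<rho> g = mat_adjoint (mat_adjoint U) * \<sigma> g * mat_adjoint U"
    using U by simp
  ultimately show ?thesis using U(1,2) unfolding unitary_equivalence_def by blast
qed

lemma unitary_equivalence_trans:
  assumes "(\<rho>, \<sigma>) \<in> unitary_equivalence G" and "(\<sigma>, \<tau>) \<in> unitary_equivalence G"
  shows "(\<rho>, \<tau>) \<in> unitary_equivalence G"
proof -
  obtain n U where U: "unitary_rep G n \<rho>" "unitary_rep G n \<sigma>" "U \<in> carrier_mat n n"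
    "mat_adjoint U * U = 1\<^sub>m n" "\<And>g. g \<in> carrier G \<Longrightarrow> \<sigma> g = mat_adjoint U * \<rho> g * U"
    using unitary_equivalence_cases[OF assms(1)] by metis
  obtain k V where V: "unitary_rep G k \<sigma>" "unitary_rep G k \<tau>" "V \<in> carrier_mat k k"
    "mat_adjoint V * V = 1\<^sub>m k" "\<And>g. g \<in> carrier G \<Longrightarrow> \<tau> g = mat_adjoint V * \<sigma> g * V"
    using unitary_equivalence_cases[OF assms(2)] by metis
  have k: "k = n" using rep_dim_unitary_rep[OF U(2)] rep_dim_unitary_rep[OF V(1)] by simp
  note V = V[unfolded k]
  note c = mat_adjoint_carrier[OF U(3)] mat_adjoint_carrier[OF V(3)]
  have adj: "mat_adjoint (U * V) = mat_adjoint V * mat_adjoint U" by (rule mat_adjoint_mult[OF U(3) V(3)])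
  have "mat_adjoint V * mat_adjoint U * (U * V) = mat_adjoint V * (mat_adjoint U * U) * V"
    using U(3) V(3) c by (simp add: assoc_mult_mat[of _ n n _ n _ n] mult_carrier_mat[of _ n n _ n])
  then have "U * V \<in> carrier (unitary_group n)"
    using U V c by (simp add: unitary_group_iff adj)
  moreover have "\<tau> g = mat_adjoint (U * V) * \<rho> g * (U * V)" if g: "g \<in> carrier G" for g
    using U(3,5) V(3,5) c g unitary_rep_carrier[OF U(1) g]
    by (simp add: adj assoc_mult_mat[of _ n n _ n _ n] mult_carrier_mat[of _ n n _ n])
  ultimately show ?thesis using U(1) V(2) unfolding unitary_equivalence_def by blast
qed

text \<open>The unitary matrix \<open>U\<close> carries a subspace \<open>W\<close> invariant under
  \<sigma> to the subspace \<open>X\<close> invariant under \<rho>; \<open>X\<close> is written as a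
  preimage under the adjoint of \<open>U\<close>.\<close>

lemma irreducible_rep_equivalent:
  assumes eqv: "(\<rho>, \<sigma>) \<in> unitary_equivalence G" and irr: "irreducible_rep G n \<rho>"
  shows "irreducible_rep G n \<sigma>"
proof -
  have \<rho>n: "unitary_rep G n \<rho>" using irr by (simp add: irreducible_rep_def)
  obtain k U where U: "unitary_rep G k \<rho>" "unitary_rep G k \<sigma>" "U \<in> carrier_mat k k"
    "mat_adjoint U * U = 1\<^sub>m k" "U * mat_adjoint U = 1\<^sub>m k"
    "\<And>g. g \<in> carrier G \<Longrightarrow> \<sigma> g = mat_adjoint U * \<rho> g * U"
    "\<And>g. g \<in> carrier G \<Longrightarrow> \<rho> g = U * \<sigma> g * mat_adjoint U"
    using unitary_equivalence_cases[OF eqv] by blast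
  have "k = n" using rep_dim_unitary_rep[OF \<rho>n] rep_dim_unitary_rep[OF U(1)] by simp
  note U = U[unfolded this]
  note U' = mat_adjoint_carrier[OF U(3)]
  show ?thesis
    unfolding irreducible_rep_def
  proof (intro conjI allI impI)
    fix W assume W: "VectorSpace.subspace class_ring W (module_vec TYPE(complex) n) \<and>
      (\<forall>g\<in>carrier G. \<forall>w\<in>W. \<sigma> g *\<^sub>v w \<in> W)"
    then have Wc: "W \<subseteq> carrier_vec n" and W0: "0\<^sub>v n \<in> W"
      and Wadd: "\<And>v w. v \<in> W \<Longrightarrow> w \<in> W \<Longrightarrow> v + w \<in> W" and Wsm: "\<And>c v. v \<in> W \<Longrightarrow> c \<cdot>\<^sub>v v \<in> W"
      and W\<sigma>: "\<And>g v. g \<in> carrier G \<Longrightarrow> v \<in> W \<Longrightarrow> \<sigma> g *\<^sub>v v \<in> W"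
      unfolding subspace_vec_iff by auto
    define X where "X = {v \<in> carrier_vec n. mat_adjoint U *\<^sub>v v \<in> W}"
    have "mat_adjoint U *\<^sub>v 0\<^sub>v n = 0\<^sub>v n" using U(3) U' by (intro eq_vecI) (auto intro!: scalar_prod_right_zero)
    then have "VectorSpace.subspace class_ring X (module_vec TYPE(complex) n)"
      using U' W0 Wadd Wsm unfolding subspace_vec_iff X_def
      by (auto simp: mult_add_distrib_mat_vec[OF U'] mult_mat_vec[OF U'])
    moreover have "\<rho> g *\<^sub>v v \<in> X" if g: "g \<in> carrier G" and v: "v \<in> X" for g v
    proof -
      have vc: "v \<in> carrier_vec n" "mat_adjoint U *\<^sub>v v \<in> W" using v by (auto simp: X_def)
      note c = unitary_rep_carrier[OF U(1) g] unitary_rep_carrier[OF U(2) g]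
      have "mat_adjoint U * \<rho> g = mat_adjoint U * (U * (\<sigma> g * mat_adjoint U))"
        using U(3,7) U' c g by (simp add: assoc_mult_mat[of _ n n _ n _ n])
      also have "\<dots> = mat_adjoint U * U * (\<sigma> g * mat_adjoint U)"
        using U(3) U' c by (intro assoc_mult_mat[symmetric]) auto
      also have "\<dots> = \<sigma> g * mat_adjoint U"
        using U(4) U' c by (simp add: mult_carrier_mat[of _ n n _ n])
      finally have "mat_adjoint U *\<^sub>v (\<rho> g *\<^sub>v v) = \<sigma> g *\<^sub>v (mat_adjoint U *\<^sub>v v)"
        using assoc_mult_mat_vec[OF U' c(1) vc(1)] assoc_mult_mat_vec[OF c(2) U' vc(1)] by simp
      then show ?thesis using W\<sigma>[OF g vc(2)] c vc(1) by (simp add: X_def)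
    qed
    ultimately have X: "X = {0\<^sub>v n} \<or> X = carrier_vec n"
      using irr unfolding irreducible_rep_def by blast
    have UW: "U *\<^sub>v w \<in> X" "mat_adjoint U *\<^sub>v (U *\<^sub>v w) = w" if "w \<in> W" for w
    proof -
      have wc: "w \<in> carrier_vec n" using that Wc by blast
      show 1: "mat_adjoint U *\<^sub>v (U *\<^sub>v w) = w"
        using assoc_mult_mat_vec[OF U' U(3) wc] wc by (simp add: U(4))
      then show "U *\<^sub>v w \<in> X" using that U(3) wc by (simp add: X_def)
    qed
    show "W = {0\<^sub>v n} \<or> W = carrier_vec n"
    proof (cases "X = {0\<^sub>v n}")
      case True
      have "w = 0\<^sub>v n" if w: "w \<in> W" for w
        using UW[OF w] True U' \<open>mat_adjoint U *\<^sub>v 0\<^sub>v n = 0\<^sub>v n\<close> by auto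
      then show ?thesis using W0 by blast
    next
      case False
      have "w \<in> W" if w: "w \<in> carrier_vec n" for w
      proof -
        have "U *\<^sub>v w \<in> X" using X False U(3) w by auto
        then have "mat_adjoint U *\<^sub>v (U *\<^sub>v w) \<in> W" by (simp add: X_def)
        then show ?thesis using assoc_mult_mat_vec[OF U' U(3) w] w by (simp add: U(4))
      qed
      then show ?thesis using Wc by blast
    qed
  qed (use U irr in \<open>auto simp: irreducible_rep_def\<close>)
qed

lemma right_invariant_equivalent:
  assumes "(\<rho>, \<sigma>) \<in> unitary_equivalence G" and "right_invariant G K \<rho>" and "K \<subseteq> carrier G"
  shows "right_invariant G K \<sigma>"
proof -
  obtain n U where "\<And>g. g \<in> carrier G \<Longrightarrow> \<sigma> g = mat_adjoint U * \<rho> g * U"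
    using unitary_equivalence_cases[OF assms(1)] by metis
  then show ?thesis using assms(2,3) unfolding right_invariant_def by (metis m_closed subsetD)
qed

text \<open>Matrix coefficients of \<rho> are fixed linear combinations of those of an equivalent
  \<sigma>. Orthogonality to the coefficients of one representative therefore covers its whole
  class.\<close>

lemma equivalent_rep_index:
  assumes "(\<rho>, \<sigma>) \<in> unitary_equivalence G" and "unitary_rep G n \<rho>"
  obtains U where "\<And>g i j. \<lbrakk>g \<in> carrier G; i < n; j < n\<rbrakk> \<Longrightarrow>
    \<rho> g $$ (i, j) = (\<Sum>a<n. \<Sum>b<n. U i j a b * \<sigma> g $$ (a, b))"
proof -
  obtain k U where U: "unitary_rep G k \<rho>" "unitary_rep G k \<sigma>" "U \<in> carrier_mat k k"
    "\<And>g. g \<in> carrier G \<Longrightarrow> \<rho> g = U * \<sigma> g * mat_adjoint U"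
    using unitary_equivalence_cases[OF assms(1)] by metis
  have "k = n" using rep_dim_unitary_rep[OF assms(2)] rep_dim_unitary_rep[OF U(1)] by simp
  note U = U[unfolded this]
  have "\<rho> g $$ (i, j) = (\<Sum>a<n. \<Sum>b<n. (U $$ (i, a) * cnj (U $$ (j, b))) * \<sigma> g $$ (a, b))"
    if g: "g \<in> carrier G" and ij: "i < n" "j < n" for g i j
  proof -
    note c = unitary_rep_carrier[OF U(2) g]
    have "\<rho> g $$ (i, j) = (\<Sum>b<n. (\<Sum>a<n. U $$ (i, a) * \<sigma> g $$ (a, b)) * cnj (U $$ (j, b)))"
      using ij by (simp add: U(4)[OF g] mat_mult_index[OF mult_carrier_mat[OF U(3) c] mat_adjoint_carrier[OF U(3)]]
          mat_mult_index[OF U(3) c] mat_adjoint_index[OF U(3)])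
    then show ?thesis
      by (simp add: sum_distrib_right sum_distrib_left mult_ac) (rule sum.swap)
  qed
  then show ?thesis using that[of "\<lambda>i j a b. U $$ (i, a) * cnj (U $$ (j, b))"] by blast
qed

end

section \<open>Means and scalar Fourier coefficients independent of the period\<close>

text \<open>The properties of the groups T^N on which the analysis rests. Directedness points
  downwards: two periods have a common refinement.\<close>

locale periodic_family = group G for G (structure) +
  fixes \<K> :: "'a set set"
  assumes finite_index_normal: "K \<in> \<K> \<Longrightarrow> finite_index_normal K G"
    and nonempty: "\<K> \<noteq> {}"
    and directed: "\<lbrakk>K \<in> \<K>; L \<in> \<K>\<rbrakk> \<Longrightarrow> \<exists>M\<in>\<K>. M \<subseteq> K \<inter> L"
begin

text \<open>The mean over an arbitrarily chosen period; unspecified for functions without a period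
  in the family.\<close>

definition pmean :: "('a \<Rightarrow> complex) \<Rightarrow> complex" where
  "pmean f = coset_mean G (SOME K. K \<in> \<K> \<and> right_invariant G K f) f"

text \<open>The means for two periods both agree with the mean for a subgroup of their intersection
  taken from the family.\<close>

lemma pmean_eq:
  assumes K: "K \<in> \<K>" "right_invariant G K f"
  shows "pmean f = coset_mean G K f"
proof -
  define L where "L = (SOME K. K \<in> \<K> \<and> right_invariant G K f)"
  have "\<exists>K. K \<in> \<K> \<and> right_invariant G K f" using K by blast
  then have L: "L \<in> \<K> \<and> right_invariant G L f" unfolding L_def by (rule someI_ex)
  obtain M where M: "M \<in> \<K>" "M \<subseteq> K \<inter> L" using directed K L by blast
  have "coset_mean G M f = coset_mean G K f" "coset_mean G M f = coset_mean G L f"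
    using K L M by (auto intro!: coset_mean_subset finite_index_normal)
  then show ?thesis by (simp add: pmean_def L_def)
qed

lemma ex_common_period:
  assumes "finite A" and "\<And>f. f \<in> A \<Longrightarrow> \<exists>K\<in>\<K>. right_invariant G K f"
  shows "\<exists>K\<in>\<K>. \<forall>f\<in>A. right_invariant G K f"
  using assms
proof (induction A)
  case empty
  then show ?case using nonempty by auto
next
  case (insert f A)
  obtain K where K: "K \<in> \<K>" "\<forall>f\<in>A. right_invariant G K f" using insert by auto
  obtain L where L: "L \<in> \<K>" "right_invariant G L f" using insert by auto
  obtain M where "M \<in> \<K>" "M \<subseteq> K \<inter> L" using directed K L by blast
  then show ?case using K L right_invariant_subset[where L = M] by (intro bexI[of _ M]) auto
qed

end

text \<open>The consequences of choosing one representation from each periodic class, expressed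
  without equivalence classes.\<close>

locale periodic_reps = periodic_family +
  fixes \<E> :: "('a \<Rightarrow> complex mat) set"
  assumes irreducible: "\<rho> \<in> \<E> \<Longrightarrow> irreducible_rep G (rep_dim G \<rho>) \<rho>"
    and ex_period: "\<rho> \<in> \<E> \<Longrightarrow> \<exists>K\<in>\<K>. right_invariant G K \<rho>"
    and inequivalent: "\<lbrakk>\<rho> \<in> \<E>; \<sigma> \<in> \<E>; (\<rho>, \<sigma>) \<in> unitary_equivalence G\<rbrakk> \<Longrightarrow> \<rho> = \<sigma>"
    and exhaustive: "\<lbrakk>irreducible_rep G n \<rho>; K \<in> \<K>; right_invariant G K \<rho>\<rbrakk>
      \<Longrightarrow> \<exists>\<sigma>\<in>\<E>. (\<rho>, \<sigma>) \<in> unitary_equivalence G"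
begin

abbreviation "dm \<rho> \<equiv> rep_dim G \<rho>"

text \<open>Up to equivalence, the irreducible representations of the finite group G/K, pulled back
  to \<open>G\<close>.\<close>

definition invariant_reps :: "'a set \<Rightarrow> ('a \<Rightarrow> complex mat) set" where
  "invariant_reps K = {\<rho> \<in> \<E>. right_invariant G K \<rho>}"

text \<open>The scalar Fourier coefficient. It contains \<rho> itself, not its conjugate, in
  accordance with the transform of the theorem.\<close>

definition coeff :: "('a \<Rightarrow> complex) \<Rightarrow> ('a \<Rightarrow> complex mat) \<Rightarrow> nat \<Rightarrow> nat \<Rightarrow> complex" where
  "coeff u \<rho> i j = pmean (\<lambda>g. u g * \<rho> g $$ (i, j))"

lemma dm_pos: "\<rho> \<in> \<E> \<Longrightarrow> dm \<rho> > 0"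
  using irreducible[of \<rho>] by (simp add: irreducible_rep_def)

lemma mean_orthogonal:
  assumes K: "K \<in> \<K>" and \<rho>: "\<rho> \<in> invariant_reps K" and \<sigma>: "\<sigma> \<in> invariant_reps K"
    and "i < dm \<rho>" "j < dm \<rho>" "a < dm \<sigma>" "b < dm \<sigma>"
  shows "coset_mean G K (\<lambda>g. \<rho> g $$ (i, j) * cnj (\<sigma> g $$ (a, b)))
    = (if \<rho> = \<sigma> \<and> i = a \<and> j = b then 1 / of_nat (dm \<sigma>) else 0)"
proof -
  interpret K: finite_index_normal K G by (rule finite_index_normal[OF K])
  have \<E>: "\<rho> \<in> \<E>" "\<sigma> \<in> \<E>" "right_invariant G K \<rho>" "right_invariant G K \<sigma>"
    using \<rho> \<sigma> by (auto simp: invariant_reps_def)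
  show ?thesis
  proof (cases "\<rho> = \<sigma>")
    case True
    then show ?thesis using K.schur_orthogonality[OF irreducible[OF \<E>(1)] \<E>(3), of i j a b] assms by simp
  next
    case False
    then have "(\<rho>, \<sigma>) \<notin> unitary_equivalence G" using inequivalent \<E> by blast
    then show ?thesis
      using K.schur_orthogonality_inequivalent[OF irreducible[OF \<E>(1)] \<E>(3) irreducible[OF \<E>(2)] \<E>(4)]
        assms False by simp
  qed
qed

text \<open>The (0, 0) entries of distinct members, scaled by the square root of the dimension, form
  an orthonormal system of \<open>K\<close>-invariant functions, and such systems have at most |G/K|
  elements.\<close>

lemma finite_invariant_reps:
  assumes K: "K \<in> \<K>"
  shows "finite (invariant_reps K)"
proof -
  interpret K: finite_index_normal K G by (rule finite_index_normal[OF K])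
  have "card A \<le> card K.Cs" if A: "A \<subseteq> invariant_reps K" "finite A" for A
  proof -
    obtain \<rho> where \<rho>: "bij_betw \<rho> {..<card A} A"
      using ex_bij_betw_nat_finite[OF A(2)] by (auto simp: lessThan_atLeast0)
    have \<rho>A: "\<rho> k \<in> invariant_reps K" if "k < card A" for k
      using \<rho> that A by (auto simp: bij_betw_def)
    have pos: "dm (\<rho> k) > 0" if "k < card A" for k
      using dm_pos \<rho>A[OF that] by (simp add: invariant_reps_def)
    define s where "s k = complex_of_real (sqrt (dm (\<rho> k)))" for k
    have ss: "s k * s k = of_nat (dm (\<rho> k))" for k
      unfolding s_def of_real_mult[symmetric] by simp
    define e where "e k g = s k * \<rho> k g $$ (0, 0)" for k g
    have "K.ip (e k) (e l) = (if k = l then 1 else 0)" if kl: "k < card A" "l < card A" for k l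
    proof -
      have "K.ip (e k) (e l) = s k * s l * K.mean (\<lambda>g. \<rho> k g $$ (0, 0) * cnj (\<rho> l g $$ (0, 0)))"
        unfolding K.ip_def K.mean_cmult[symmetric] by (simp add: e_def s_def mult_ac)
      also have "\<dots> = (if \<rho> k = \<rho> l then 1 else 0)"
        using mean_orthogonal[OF K \<rho>A[OF kl(1)] \<rho>A[OF kl(2)] pos[OF kl(1)] pos[OF kl(1)] pos[OF kl(2)] pos[OF kl(2)]]
          ss[of k] pos[OF kl(1)] by (auto simp: s_def)
      also have "\<rho> k = \<rho> l \<longleftrightarrow> k = l" using \<rho> kl by (auto simp: bij_betw_def inj_on_def)
      finally show ?thesis .
    qed
    then have "K.orthonormal_in UNIV (card A) e" by (simp add: K.orthonormal_in_def)
    then show ?thesis by (rule K.orthonormal_bound)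
  qed
  then show ?thesis using finite_if_finite_subsets_card_bdd[of "invariant_reps K" "card K.Cs"] by blast
qed

text \<open>\<open>p\<close> is the orthogonal projection of \<open>f\<close> onto the matrix
  coefficients. By the orthogonality relations \<open>f - p\<close> is orthogonal to all of them, so
  it vanishes by completeness.\<close>

lemma expansion:
  assumes K: "K \<in> \<K>" and f: "right_invariant G K f" and g: "g \<in> carrier G"
  shows "f g = (\<Sum>\<sigma>\<in>invariant_reps K. \<Sum>i<dm \<sigma>. \<Sum>j<dm \<sigma>.
    of_nat (dm \<sigma>) * coset_mean G K (\<lambda>g. f g * cnj (\<sigma> g $$ (i, j))) * \<sigma> g $$ (i, j))"
proof -
  interpret K: finite_index_normal K G by (rule finite_index_normal[OF K])
  note fin = finite_invariant_reps[OF K]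
  define c where "c \<sigma> i j = of_nat (dm \<sigma>) * K.mean (\<lambda>g. f g * cnj (\<sigma> g $$ (i, j)))" for \<sigma> i j
  define p where "p g = (\<Sum>\<sigma>\<in>invariant_reps K. \<Sum>i<dm \<sigma>. \<Sum>j<dm \<sigma>. c \<sigma> i j * \<sigma> g $$ (i, j))" for g
  have p: "right_invariant G K p"
    unfolding right_invariant_def
  proof (intro ballI)
    fix g t assume gt: "g \<in> carrier G" "t \<in> K"
    show "p g = p (g \<otimes> t)"
      unfolding p_def using gt by (intro sum.cong refl) (simp add: invariant_reps_def right_invariantD[of _ K])
  qed
  have fp: "right_invariant G K (\<lambda>g. f g - p g)"
    using f p unfolding right_invariant_def by metis
  have orth: "K.mean (\<lambda>g. (f g - p g) * cnj (\<sigma> g $$ (a, b))) = 0"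
    if \<sigma>: "\<sigma> \<in> invariant_reps K" and ab: "a < dm \<sigma>" "b < dm \<sigma>" for \<sigma> a b
  proof -
    have pos: "dm \<sigma> > 0" using ab by simp
    have "K.mean (\<lambda>g. p g * cnj (\<sigma> g $$ (a, b)))
        = K.mean (\<lambda>g. \<Sum>\<rho>\<in>invariant_reps K. \<Sum>i<dm \<rho>. \<Sum>j<dm \<rho>. c \<rho> i j * (\<rho> g $$ (i, j) * cnj (\<sigma> g $$ (a, b))))"
      by (simp add: p_def sum_distrib_right mult.assoc)
    also have "\<dots> = (\<Sum>\<rho>\<in>invariant_reps K. \<Sum>i<dm \<rho>. \<Sum>j<dm \<rho>.
        c \<rho> i j * K.mean (\<lambda>g. \<rho> g $$ (i, j) * cnj (\<sigma> g $$ (a, b))))"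
      by (simp only: K.mean_sum K.mean_cmult)
    also have "\<dots> = (\<Sum>\<rho>\<in>invariant_reps K. \<Sum>i<dm \<rho>. \<Sum>j<dm \<rho>.
        if \<rho> = \<sigma> \<and> i = a \<and> j = b then c \<sigma> a b / of_nat (dm \<sigma>) else 0)"
      using mean_orthogonal[OF K _ \<sigma> _ _ ab] by (intro sum.cong refl) auto
    also have "\<dots> = (\<Sum>\<rho>\<in>invariant_reps K. if \<rho> = \<sigma> then c \<sigma> a b / of_nat (dm \<sigma>) else 0)"
    proof (intro sum.cong refl)
      fix \<rho>
      have "(\<Sum>i<dm \<sigma>. \<Sum>j<dm \<sigma>. if i = a \<and> j = b then c \<sigma> a b / of_nat (dm \<sigma>) else 0)
          = (\<Sum>i<dm \<sigma>. if i = a then c \<sigma> a b / of_nat (dm \<sigma>) else 0)"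
        using ab by (intro sum.cong refl) auto
      then show "(\<Sum>i<dm \<rho>. \<Sum>j<dm \<rho>. if \<rho> = \<sigma> \<and> i = a \<and> j = b then c \<sigma> a b / of_nat (dm \<sigma>) else 0)
          = (if \<rho> = \<sigma> then c \<sigma> a b / of_nat (dm \<sigma>) else 0)" using ab by auto
    qed
    also have "\<dots> = c \<sigma> a b / of_nat (dm \<sigma>)" using fin \<sigma> by simp
    also have "\<dots> = K.mean (\<lambda>g. f g * cnj (\<sigma> g $$ (a, b)))" using pos by (simp add: c_def)
    finally show ?thesis by (simp add: left_diff_distrib K.mean_diff)
  qed
  have "f g - p g = 0"
  proof (rule K.matrix_coefficients_complete[OF fp _ g])
    fix n \<rho> i j assume \<rho>: "irreducible_rep G n \<rho>" "right_invariant G K \<rho>" and ij: "i < n" "j < n"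
    have u: "unitary_rep G n \<rho>" using \<rho> by (simp add: irreducible_rep_def)
    \<comment> \<open>Completeness speaks of all irreducible representations, whereas
      \<open>orth\<close> covers the chosen ones; the equivalent representative inherits the period
      \<open>K\<close>.\<close>
    obtain \<sigma> where \<sigma>: "\<sigma> \<in> \<E>" "(\<rho>, \<sigma>) \<in> unitary_equivalence G" using exhaustive[OF \<rho>(1) K \<rho>(2)] by blast
    have \<sigma>K: "\<sigma> \<in> invariant_reps K"
      using right_invariant_equivalent[OF \<sigma>(2) \<rho>(2) K.subset] \<sigma>(1) by (simp add: invariant_reps_def)
    have "unitary_rep G n \<sigma>"
      using irreducible_rep_equivalent[OF \<sigma>(2) \<rho>(1)] by (simp add: irreducible_rep_def)
    then have dm: "dm \<sigma> = n" by (rule rep_dim_unitary_rep)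
    obtain U where U: "\<And>g i j. \<lbrakk>g \<in> carrier G; i < n; j < n\<rbrakk> \<Longrightarrow>
        \<rho> g $$ (i, j) = (\<Sum>a<n. \<Sum>b<n. U i j a b * \<sigma> g $$ (a, b))"
      using equivalent_rep_index[OF \<sigma>(2) u] by blast
    have "K.mean (\<lambda>g. (f g - p g) * cnj (\<rho> g $$ (i, j)))
        = K.mean (\<lambda>g. \<Sum>a<n. \<Sum>b<n. cnj (U i j a b) * ((f g - p g) * cnj (\<sigma> g $$ (a, b))))"
      by (rule K.mean_cong) (simp add: U ij sum_distrib_left mult_ac)
    also have "\<dots> = (\<Sum>a<n. \<Sum>b<n. cnj (U i j a b) * K.mean (\<lambda>g. (f g - p g) * cnj (\<sigma> g $$ (a, b))))"
      by (simp only: K.mean_sum K.mean_cmult)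
    also have "\<dots> = 0" using orth[OF \<sigma>K] by (intro sum.neutral ballI) (simp add: dm)
    finally show "K.mean (\<lambda>g. (f g - p g) * cnj (\<rho> g $$ (i, j))) = 0" .
  qed
  then show ?thesis by (simp add: p_def c_def)
qed

lemma right_invariant_mult_entry:
  fixes u :: "'a \<Rightarrow> complex"
  assumes "right_invariant G K u" and "right_invariant G K \<rho>"
  shows "right_invariant G K (\<lambda>g. u g * \<rho> g $$ (i, j))"
  using assms unfolding right_invariant_def by metis

lemma coeff_eq:
  assumes "K \<in> \<K>" "right_invariant G K u" "right_invariant G K \<rho>"
  shows "coeff u \<rho> i j = coset_mean G K (\<lambda>g. u g * \<rho> g $$ (i, j))"
  unfolding coeff_def by (rule pmean_eq[OF assms(1) right_invariant_mult_entry[OF assms(2,3)]])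

text \<open>The conjugate of the expansion of the conjugate of \<open>u\<close>. This is how the
  missing conjugate in \<open>coeff\<close> is accounted for.\<close>

lemma inversion:
  assumes K: "K \<in> \<K>" and u: "right_invariant G K u" and g: "g \<in> carrier G"
  shows "u g = (\<Sum>\<sigma>\<in>invariant_reps K. \<Sum>i<dm \<sigma>. \<Sum>j<dm \<sigma>.
    of_nat (dm \<sigma>) * coeff u \<sigma> i j * cnj (\<sigma> g $$ (i, j)))"
proof -
  interpret K: finite_index_normal K G by (rule finite_index_normal[OF K])
  have "right_invariant G K (\<lambda>g. cnj (u g))" using u unfolding right_invariant_def by metis
  from expansion[OF K this g, THEN arg_cong[where f = cnj]]
  have "u g = (\<Sum>\<sigma>\<in>invariant_reps K. \<Sum>i<dm \<sigma>. \<Sum>j<dm \<sigma>.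
      of_nat (dm \<sigma>) * cnj (K.mean (\<lambda>g. cnj (u g) * cnj (\<sigma> g $$ (i, j)))) * cnj (\<sigma> g $$ (i, j)))"
    by simp
  also have "\<dots> = (\<Sum>\<sigma>\<in>invariant_reps K. \<Sum>i<dm \<sigma>. \<Sum>j<dm \<sigma>.
      of_nat (dm \<sigma>) * coeff u \<sigma> i j * cnj (\<sigma> g $$ (i, j)))"
    by (intro sum.cong refl) (simp add: K.mean_cnj[symmetric] coeff_eq[OF K u] invariant_reps_def)
  finally show ?thesis .
qed

text \<open>Orthogonality relations over a common period of \<rho> and the finite set
  \<open>A\<close>. The numbers \<open>c\<close> are arbitrary, so this is at once the source of
  surjectivity and of the vanishing of coefficients outside \<open>A\<close>.\<close>

lemma synthesis:
  assumes A: "A \<subseteq> \<E>" "finite A" and \<rho>: "\<rho> \<in> \<E>" "a < dm \<rho>" "b < dm \<rho>"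
    and u: "\<And>g. g \<in> carrier G \<Longrightarrow>
      u g = (\<Sum>\<sigma>\<in>A. \<Sum>i<dm \<sigma>. \<Sum>j<dm \<sigma>. of_nat (dm \<sigma>) * c \<sigma> i j * cnj (\<sigma> g $$ (i, j)))"
  shows "coeff u \<rho> a b = (if \<rho> \<in> A then c \<rho> a b else 0)"
proof -
  obtain K where K: "K \<in> \<K>" "\<forall>\<sigma>\<in>insert \<rho> A. right_invariant G K \<sigma>"
    using ex_common_period[of "insert \<rho> A"] A \<rho> ex_period by blast
  interpret K: finite_index_normal K G by (rule finite_index_normal[OF K(1)])
  have inv: "\<sigma> \<in> invariant_reps K" if "\<sigma> \<in> insert \<rho> A" for \<sigma>
    using that K A \<rho> by (auto simp: invariant_reps_def)
  have uK: "right_invariant G K u"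
    unfolding right_invariant_def
  proof (intro ballI)
    fix g t assume gt: "g \<in> carrier G" "t \<in> K"
    then have "g \<otimes> t \<in> carrier G" using K.subset by auto
    then show "u g = u (g \<otimes> t)"
      unfolding u[OF gt(1)] u[OF \<open>g \<otimes> t \<in> carrier G\<close>]
      using gt K by (intro sum.cong refl) (simp add: right_invariantD[of _ K])
  qed
  have "coeff u \<rho> a b = K.mean (\<lambda>g. u g * \<rho> g $$ (a, b))"
    using K by (intro coeff_eq uK) auto
  also have "\<dots> = K.mean (\<lambda>g. \<Sum>\<sigma>\<in>A. \<Sum>i<dm \<sigma>. \<Sum>j<dm \<sigma>.
      of_nat (dm \<sigma>) * c \<sigma> i j * (\<rho> g $$ (a, b) * cnj (\<sigma> g $$ (i, j))))"
    by (rule K.mean_cong) (simp add: u sum_distrib_left sum_distrib_right mult_ac)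
  also have "\<dots> = (\<Sum>\<sigma>\<in>A. \<Sum>i<dm \<sigma>. \<Sum>j<dm \<sigma>.
      of_nat (dm \<sigma>) * c \<sigma> i j * K.mean (\<lambda>g. \<rho> g $$ (a, b) * cnj (\<sigma> g $$ (i, j))))"
    by (simp only: K.mean_sum K.mean_cmult)
  also have "\<dots> = (\<Sum>\<sigma>\<in>A. if \<rho> = \<sigma> then c \<rho> a b else 0)"
  proof (intro sum.cong refl)
    fix \<sigma> assume \<sigma>: "\<sigma> \<in> A"
    have pos: "dm \<sigma> > 0" using \<sigma> A dm_pos by blast
    have "(\<Sum>i<dm \<sigma>. \<Sum>j<dm \<sigma>. of_nat (dm \<sigma>) * c \<sigma> i j * K.mean (\<lambda>g. \<rho> g $$ (a, b) * cnj (\<sigma> g $$ (i, j))))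
        = (\<Sum>i<dm \<sigma>. \<Sum>j<dm \<sigma>. if i = a then if j = b then if \<rho> = \<sigma> then c \<rho> a b else 0 else 0 else 0)"
      using mean_orthogonal[OF K(1) inv[of \<rho>] inv[of \<sigma>] \<rho>(2,3)] \<sigma> pos by (intro sum.cong refl) auto
    also have "\<dots> = (\<Sum>i<dm \<sigma>. if i = a then if \<rho> = \<sigma> then c \<rho> a b else 0 else 0)"
      using \<rho> by (intro sum.cong refl) auto
    also have "\<dots> = (if \<rho> = \<sigma> then c \<rho> a b else 0)" using \<rho> by auto
    finally show "(\<Sum>i<dm \<sigma>. \<Sum>j<dm \<sigma>. of_nat (dm \<sigma>) * c \<sigma> i j * K.mean (\<lambda>g. \<rho> g $$ (a, b) * cnj (\<sigma> g $$ (i, j))))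
        = (if \<rho> = \<sigma> then c \<rho> a b else 0)" .
  qed
  also have "\<dots> = (if \<rho> \<in> A then c \<rho> a b else 0)" using A by simp
  finally show ?thesis .
qed

text \<open>By inversion \<open>u\<close> is synthesized from the members of
  \<open>invariant_reps K\<close> alone, so coefficients at any other member vanish.\<close>

lemma coeff_eq_0:
  assumes K: "K \<in> \<K>" and u: "right_invariant G K u" and \<rho>: "\<rho> \<in> \<E> - invariant_reps K"
    and "i < dm \<rho>" "j < dm \<rho>"
  shows "coeff u \<rho> i j = 0"
  using synthesis[of "invariant_reps K" \<rho> i j u "coeff u"] inversion[OF K u] finite_invariant_reps[OF K] assms
  by (auto simp: invariant_reps_def)

text \<open>After inserting the inversion formula for \<open>u\<close>, the mean over the remaining
  factors is the conjugate of a coefficient of \<open>v\<close>.\<close>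

lemma parseval:
  assumes K: "K \<in> \<K>" and u: "right_invariant G K u" and v: "right_invariant G K v"
  shows "pmean (\<lambda>g. u g * cnj (v g)) = (\<Sum>\<sigma>\<in>invariant_reps K.
    of_nat (dm \<sigma>) * (\<Sum>i<dm \<sigma>. \<Sum>j<dm \<sigma>. coeff u \<sigma> i j * cnj (coeff v \<sigma> i j)))"
proof -
  interpret K: finite_index_normal K G by (rule finite_index_normal[OF K])
  have "pmean (\<lambda>g. u g * cnj (v g)) = K.mean (\<lambda>g. u g * cnj (v g))"
    by (rule pmean_eq[OF K K.right_invariant_mult_cnj[OF u v]])
  also have "\<dots> = K.mean (\<lambda>g. \<Sum>\<sigma>\<in>invariant_reps K. \<Sum>i<dm \<sigma>. \<Sum>j<dm \<sigma>.
      of_nat (dm \<sigma>) * coeff u \<sigma> i j * cnj (v g * \<sigma> g $$ (i, j)))"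
  proof (rule K.mean_cong)
    fix g assume g: "g \<in> carrier G"
    show "u g * cnj (v g) = (\<Sum>\<sigma>\<in>invariant_reps K. \<Sum>i<dm \<sigma>. \<Sum>j<dm \<sigma>.
      of_nat (dm \<sigma>) * coeff u \<sigma> i j * cnj (v g * \<sigma> g $$ (i, j)))"
      by (subst inversion[OF K u g]) (simp add: sum_distrib_left sum_distrib_right mult_ac)
  qed
  also have "\<dots> = (\<Sum>\<sigma>\<in>invariant_reps K. \<Sum>i<dm \<sigma>. \<Sum>j<dm \<sigma>.
      of_nat (dm \<sigma>) * coeff u \<sigma> i j * cnj (K.mean (\<lambda>g. v g * \<sigma> g $$ (i, j))))"
    by (simp only: K.mean_sum K.mean_cmult K.mean_cnj)
  also have "\<dots> = (\<Sum>\<sigma>\<in>invariant_reps K.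
      of_nat (dm \<sigma>) * (\<Sum>i<dm \<sigma>. \<Sum>j<dm \<sigma>. coeff u \<sigma> i j * cnj (coeff v \<sigma> i j)))"
    by (intro sum.cong refl)
      (simp add: coeff_eq[OF K v] invariant_reps_def sum_distrib_left mult.assoc)
  finally show ?thesis .
qed

end

section \<open>The matrix-valued Fourier transform\<close>

lemma sum_lessThan_mult:
  fixes f :: "nat \<Rightarrow> 'a :: comm_monoid_add"
  shows "(\<Sum>p<m * d. f p) = (\<Sum>a<m. \<Sum>i<d. f (a * d + i))"
proof -
  have "sum f {a * d..<a * d + d} = (\<Sum>i<d. f (a * d + i))" for a
    by (rule sum.reindex_bij_witness[where i = "\<lambda>i. a * d + i" and j = "\<lambda>p. p - a * d"]) auto
  then show ?thesis by (simp add: sum.nat_group[symmetric])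
qed

lemma mult_add_less:
  fixes a i m d :: nat
  assumes "a < m" "i < d"
  shows "a * d + i < m * d"
proof -
  have "a * d + i < Suc a * d" using assms by simp
  also have "\<dots> \<le> m * d" using assms by (intro mult_le_mono1) simp
  finally show ?thesis .
qed

lemma kronecker_index:
  assumes "A \<in> carrier_mat m n" "B \<in> carrier_mat k l" "p < m * k" "q < n * l"
  shows "kronecker A B $$ (p, q) = A $$ (p div k, q div l) * B $$ (p mod k, q mod l)"
  using assms by (simp add: kronecker_def)

locale fourier_setting = periodic_reps G "set_pow G T ` normal_exponents G T" \<E>
  for G (structure) and T and \<E>
begin

lemma periodic_wrt_iff: "periodic_wrt G T N u \<longleftrightarrow> right_invariant G (set_pow G T N) u"
  by (simp add: periodic_wrt_def right_invariant_def)

lemma finite_index_set_pow: "N \<in> normal_exponents G T \<Longrightarrow> finite_index_normal (set_pow G T N) G"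
  by (intro finite_index_normal imageI)

text \<open>The transform in closed form, free of the choice of a period and of representatives: its
  block at (a, b) consists of the scalar coefficients of the entry u_ab.\<close>

definition FT :: "nat \<Rightarrow> nat \<Rightarrow> ('a \<Rightarrow> complex mat) \<Rightarrow> ('a \<Rightarrow> complex mat) \<Rightarrow> complex mat" where
  "FT m n u \<rho> = mat (m * dm \<rho>) (n * dm \<rho>)
     (\<lambda>(p, q). coeff (\<lambda>g. u g $$ (p div dm \<rho>, q div dm \<rho>)) \<rho> (p mod dm \<rho>) (q mod dm \<rho>))"

lemma L_per_carrier: "u \<in> L_per G T m n \<Longrightarrow> g \<in> carrier G \<Longrightarrow> u g \<in> carrier_mat m n"
  by (auto simp: L_per_def)

lemma L_per_period:
  assumes "u \<in> L_per G T m n"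
  shows "\<exists>K\<in>set_pow G T ` normal_exponents G T. right_invariant G K u"
  using assms by (auto simp: L_per_def periodic_def periodic_wrt_iff)

lemma common_period:
  assumes "finite A" and "\<And>f. f \<in> A \<Longrightarrow> \<exists>K\<in>set_pow G T ` normal_exponents G T. right_invariant G K f"
  obtains N where "N \<in> normal_exponents G T" "\<And>f. f \<in> A \<Longrightarrow> right_invariant G (set_pow G T N) f"
  using ex_common_period[OF assms] by blast

text \<open>Every admissible choice of \<open>N\<close> and \<open>C\<close> leads to
  \<open>FT\<close>, because \<open>coeff\<close> is the mean for each common period. This is the
  well-definedness of the transform.\<close>

lemma fourier_representatives:
  assumes u: "u \<in> L_per G T m n" and \<rho>: "\<rho> \<in> \<E>" and N: "N \<in> normal_exponents G T"
    and inv: "right_invariant G (set_pow G T N) u" "right_invariant G (set_pow G T N) \<rho>"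
    and C: "representatives C (carrier (G Mod set_pow G T N))"
  shows "mat (m * dm \<rho>) (n * dm \<rho>) (\<lambda>pq. 1 / of_nat (card C) * (\<Sum>g\<in>C. kronecker (u g) (\<rho> g) $$ pq)) = FT m n u \<rho>"
proof (rule eq_matI)
  interpret K: finite_index_normal "set_pow G T N" G by (rule finite_index_set_pow[OF N])
  have CG: "C \<subseteq> carrier G" using C by (simp add: K.representatives_iff)
  have \<rho>u: "unitary_rep G (dm \<rho>) \<rho>" using irreducible[OF \<rho>] by (simp add: irreducible_rep_def)
  fix p q assume "p < dim_row (FT m n u \<rho>)" "q < dim_col (FT m n u \<rho>)"
  then have pq: "p < m * dm \<rho>" "q < n * dm \<rho>" by (auto simp: FT_def)
  have K: "set_pow G T N \<in> set_pow G T ` normal_exponents G T" using N by simp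
  have "(\<Sum>g\<in>C. kronecker (u g) (\<rho> g) $$ (p, q))
      = (\<Sum>g\<in>C. u g $$ (p div dm \<rho>, q div dm \<rho>) * \<rho> g $$ (p mod dm \<rho>, q mod dm \<rho>))"
    using CG pq L_per_carrier[OF u] unitary_rep_carrier[OF \<rho>u]
    by (intro sum.cong refl kronecker_index[where m = m and n = n]) auto
  then have "1 / of_nat (card C) * (\<Sum>g\<in>C. kronecker (u g) (\<rho> g) $$ (p, q))
      = K.mean (\<lambda>g. u g $$ (p div dm \<rho>, q div dm \<rho>) * \<rho> g $$ (p mod dm \<rho>, q mod dm \<rho>))"
    by (simp only: K.mean_representatives[OF C right_invariant_mult_entry[OF right_invariant_entry[OF inv(1)] inv(2)]])
  also have "\<dots> = FT m n u \<rho> $$ (p, q)"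
    using pq by (simp add: FT_def coeff_eq[OF K right_invariant_entry[OF inv(1)] inv(2)])
  finally show "mat (m * dm \<rho>) (n * dm \<rho>)
      (\<lambda>pq. 1 / of_nat (card C) * (\<Sum>g\<in>C. kronecker (u g) (\<rho> g) $$ pq)) $$ (p, q) = FT m n u \<rho> $$ (p, q)"
    using pq by simp
qed (auto simp: FT_def)

lemma is_fourier_iff:
  assumes u: "u \<in> L_per G T m n" and \<rho>: "\<rho> \<in> \<E>"
  shows "is_fourier G T m n u \<rho> X \<longleftrightarrow> X = FT m n u \<rho>"
proof
  assume "is_fourier G T m n u \<rho> X"
  then show "X = FT m n u \<rho>"
    unfolding is_fourier_def periodic_wrt_iff using fourier_representatives[OF u \<rho>] by blast
next
  assume X: "X = FT m n u \<rho>"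
  obtain N where N: "N \<in> normal_exponents G T" "\<And>f. f \<in> {u, \<rho>} \<Longrightarrow> right_invariant G (set_pow G T N) f"
    using common_period[of "{u, \<rho>}"] L_per_period[OF u] ex_period[OF \<rho>] by blast
  interpret K: finite_index_normal "set_pow G T N" G by (rule finite_index_set_pow[OF N(1)])
  show "is_fourier G T m n u \<rho> X"
    unfolding is_fourier_def periodic_wrt_iff X
    using N fourier_representatives[OF u \<rho> N(1) _ _ K.representatives_coset_reps, symmetric]
      K.representatives_coset_reps by blast
qed

lemma fourier_eq:
  assumes "u \<in> L_per G T m n" and "\<rho> \<in> \<E>"
  shows "fourier G T m n u \<rho> = FT m n u \<rho>"
  unfolding fourier_def is_fourier_iff[OF assms] by simp

definition IP :: "nat \<Rightarrow> nat \<Rightarrow> ('a \<Rightarrow> complex mat) \<Rightarrow> ('a \<Rightarrow> complex mat) \<Rightarrow> complex" where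
  "IP m n u v = (\<Sum>a<m. \<Sum>b<n. pmean (\<lambda>g. u g $$ (a, b) * cnj (v g $$ (a, b))))"

lemma inner_representatives:
  assumes u: "u \<in> L_per G T m n" and v: "v \<in> L_per G T m n" and N: "N \<in> normal_exponents G T"
    and inv: "right_invariant G (set_pow G T N) u" "right_invariant G (set_pow G T N) v"
    and C: "representatives C (carrier (G Mod set_pow G T N))"
  shows "1 / of_nat (card C) * (\<Sum>g\<in>C. frobenius (u g) (v g)) = IP m n u v"
proof -
  interpret K: finite_index_normal "set_pow G T N" G by (rule finite_index_set_pow[OF N])
  have CG: "C \<subseteq> carrier G" using C by (simp add: K.representatives_iff)
  have K: "set_pow G T N \<in> set_pow G T ` normal_exponents G T" using N by simp
  have entry: "right_invariant G (set_pow G T N) (\<lambda>g. u g $$ (a, b) * cnj (v g $$ (a, b)))" for a b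
    by (intro K.right_invariant_mult_cnj right_invariant_entry inv)
  have "(\<Sum>g\<in>C. frobenius (u g) (v g)) = (\<Sum>g\<in>C. \<Sum>a<m. \<Sum>b<n. u g $$ (a, b) * cnj (v g $$ (a, b)))"
    using L_per_carrier[OF u] CG by (intro sum.cong refl) (auto simp: frobenius_def)
  also have "\<dots> = (\<Sum>a<m. \<Sum>b<n. \<Sum>g\<in>C. u g $$ (a, b) * cnj (v g $$ (a, b)))"
    by (subst sum.swap) (intro sum.cong refl sum.swap)
  finally have "1 / of_nat (card C) * (\<Sum>g\<in>C. frobenius (u g) (v g))
      = (\<Sum>a<m. \<Sum>b<n. 1 / of_nat (card C) * (\<Sum>g\<in>C. u g $$ (a, b) * cnj (v g $$ (a, b))))"
    by (simp only: sum_distrib_left)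
  then show ?thesis
    by (simp only: IP_def pmean_eq[OF K entry] K.mean_representatives[OF C entry])
qed

lemma is_inner_per_iff:
  assumes u: "u \<in> L_per G T m n" and v: "v \<in> L_per G T m n"
  shows "is_inner_per G T u v c \<longleftrightarrow> c = IP m n u v"
proof
  assume "is_inner_per G T u v c"
  then show "c = IP m n u v"
    unfolding is_inner_per_def periodic_wrt_iff using inner_representatives[OF u v] by blast
next
  assume c: "c = IP m n u v"
  obtain N where N: "N \<in> normal_exponents G T" "\<And>f. f \<in> {u, v} \<Longrightarrow> right_invariant G (set_pow G T N) f"
    using common_period[of "{u, v}"] L_per_period[OF u] L_per_period[OF v] by blast
  interpret K: finite_index_normal "set_pow G T N" G by (rule finite_index_set_pow[OF N(1)])
  show "is_inner_per G T u v c"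
    unfolding is_inner_per_def periodic_wrt_iff c
    using N inner_representatives[OF u v N(1) _ _ K.representatives_coset_reps, symmetric]
      K.representatives_coset_reps by blast
qed

lemma FT_dim [simp]: "dim_row (FT m n u \<rho>) = m * dm \<rho>" "dim_col (FT m n u \<rho>) = n * dm \<rho>"
  by (simp_all add: FT_def)

lemma FT_index:
  assumes "a < m" "b < n" "i < dm \<rho>" "j < dm \<rho>"
  shows "FT m n u \<rho> $$ (a * dm \<rho> + i, b * dm \<rho> + j) = coeff (\<lambda>g. u g $$ (a, b)) \<rho> i j"
  using assms mult_add_less[of a m i "dm \<rho>"] mult_add_less[of b n j "dm \<rho>"] by (simp add: FT_def)

lemma FT_eq_0:
  assumes N: "N \<in> normal_exponents G T" and u: "right_invariant G (set_pow G T N) u"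
    and \<rho>: "\<rho> \<in> \<E> - invariant_reps (set_pow G T N)"
  shows "FT m n u \<rho> = 0\<^sub>m (m * dm \<rho>) (n * dm \<rho>)"
proof (rule eq_matI)
  fix p q assume "p < dim_row (0\<^sub>m (m * dm \<rho>) (n * dm \<rho>) :: complex mat)" "q < dim_col (0\<^sub>m (m * dm \<rho>) (n * dm \<rho>) :: complex mat)"
  then show "FT m n u \<rho> $$ (p, q) = 0\<^sub>m (m * dm \<rho>) (n * dm \<rho>) $$ (p, q)"
    using coeff_eq_0[OF imageI[OF N] right_invariant_entry[OF u] \<rho>] dm_pos[of \<rho>] \<rho> by (simp add: FT_def)
qed (auto simp: FT_def)

lemma finite_support_FT:
  assumes "u \<in> L_per G T m n"
  shows "finite {\<rho> \<in> \<E>. FT m n u \<rho> \<noteq> 0\<^sub>m (m * dm \<rho>) (n * dm \<rho>)}"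
proof -
  obtain N where N: "N \<in> normal_exponents G T" "right_invariant G (set_pow G T N) u"
    using L_per_period[OF assms] by blast
  show ?thesis
    by (rule finite_subset[OF _ finite_invariant_reps[OF imageI[OF N(1)]]]) (use FT_eq_0[OF N] in blast)
qed

text \<open>Inversion over a common period recovers each matrix entry on the group from the
  transform; outside the group, both functions are undefined in the same way by
  extensionality.\<close>

lemma FT_inj:
  assumes u: "u \<in> L_per G T m n" and v: "v \<in> L_per G T m n"
    and eq: "\<And>\<rho>. \<rho> \<in> \<E> \<Longrightarrow> FT m n u \<rho> = FT m n v \<rho>"
  shows "u = v"
proof
  fix g
  obtain N where N: "N \<in> normal_exponents G T" "\<And>f. f \<in> {u, v} \<Longrightarrow> right_invariant G (set_pow G T N) f"
    using common_period[of "{u, v}"] L_per_period[OF u] L_per_period[OF v] by blast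
  show "u g = v g"
  proof (cases "g \<in> carrier G")
    case g: True
    show ?thesis
    proof (rule eq_matI)
      note c = L_per_carrier[OF u g] L_per_carrier[OF v g]
      fix a b assume "a < dim_row (v g)" "b < dim_col (v g)"
      then have ab: "a < m" "b < n" using c by auto
      have "coeff (\<lambda>g. u g $$ (a, b)) \<rho> i j = coeff (\<lambda>g. v g $$ (a, b)) \<rho> i j"
        if "\<rho> \<in> invariant_reps (set_pow G T N)" "i < dm \<rho>" "j < dm \<rho>" for \<rho> i j
        using FT_index[OF ab that(2,3), of u] FT_index[OF ab that(2,3), of v] eq[of \<rho>] that(1)
        by (simp add: invariant_reps_def)
      then show "u g $$ (a, b) = v g $$ (a, b)"
        unfolding inversion[OF imageI[OF N(1)] right_invariant_entry[OF N(2)[of u]] g, simplified]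
          inversion[OF imageI[OF N(1)] right_invariant_entry[OF N(2)[of v]] g, simplified]
        by (intro sum.cong refl) auto
    qed (use L_per_carrier[OF u g] L_per_carrier[OF v g] in auto)
  next
    case False
    then show ?thesis using u v by (auto simp: L_per_def PiE_def extensional_def)
  qed
qed

text \<open>The preimage is written down by the inversion formula with the entries of
  \<open>X\<close> as coefficients. Finiteness of the support makes this a finite sum with a common
  period.\<close>

lemma FT_surj:
  assumes X: "X \<in> fourier_codomain G \<E> m n"
  shows "\<exists>u\<in>L_per G T m n. \<forall>\<rho>\<in>\<E>. FT m n u \<rho> = X \<rho>"
proof -
  have Xc: "X \<rho> \<in> carrier_mat (m * dm \<rho>) (n * dm \<rho>)" if "\<rho> \<in> \<E>" for \<rho>
    using X that by (auto simp: fourier_codomain_def)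
  define A where "A = {\<rho> \<in> \<E>. X \<rho> \<noteq> 0\<^sub>m (m * dm \<rho>) (n * dm \<rho>)}"
  have A: "A \<subseteq> \<E>" "finite A" using X by (auto simp: A_def fourier_codomain_def)
  define f where "f a b g = (\<Sum>\<sigma>\<in>A. \<Sum>i<dm \<sigma>. \<Sum>j<dm \<sigma>.
    of_nat (dm \<sigma>) * X \<sigma> $$ (a * dm \<sigma> + i, b * dm \<sigma> + j) * cnj (\<sigma> g $$ (i, j)))" for a b g
  define u where "u = (\<lambda>g\<in>carrier G. mat m n (\<lambda>(a, b). f a b g))"
  have u_index: "u g $$ (a, b) = f a b g" if "g \<in> carrier G" "a < m" "b < n" for g a b
    using that by (simp add: u_def)
  obtain N where N: "N \<in> normal_exponents G T" "\<And>\<sigma>. \<sigma> \<in> A \<Longrightarrow> right_invariant G (set_pow G T N) \<sigma>"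
    using common_period[OF A(2)] ex_period A(1) by blast
  interpret K: finite_index_normal "set_pow G T N" G by (rule finite_index_set_pow[OF N(1)])
  have "right_invariant G (set_pow G T N) u"
    unfolding right_invariant_def
  proof (intro ballI)
    fix g t assume gt: "g \<in> carrier G" "t \<in> set_pow G T N"
    then have gtG: "g \<otimes> t \<in> carrier G" using K.subset by auto
    have "f a b (g \<otimes> t) = f a b g" for a b
      unfolding f_def by (intro sum.cong refl) (simp add: right_invariantD[OF N(2) gt])
    then show "u g = u (g \<otimes> t)" using gt gtG by (simp add: u_def)
  qed
  then have "periodic G T u" using N(1) unfolding periodic_def periodic_wrt_iff by blast
  then have uL: "u \<in> L_per G T m n" by (auto simp: L_per_def u_def)
  have "FT m n u \<rho> = X \<rho>" if \<rho>: "\<rho> \<in> \<E>" for \<rho>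
  proof (rule eq_matI)
    fix p q assume "p < dim_row (X \<rho>)" "q < dim_col (X \<rho>)"
    then have pq: "p < m * dm \<rho>" "q < n * dm \<rho>" using Xc[OF \<rho>] by auto
    define a b i j where "a = p div dm \<rho>" and "b = q div dm \<rho>" and "i = p mod dm \<rho>" and "j = q mod dm \<rho>"
    have ab: "a < m" "b < n" using pq by (auto simp: a_def b_def less_mult_imp_div_less)
    have ij: "i < dm \<rho>" "j < dm \<rho>" using dm_pos[OF \<rho>] by (auto simp: i_def j_def)
    have pq_eq: "a * dm \<rho> + i = p" "b * dm \<rho> + j = q" by (simp_all only: a_def b_def i_def j_def div_mult_mod_eq)
    have "FT m n u \<rho> $$ (p, q) = coeff (\<lambda>g. u g $$ (a, b)) \<rho> i j"
      using FT_index[OF ab ij, of u] by (simp only: pq_eq)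
    also have "\<dots> = (if \<rho> \<in> A then X \<rho> $$ (a * dm \<rho> + i, b * dm \<rho> + j) else 0)"
      by (rule synthesis[OF A \<rho> ij]) (simp add: u_index ab f_def)
    also have "\<dots> = X \<rho> $$ (p, q)" using \<rho> pq unfolding pq_eq by (auto simp: A_def)
    finally show "FT m n u \<rho> $$ (p, q) = X \<rho> $$ (p, q)" .
  qed (use Xc[OF \<rho>] in \<open>auto simp: FT_def\<close>)
  then show ?thesis using uL by blast
qed

text \<open>Parseval for each entry of \<open>u\<close> and \<open>v\<close>, with the sums
  rearranged. \<E> may be infinite, but the terms outside the representations invariant under a
  common period of \<open>u\<close> and \<open>v\<close> are zero, which reduces the claim to a
  finite sum.\<close>

lemma plancherel:
  assumes u: "u \<in> L_per G T m n" and v: "v \<in> L_per G T m n"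
  shows "((\<lambda>\<rho>. of_nat (dm \<rho>) * frobenius (FT m n u \<rho>) (FT m n v \<rho>)) has_sum IP m n u v) \<E>"
proof -
  obtain N where N: "N \<in> normal_exponents G T" "\<And>f. f \<in> {u, v} \<Longrightarrow> right_invariant G (set_pow G T N) f"
    using common_period[of "{u, v}"] L_per_period[OF u] L_per_period[OF v] by blast
  define B where "B = invariant_reps (set_pow G T N)"
  have inv: "right_invariant G (set_pow G T N) u" "right_invariant G (set_pow G T N) v" using N by auto
  have B: "finite B" "B \<subseteq> \<E>"
    using finite_invariant_reps[OF imageI[OF N(1)]] by (auto simp: B_def invariant_reps_def)
  have frob: "frobenius (FT m n u \<rho>) (FT m n v \<rho>) = (\<Sum>a<m. \<Sum>b<n. \<Sum>i<dm \<rho>. \<Sum>j<dm \<rho>.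
      coeff (\<lambda>g. u g $$ (a, b)) \<rho> i j * cnj (coeff (\<lambda>g. v g $$ (a, b)) \<rho> i j))" for \<rho>
  proof -
    have "frobenius (FT m n u \<rho>) (FT m n v \<rho>) = (\<Sum>a<m. \<Sum>i<dm \<rho>. \<Sum>b<n. \<Sum>j<dm \<rho>.
        FT m n u \<rho> $$ (a * dm \<rho> + i, b * dm \<rho> + j) * cnj (FT m n v \<rho> $$ (a * dm \<rho> + i, b * dm \<rho> + j)))"
      unfolding frobenius_def FT_dim by (simp only: sum_lessThan_mult)
    also have "\<dots> = (\<Sum>a<m. \<Sum>i<dm \<rho>. \<Sum>b<n. \<Sum>j<dm \<rho>.
        coeff (\<lambda>g. u g $$ (a, b)) \<rho> i j * cnj (coeff (\<lambda>g. v g $$ (a, b)) \<rho> i j))"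
      by (intro sum.cong refl) (simp add: FT_index)
    also have "\<dots> = (\<Sum>a<m. \<Sum>b<n. \<Sum>i<dm \<rho>. \<Sum>j<dm \<rho>.
        coeff (\<lambda>g. u g $$ (a, b)) \<rho> i j * cnj (coeff (\<lambda>g. v g $$ (a, b)) \<rho> i j))"
      by (intro sum.cong refl sum.swap)
    finally show ?thesis .
  qed
  have "IP m n u v = (\<Sum>a<m. \<Sum>b<n. \<Sum>\<rho>\<in>B. of_nat (dm \<rho>) * (\<Sum>i<dm \<rho>. \<Sum>j<dm \<rho>.
      coeff (\<lambda>g. u g $$ (a, b)) \<rho> i j * cnj (coeff (\<lambda>g. v g $$ (a, b)) \<rho> i j)))"
    unfolding IP_def B_def
    by (intro sum.cong refl parseval[OF imageI[OF N(1)]] right_invariant_entry inv)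
  also have "\<dots> = (\<Sum>\<rho>\<in>B. \<Sum>a<m. \<Sum>b<n. of_nat (dm \<rho>) * (\<Sum>i<dm \<rho>. \<Sum>j<dm \<rho>.
      coeff (\<lambda>g. u g $$ (a, b)) \<rho> i j * cnj (coeff (\<lambda>g. v g $$ (a, b)) \<rho> i j)))"
    by (subst (2) sum.swap) (intro sum.cong refl sum.swap)
  also have "\<dots> = (\<Sum>\<rho>\<in>B. of_nat (dm \<rho>) * frobenius (FT m n u \<rho>) (FT m n v \<rho>))"
    by (simp add: frob sum_distrib_left)
  finally have "((\<lambda>\<rho>. of_nat (dm \<rho>) * frobenius (FT m n u \<rho>) (FT m n v \<rho>)) has_sum IP m n u v) B"
    using B(1) by (intro has_sum_finiteI)
  moreover have "frobenius (FT m n u \<rho>) (FT m n v \<rho>) = 0" if "\<rho> \<in> \<E> - B" for \<rho>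
    using FT_eq_0[OF N(1) inv(1), of \<rho> m n] that unfolding B_def by (simp add: frobenius_def)
  ultimately show ?thesis
    using B(2) by (subst has_sum_cong_neutral[where T = B and g = "\<lambda>\<rho>. of_nat (dm \<rho>) * frobenius (FT m n u \<rho>) (FT m n v \<rho>)"]) auto
qed

theorem fourier_bijective_plancherel:
  shows "(\<forall>u \<in> L_per G T m n. \<forall>\<rho>\<in>\<E>. \<exists>!X. is_fourier G T m n u \<rho> X)
    \<and> bij_betw (\<lambda>u. \<lambda>\<rho>\<in>\<E>. fourier G T m n u \<rho>) (L_per G T m n) (fourier_codomain G \<E> m n)
    \<and> (\<forall>u \<in> L_per G T m n. \<forall>v \<in> L_per G T m n. (\<exists>!c. is_inner_per G T u v c)
        \<and> ((\<lambda>\<rho>. of_nat (rep_dim G \<rho>) * frobenius (fourier G T m n u \<rho>) (fourier G T m n v \<rho>))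
             has_sum inner_per G T u v) \<E>)"
proof (intro conjI ballI)
  let ?F = "\<lambda>u. \<lambda>\<rho>\<in>\<E>. fourier G T m n u \<rho>"
  show "bij_betw ?F (L_per G T m n) (fourier_codomain G \<E> m n)"
    unfolding bij_betw_def
  proof (intro conjI equalityI subsetI)
    show "inj_on ?F (L_per G T m n)"
    proof (rule inj_onI)
      fix u v assume uv: "u \<in> L_per G T m n" "v \<in> L_per G T m n" "?F u = ?F v"
      have "FT m n u \<rho> = FT m n v \<rho>" if "\<rho> \<in> \<E>" for \<rho>
        using fun_cong[OF uv(3), of \<rho>] that by (simp add: fourier_eq uv(1,2))
      then show "u = v" by (rule FT_inj[OF uv(1,2)])
    qed
    fix X assume "X \<in> ?F ` L_per G T m n"
    then obtain u where u: "u \<in> L_per G T m n" "X = (\<lambda>\<rho>\<in>\<E>. FT m n u \<rho>)"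
      by (auto simp: fourier_eq cong: restrict_cong)
    have "{\<rho> \<in> \<E>. X \<rho> \<noteq> 0\<^sub>m (m * dm \<rho>) (n * dm \<rho>)} = {\<rho> \<in> \<E>. FT m n u \<rho> \<noteq> 0\<^sub>m (m * dm \<rho>) (n * dm \<rho>)}"
      by (auto simp: u(2))
    then show "X \<in> fourier_codomain G \<E> m n"
      using finite_support_FT[OF u(1)] unfolding fourier_codomain_def by (auto simp: u(2) FT_def)
  next
    fix X assume X: "X \<in> fourier_codomain G \<E> m n"
    obtain u where u: "u \<in> L_per G T m n" "\<And>\<rho>. \<rho> \<in> \<E> \<Longrightarrow> FT m n u \<rho> = X \<rho>" using FT_surj[OF X] by blast
    have "?F u = X"
    proof
      fix \<rho> show "?F u \<rho> = X \<rho>"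
        using X u by (cases "\<rho> \<in> \<E>") (auto simp: fourier_eq fourier_codomain_def PiE_def extensional_def)
    qed
    then show "X \<in> ?F ` L_per G T m n" using u(1) by blast
  qed
next
  fix u v assume uv: "u \<in> L_per G T m n" "v \<in> L_per G T m n"
  show "\<exists>!c. is_inner_per G T u v c" by (simp add: is_inner_per_iff[OF uv])
  have "inner_per G T u v = IP m n u v" by (simp add: inner_per_def is_inner_per_iff[OF uv])
  then show "((\<lambda>\<rho>. of_nat (dm \<rho>) * frobenius (fourier G T m n u \<rho>) (fourier G T m n v \<rho>))
      has_sum inner_per G T u v) \<E>"
    using plancherel[OF uv]
    by (simp only: fourier_eq[OF uv(1)] fourier_eq[OF uv(2)] cong: has_sum_cong) (simp only:)
qed (simp add: is_fourier_iff)

end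

text \<open>A class counts as periodic as soon as some member is, and its representative in \<E> may
  be another member. Unitary equivalence transports irreducibility and the period to it.\<close>

lemma (in periodic_family) periodic_reps_representatives:
  assumes \<K>: "\<K> = set_pow G T ` normal_exponents G T"
    and \<E>: "representatives \<E> (periodic_dual G T)"
  shows "periodic_reps G \<K> \<E>"
proof
  have per: "periodic G T \<rho> \<longleftrightarrow> (\<exists>K\<in>\<K>. right_invariant G K \<rho>)" for \<rho> :: "'a \<Rightarrow> complex mat"
    unfolding \<K> periodic_def by (simp add: periodic_wrt_def right_invariant_def)
  have member: "\<exists>\<tau> c. c = unitary_equivalence G `` {\<tau>} \<and> c \<in> periodic_dual G T \<and> (\<tau>, \<rho>) \<in> unitary_equivalence G \<and>
      irreducible_rep G (rep_dim G \<rho>) \<rho> \<and> (\<exists>K\<in>\<K>. right_invariant G K \<rho>)"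
    if \<rho>: "\<rho> \<in> \<E>" for \<rho>
  proof -
    obtain c where c: "c \<in> periodic_dual G T" "\<rho> \<in> c" using \<E> \<rho> unfolding representatives_def by blast
    then obtain \<tau> n where \<tau>: "c = unitary_equivalence G `` {\<tau>}" "irreducible_rep G n \<tau>"
      by (auto simp: periodic_dual_def unitary_dual_def quotient_def irreducible_reps_def)
    have \<tau>\<rho>: "(\<tau>, \<rho>) \<in> unitary_equivalence G" using c \<tau> by simp
    have irr: "irreducible_rep G n \<rho>" by (rule irreducible_rep_equivalent[OF \<tau>\<rho> \<tau>(2)])
    then have "rep_dim G \<rho> = n" by (intro rep_dim_unitary_rep) (simp add: irreducible_rep_def)
    moreover obtain \<sigma> K where \<sigma>: "\<sigma> \<in> c" "K \<in> \<K>" "right_invariant G K \<sigma>"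
      using c(1) unfolding periodic_dual_def per by blast
    \<comment> \<open>\<sigma> is the member known to be periodic; both it and \<rho> are equivalent
      to the element \<tau> generating the class.\<close>
    have "(\<sigma>, \<rho>) \<in> unitary_equivalence G"
      using unitary_equivalence_trans[OF unitary_equivalence_sym \<tau>\<rho>] \<sigma>(1) \<tau>(1) by simp
    moreover have "K \<subseteq> carrier G"
      using finite_index_normal[OF \<sigma>(2)] unfolding finite_index_normal_def
      by (meson normal_imp_subgroup subgroup.subset)
    ultimately have "right_invariant G K \<rho>" using right_invariant_equivalent \<sigma>(3) by blast
    with \<open>rep_dim G \<rho> = n\<close> irr c \<tau> \<tau>\<rho> \<sigma>(2) show ?thesis by blast
  qed
  fix \<rho> assume \<rho>: "\<rho> \<in> \<E>"
  show "irreducible_rep G (rep_dim G \<rho>) \<rho>" "\<exists>K\<in>\<K>. right_invariant G K \<rho>" using member[OF \<rho>] by blast+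
  fix \<sigma> assume \<sigma>: "\<sigma> \<in> \<E>" and eq: "(\<rho>, \<sigma>) \<in> unitary_equivalence G"
  obtain \<tau> c where c: "c = unitary_equivalence G `` {\<tau>}" "c \<in> periodic_dual G T" "(\<tau>, \<rho>) \<in> unitary_equivalence G"
    using member[OF \<rho>] by blast
  have "\<rho> \<in> \<E> \<inter> c" "\<sigma> \<in> \<E> \<inter> c" using \<rho> \<sigma> c eq unitary_equivalence_trans by auto
  then show "\<rho> = \<sigma>" using \<E> c(2) unfolding representatives_def by blast
next
  fix n \<rho> K assume \<rho>: "irreducible_rep G n \<rho>" "K \<in> \<K>" "right_invariant G K \<rho>"
  have "(\<rho>, \<rho>) \<in> unitary_equivalence G"
    using \<rho>(1) by (intro unitary_equivalence_refl) (auto simp: irreducible_rep_def)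
  moreover have "periodic G T \<rho>"
    unfolding \<K> periodic_def using \<rho>(2,3)[unfolded \<K>] by (auto simp: periodic_wrt_def right_invariant_def)
  ultimately have "unitary_equivalence G `` {\<rho>} \<in> periodic_dual G T"
    using \<rho>(1) by (auto simp: periodic_dual_def unitary_dual_def irreducible_reps_def intro!: quotientI)
  then obtain \<sigma> where "\<sigma> \<in> \<E> \<inter> unitary_equivalence G `` {\<rho>}"
    using \<E> unfolding representatives_def by blast
  then show "\<exists>\<sigma>\<in>\<E>. (\<rho>, \<sigma>) \<in> unitary_equivalence G" by blast
qed

section \<open>Discrete groups of block isometries\<close>

lemma orthogonal_entry_bound:
  assumes "A \<in> orthogonal_matrices d" and "i < d" and "j < d"
  shows "\<bar>A $$ (i, j)\<bar> \<le> 1"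
proof -
  have A: "A \<in> carrier_mat d d" "transpose_mat A * A = 1\<^sub>m d"
    using assms by (auto simp: orthogonal_matrices_def)
  have "(transpose_mat A * A) $$ (j, j) = (\<Sum>k<d. (A $$ (k, j))\<^sup>2)"
    using A(1) assms by (simp add: scalar_prod_def power2_eq_square lessThan_atLeast0)
  then have "(\<Sum>k<d. (A $$ (k, j))\<^sup>2) = 1" using A assms by simp
  moreover have "(A $$ (i, j))\<^sup>2 \<le> (\<Sum>k<d. (A $$ (k, j))\<^sup>2)"
    using assms by (intro member_le_sum) auto
  ultimately show ?thesis by (simp add: abs_square_le_1)
qed

text \<open>A crude bound in the maximum norm: each entry of an orthogonal matrix has modulus at
  most 1. Only boundedness matters later, so the factor \<open>d\<close> is harmless.\<close>

lemma orthogonal_mult_vec_bound: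
  assumes "A \<in> orthogonal_matrices d" and "v \<in> carrier_vec d" and "\<And>i. i < d \<Longrightarrow> \<bar>v $ i\<bar> \<le> R"
    and "i < d"
  shows "\<bar>(A *\<^sub>v v) $ i\<bar> \<le> d * R"
proof -
  have A: "A \<in> carrier_mat d d" using assms by (auto simp: orthogonal_matrices_def)
  have "(A *\<^sub>v v) $ i = (\<Sum>k<d. A $$ (i, k) * v $ k)"
    using A assms by (simp add: scalar_prod_def lessThan_atLeast0)
  also have "\<bar>\<dots>\<bar> \<le> (\<Sum>k<d. \<bar>A $$ (i, k)\<bar> * \<bar>v $ k\<bar>)"
    by (rule order_trans[OF sum_abs]) (simp add: abs_mult)
  also have "\<dots> \<le> (\<Sum>k<d. 1 * R)"
    using assms orthogonal_entry_bound[OF assms(1)] by (intro sum_mono mult_mono) auto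
  finally show ?thesis by simp
qed

lemma discrete_subgroup_isolated_one:
  assumes "discrete_subgroup d H"
  obtains e where "e > 0"
    "\<And>x. \<lbrakk>x \<in> H; euclidean_group_dist d \<one>\<^bsub>euclidean_group d\<^esub> x < e\<rbrakk> \<Longrightarrow> x = \<one>\<^bsub>euclidean_group d\<^esub>"
proof -
  interpret Metric_space "carrier (euclidean_group d)" "euclidean_group_dist d"
    by (rule Metric_space_euclidean_group)
  let ?o = "\<one>\<^bsub>euclidean_group d\<^esub>"
  have H: "subgroup H (euclidean_group d)"
    "subtopology (euclidean_group_topology d) H = discrete_topology H"
    using assms by (auto simp: discrete_subgroup_def)
  have o: "?o \<in> H" by (rule subgroup.one_closed[OF H(1)])
  then have "openin (subtopology mtopology H) {?o}"
    using H(2) by (simp add: euclidean_group_topology_def)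
  then obtain U where U: "openin mtopology U" "{?o} = U \<inter> H"
    by (auto simp: openin_subtopology)
  then obtain e where e: "e > 0" "mball ?o e \<subseteq> U"
    unfolding openin_mtopology by blast
  have "x = ?o" if "x \<in> H" "euclidean_group_dist d ?o x < e" for x
  proof -
    have "x \<in> mball ?o e" using that o subgroup.subset[OF H(1)] by auto
    then show ?thesis using that U e by blast
  qed
  then show ?thesis using that e by blast
qed

lemma abs_diff_lt_if_floor_eq:
  fixes x y :: real
  assumes "\<lfloor>x / s\<rfloor> = \<lfloor>y / s\<rfloor>" and "s > 0"
  shows "\<bar>x - y\<bar> < s"
proof -
  have "\<bar>x / s - y / s\<bar> < 1" using assms(1) by linarith
  then show ?thesis using assms(2) by (simp add: diff_divide_distrib[symmetric] abs_divide)
qed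

text \<open>The entries are sorted into cells of side \<open>s\<close>. Two elements x and y in the
  same cell have inverse(x) y so close to the identity that discreteness makes them equal, and a
  bounded region meets only finitely many cells.\<close>

lemma finite_bounded_discrete_subgroup:
  assumes "discrete_subgroup d H"
  shows "finite {x \<in> H. \<forall>i<d. \<bar>snd x $ i\<bar> \<le> R}"
proof -
  interpret E: group "euclidean_group d" by (rule group_euclidean_group)
  let ?o = "\<one>\<^bsub>euclidean_group d\<^esub>"
  have H: "subgroup H (euclidean_group d)"
    using assms by (auto simp: discrete_subgroup_def)
  interpret H: subgroup H "euclidean_group d" by fact
  obtain e where e: "e > 0"
    and iso: "\<And>x. \<lbrakk>x \<in> H; euclidean_group_dist d ?o x < e\<rbrakk> \<Longrightarrow> x = ?o"
    using discrete_subgroup_isolated_one[OF assms] by blast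
  \<comment> \<open>For two elements of one cell the d^2 matrix entries and d vector entries of the
    quotient deviate from the identity by at most d s each, so its distance to the identity is at
    most (d^3 + d^2) s. The summand 1 keeps the denominator positive for d = 0, and the factor 2
    keeps the bound strictly below \<open>e\<close>.\<close>
  define s where "s = e / (2 * (real d ^ 3 + real d ^ 2 + 1))"
  have s: "s > 0" using e by (simp add: s_def add_nonneg_pos)
  have small: "(real d ^ 3 + real d ^ 2) * s < e"
  proof -
    define K where "K = real d ^ 3 + real d ^ 2 + 1"
    have K: "K > 0" by (simp add: K_def add_nonneg_pos)
    have "(K - 1) * s \<le> K * s" using s by simp
    also have "\<dots> = e / 2" using K unfolding s_def K_def[symmetric] by simp
    finally show ?thesis using e by (simp add: K_def)
  qed
  let ?X = "{x \<in> H. \<forall>i<d. \<bar>snd x $ i\<bar> \<le> R}"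
  \<comment> \<open>One index for each matrix entry (\<open>Inl\<close>) and each vector entry
    (\<open>Inr\<close>), so that a cell is a single integer-valued function on a finite
    set.\<close>
  define D where "D = (Inl ` ({..<d} \<times> {..<d}) \<union> Inr ` {..<d} :: (nat \<times> nat + nat) set)"
  define c where "c x = (\<lambda>k\<in>D. case k of Inl ij \<Rightarrow> \<lfloor>fst x $$ ij / s\<rfloor> | Inr i \<Rightarrow> \<lfloor>snd x $ i / s\<rfloor>)"
    for x :: "real mat \<times> real vec"
  \<comment> \<open>Bounds the cell numbers: matrix entries have modulus at most 1 and vector
    entries at most \<open>R\<close>, so \<open>\<bar>R\<bar> + 1\<close> covers both.\<close>
  define b where "b = \<lceil>(\<bar>R\<bar> + 1) / s\<rceil> + 1"
  have cell: "\<lfloor>z / s\<rfloor> \<in> {-b..b}" if "\<bar>z\<bar> \<le> \<bar>R\<bar> + 1" for z :: real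
  proof -
    have "z / s \<le> (\<bar>R\<bar> + 1) / s" "- (\<bar>R\<bar> + 1) / s \<le> z / s"
      using that s by (auto intro!: divide_right_mono)
    then have "\<lfloor>z / s\<rfloor> \<le> b" "- b \<le> \<lfloor>z / s\<rfloor>" unfolding b_def minus_divide_left[symmetric] by linarith+
    then show ?thesis by simp
  qed
  have "c ` ?X \<subseteq> (\<Pi>\<^sub>E k\<in>D. {-b..b})"
  proof (intro image_subsetI)
    fix x assume x: "x \<in> ?X"
    then have "fst x \<in> orthogonal_matrices d" using H.subset by (auto simp: euclidean_group_def)
    then have "\<bar>fst x $$ (i, j)\<bar> \<le> \<bar>R\<bar> + 1" if "i < d" "j < d" for i j
      using orthogonal_entry_bound[of "fst x" d i j] that by simp
    moreover have "\<bar>snd x $ i\<bar> \<le> \<bar>R\<bar> + 1" if "i < d" for i using x that by fastforce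
    ultimately show "c x \<in> (\<Pi>\<^sub>E k\<in>D. {-b..b})"
      using cell by (auto simp: c_def D_def PiE_def Pi_def simp del: atLeastAtMost_iff)
  qed
  moreover have "finite (\<Pi>\<^sub>E k\<in>D. {-b..b})" by (rule finite_PiE) (auto simp: D_def)
  ultimately have "finite (c ` ?X)" using finite_subset by blast
  moreover have "inj_on c ?X"
  proof (rule inj_onI)
    fix x y assume xy: "x \<in> ?X" "y \<in> ?X" "c x = c y"
    obtain A a B b where eq: "x = (A, a)" "y = (B, b)" by fastforce
    have xyG: "x \<in> carrier (euclidean_group d)" "y \<in> carrier (euclidean_group d)"
      using xy H.subset by auto
    then have car: "A \<in> orthogonal_matrices d" "B \<in> orthogonal_matrices d"
      "a \<in> carrier_vec d" "b \<in> carrier_vec d" by (auto simp: euclidean_group_def eq)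
    then have m: "A \<in> carrier_mat d d" "B \<in> carrier_mat d d" "transpose_mat A * A = 1\<^sub>m d"
      by (auto simp: orthogonal_matrices_def)
    have t: "transpose_mat A \<in> carrier_mat d d" using m by simp
    have inv: "A * transpose_mat A = 1\<^sub>m d" by (rule mat_mult_left_right_inverse[OF t m(1,3)])
    have At: "transpose_mat A \<in> orthogonal_matrices d"
      using m inv by (simp add: orthogonal_matrices_def)
    have k: "c x k = c y k" if "k \<in> D" for k using xy by simp
    have dA: "\<bar>B $$ (i, j) - A $$ (i, j)\<bar> < s" if "i < d" "j < d" for i j
      using k[of "Inl (i, j)"] that s
      by (intro abs_diff_lt_if_floor_eq) (auto simp: c_def D_def eq)
    have da: "\<bar>b $ i - a $ i\<bar> < s" if "i < d" for i
      using k[of "Inr i"] that s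
      by (intro abs_diff_lt_if_floor_eq) (auto simp: c_def D_def eq)
    \<comment> \<open>The quotient of \<open>y\<close> by \<open>x\<close> on the left, computed
      with the transpose as the inverse of \<open>A\<close>.\<close>
    define z where "z = (transpose_mat A * B, transpose_mat A *\<^sub>v (b - a))"
    have zG: "z \<in> carrier (euclidean_group d)"
    proof -
      have "transpose_mat (transpose_mat A * B) * (transpose_mat A * B)
          = transpose_mat B * (A * transpose_mat A) * B"
        using m t by (simp add: transpose_mult assoc_mult_mat[of _ d d _ d _ d])
      also have "\<dots> = 1\<^sub>m d" using car inv m by (simp add: orthogonal_matrices_def)
      finally show ?thesis using m t car by (auto simp: z_def euclidean_group_def orthogonal_matrices_def)
    qed
    have xz: "x \<otimes>\<^bsub>euclidean_group d\<^esub> z = y"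
    proof -
      have "A * (transpose_mat A * B) = (A * transpose_mat A) * B"
        using m t by (simp add: assoc_mult_mat[of _ d d _ d _ d])
      moreover have "A *\<^sub>v (transpose_mat A *\<^sub>v (b - a)) = (A * transpose_mat A) *\<^sub>v (b - a)"
        using m t car by (simp add: assoc_mult_mat_vec[of _ d d _ d])
      moreover have "a + (b - a) = b" using car by (intro eq_vecI) auto
      ultimately show ?thesis using m t car inv by (simp add: z_def euclidean_group_def eq)
    qed
    then have "z = inv\<^bsub>euclidean_group d\<^esub> x \<otimes>\<^bsub>euclidean_group d\<^esub> y"
      using xyG zG by (simp add: E.inv_solve_left)
    then have zH: "z \<in> H" using xy by auto
    \<comment> \<open>This expresses the deviation from the identity through \<open>B - A\<close>,
      whose entries are smaller than \<open>s\<close>.\<close>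
    have *: "transpose_mat A * B - 1\<^sub>m d = transpose_mat A * (B - A)"
      using m t by (simp add: mult_minus_distrib_mat[of _ d d _ d])
    have e1: "\<bar>1\<^sub>m d $$ (i, j) - (transpose_mat A * B) $$ (i, j)\<bar> \<le> d * s" if ij: "i < d" "j < d" for i j
    proof -
      have "(transpose_mat A * B) $$ (i, j) - 1\<^sub>m d $$ (i, j) = (transpose_mat A * B - 1\<^sub>m d) $$ (i, j)"
        using ij m t by simp
      also have "\<dots> = (transpose_mat A *\<^sub>v col (B - A) j) $ i"
        unfolding * using ij m t by simp
      also have "\<bar>\<dots>\<bar> \<le> d * s"
        using ij m dA by (intro orthogonal_mult_vec_bound[OF At]) (auto simp: less_imp_le intro!: carrier_vecI)
      finally show ?thesis by linarith
    qed
    have e2: "\<bar>0\<^sub>v d $ i - (transpose_mat A *\<^sub>v (b - a)) $ i\<bar> \<le> d * s" if i: "i < d" for i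
    proof -
      have "\<bar>(transpose_mat A *\<^sub>v (b - a)) $ i\<bar> \<le> d * s"
        using i car da by (intro orthogonal_mult_vec_bound[OF At]) (auto simp: less_imp_le)
      then show ?thesis using i by simp
    qed
    have "euclidean_group_dist d ?o z \<le>
        (\<Sum>ij\<in>{..<d} \<times> {..<d}. \<bar>1\<^sub>m d $$ ij - (transpose_mat A * B) $$ ij\<bar>) +
        (\<Sum>i<d. \<bar>0\<^sub>v d $ i - (transpose_mat A *\<^sub>v (b - a)) $ i\<bar>)"
      unfolding euclidean_group_dist_def
      by (intro add_mono order_trans[OF L2_set_le_sum_abs]) (simp_all add: z_def euclidean_group_def)
    also have "\<dots> \<le> (\<Sum>ij\<in>{..<d} \<times> {..<d}. d * s) + (\<Sum>i<d. d * s)"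
      using e1 e2 by (intro add_mono sum_mono) auto
    also have "\<dots> = (real d ^ 3 + real d ^ 2) * s"
      by (simp add: power2_eq_square power3_eq_cube algebra_simps)
    finally have "z = ?o" using iso zH small by simp
    then show "x = y" using xz xyG by simp
  qed
  ultimately show ?thesis by (rule finite_imageD)
qed

text \<open>\<open>B\<close> is a basis, being independent of full cardinality. Reducing the
  coordinates of \<open>v\<close> modulo \<open>N\<close> by integral combinations of
  \<open>B\<close> leaves coordinates between 0 and \<open>N\<close>, whence the bound.\<close>

lemma lattice_translate_bounded:
  fixes L :: "real vec set" and N :: nat
  assumes L: "L \<subseteq> carrier_vec d" "0\<^sub>v d \<in> L" "\<And>v w. \<lbrakk>v \<in> L; w \<in> L\<rbrakk> \<Longrightarrow> v + w \<in> L"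
      "\<And>v. v \<in> L \<Longrightarrow> - v \<in> L"
    and B: "B \<subseteq> L" "finite B" "card B = d"
      "\<not> LinearCombinations.module.lin_dep class_ring (module_vec TYPE(real) d) B"
    and "N \<ge> 1"
  obtains R where "\<And>v. v \<in> carrier_vec d \<Longrightarrow>
    \<exists>l\<in>L. \<forall>i<d. \<bar>v $ i + real N * l $ i\<bar> \<le> R"
proof -
  interpret V: vec_space "TYPE(real)" d .
  have BV: "B \<subseteq> carrier_vec d" using B L by blast
  have "V.basis B"
    using V.dim_li_is_basis[of B] B BV by (simp add: V.dim_is_n)
  then have span: "V.span B = carrier_vec d" by (simp add: V.basis_def)
  have mult: "vec d (\<lambda>i. of_int k * b $ i) \<in> L" if b: "b \<in> L" for k :: int and b
  proof -
    have nat: "vec d (\<lambda>i. of_nat n * b $ i) \<in> L" for n :: nat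
    proof (induction n)
      case 0
      have "vec d (\<lambda>i. of_nat 0 * b $ i) = 0\<^sub>v d" by auto
      then show ?case using L by simp
    next
      case (Suc n)
      have "vec d (\<lambda>i. of_nat (Suc n) * b $ i) = vec d (\<lambda>i. of_nat n * b $ i) + b"
        using b L by (intro eq_vecI) (auto simp: algebra_simps)
      then show ?case using Suc b L by simp
    qed
    show ?thesis
    proof (cases k)
      case (nonneg n)
      then show ?thesis using nat[of n] by simp
    next
      case (neg n)
      have "vec d (\<lambda>i. of_int k * b $ i) = - vec d (\<lambda>i. of_nat (Suc n) * b $ i)"
        unfolding neg by (intro eq_vecI) (auto simp: algebra_simps)
      then show ?thesis using nat[of "Suc n"] L by simp
    qed
  qed
  have comb: "vec d (\<lambda>i. \<Sum>b\<in>C. of_int (k b) * b $ i) \<in> L" if C: "C \<subseteq> L" "finite C"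
    for k :: "real vec \<Rightarrow> int" and C
    using C(2,1)
  proof (induction C)
    case empty
    have "vec d (\<lambda>i. \<Sum>b\<in>{}. of_int (k b) * b $ i) = 0\<^sub>v d" by auto
    then show ?case using L by simp
  next
    case (insert b C)
    have "vec d (\<lambda>i. \<Sum>c\<in>insert b C. of_int (k c) * c $ i)
        = vec d (\<lambda>i. of_int (k b) * b $ i) + vec d (\<lambda>i. \<Sum>c\<in>C. of_int (k c) * c $ i)"
      using insert by (intro eq_vecI) auto
    then show ?case using insert mult L by auto
  qed
  define R where "R = real N * (\<Sum>i<d. \<Sum>b\<in>B. \<bar>b $ i\<bar>)"
  show ?thesis
  proof (rule that[of R])
    fix v :: "real vec" assume v: "v \<in> carrier_vec d"
    then obtain c where c: "v = V.lincomb c B"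
      using span V.finite_in_span[OF B(2)] BV by force
    have vi: "v $ i = (\<Sum>b\<in>B. c b * b $ i)" if "i < d" for i
      unfolding c using that BV by (simp add: V.lincomb_index)
    \<comment> \<open>Adding N times this integer leaves the remainder of \<open>c b\<close> modulo
      \<open>N\<close>.\<close>
    define k where "k b = - \<lfloor>c b / real N\<rfloor>" for b
    let ?l = "vec d (\<lambda>i. \<Sum>b\<in>B. of_int (k b) * b $ i)"
    have "\<bar>v $ i + real N * ?l $ i\<bar> \<le> R" if i: "i < d" for i
    proof -
      have frac: "\<bar>c b + real N * of_int (k b)\<bar> \<le> real N" for b
      proof -
        have "0 \<le> c b / real N - of_int \<lfloor>c b / real N\<rfloor>" "c b / real N - of_int \<lfloor>c b / real N\<rfloor> \<le> 1"
          by linarith+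
        then have "0 \<le> real N * (c b / real N - of_int \<lfloor>c b / real N\<rfloor>)"
          "real N * (c b / real N - of_int \<lfloor>c b / real N\<rfloor>) \<le> real N * 1"
          by (simp, intro mult_left_mono) auto
        then show ?thesis using \<open>N \<ge> 1\<close> by (simp add: k_def algebra_simps)
      qed
      have "v $ i + real N * ?l $ i = (\<Sum>b\<in>B. (c b + real N * of_int (k b)) * b $ i)"
        using i vi[OF i] by (simp add: sum_distrib_left sum.distrib algebra_simps)
      also have "\<bar>\<dots>\<bar> \<le> (\<Sum>b\<in>B. real N * \<bar>b $ i\<bar>)"
        by (rule order_trans[OF sum_abs]) (intro sum_mono, simp add: abs_mult mult_right_mono frac)
      also have "\<dots> = real N * (\<Sum>b\<in>B. \<bar>b $ i\<bar>)" by (simp add: sum_distrib_left)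
      also have "\<dots> \<le> R" unfolding R_def
        by (intro mult_left_mono member_le_sum) (use i in \<open>auto intro: sum_nonneg\<close>)
      finally show ?thesis .
    qed
    then show "\<exists>l\<in>L. \<forall>i<d. \<bar>v $ i + real N * l $ i\<bar> \<le> R"
      using comb[OF B(1,2)] by blast
  qed
qed

section \<open>Block isometries over a space group\<close>

lemma oplus_mult:
  assumes "A \<in> orthogonal_matrices d\<^sub>1" "B \<in> orthogonal_matrices d\<^sub>1"
    and "g \<in> carrier (euclidean_group d\<^sub>2)" "h \<in> carrier (euclidean_group d\<^sub>2)"
  shows "oplus A g \<otimes>\<^bsub>euclidean_group (d\<^sub>1 + d\<^sub>2)\<^esub> oplus B h = oplus (A * B) (g \<otimes>\<^bsub>euclidean_group d\<^sub>2\<^esub> h)"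
proof -
  obtain C a D b where eq: "g = (C, a)" "h = (D, b)" by fastforce
  have m: "A \<in> carrier_mat d\<^sub>1 d\<^sub>1" "B \<in> carrier_mat d\<^sub>1 d\<^sub>1" "C \<in> carrier_mat d\<^sub>2 d\<^sub>2" "D \<in> carrier_mat d\<^sub>2 d\<^sub>2"
    "a \<in> carrier_vec d\<^sub>2" "b \<in> carrier_vec d\<^sub>2"
    using assms by (auto simp: eq euclidean_group_def orthogonal_matrices_def)
  have "four_block_mat A (0\<^sub>m d\<^sub>1 d\<^sub>2) (0\<^sub>m d\<^sub>2 d\<^sub>1) C * four_block_mat B (0\<^sub>m d\<^sub>1 d\<^sub>2) (0\<^sub>m d\<^sub>2 d\<^sub>1) D
      = four_block_mat (A * B) (0\<^sub>m d\<^sub>1 d\<^sub>2) (0\<^sub>m d\<^sub>2 d\<^sub>1) (C * D)"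
    using m by (subst mult_four_block_mat[of _ d\<^sub>1 d\<^sub>1 _ d\<^sub>2 _ d\<^sub>2 _ _ d\<^sub>1 _ d\<^sub>2]) auto
  moreover have "four_block_mat A (0\<^sub>m d\<^sub>1 d\<^sub>2) (0\<^sub>m d\<^sub>2 d\<^sub>1) C *\<^sub>v (0\<^sub>v d\<^sub>1 @\<^sub>v b) = 0\<^sub>v d\<^sub>1 @\<^sub>v (C *\<^sub>v b)"
    using m by (subst four_block_mat_mult_vec[of _ d\<^sub>1 d\<^sub>1 _ d\<^sub>2 _ d\<^sub>2]) auto
  moreover have "(0\<^sub>v d\<^sub>1 @\<^sub>v a) + (0\<^sub>v d\<^sub>1 @\<^sub>v (C *\<^sub>v b)) = 0\<^sub>v d\<^sub>1 @\<^sub>v (a + C *\<^sub>v b)"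
    using m by (intro eq_vecI) auto
  ultimately show ?thesis using m by (simp add: oplus_def eq euclidean_group_def)
qed


locale block_space_group =
  fixes d\<^sub>1 d\<^sub>2 :: nat and S G T :: "(real mat \<times> real vec) set"
  assumes space_group: "space_group d\<^sub>2 S"
    and discrete: "discrete_subgroup (d\<^sub>1 + d\<^sub>2) G"
    and G_oplus: "G \<subseteq> {oplus A g | A g. A \<in> orthogonal_matrices d\<^sub>1 \<and> g \<in> S}"
    and proj_image: "block_proj d\<^sub>1 ` G = S"
    and T_sub: "T \<subseteq> G"
    and T_bij: "bij_betw (block_proj d\<^sub>1) T (translation_subgroup d\<^sub>2 S)"
begin

abbreviation "\<Gamma> \<equiv> (euclidean_group (d\<^sub>1 + d\<^sub>2))\<lparr>carrier := G\<rparr>"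
abbreviation "E2 \<equiv> euclidean_group d\<^sub>2"
abbreviation "p \<equiv> block_proj d\<^sub>1"

lemma subgroup_G: "subgroup G (euclidean_group (d\<^sub>1 + d\<^sub>2))"
  using discrete by (simp add: discrete_subgroup_def)

lemma group_\<Gamma>: "group \<Gamma>"
  by (rule subgroup.subgroup_is_group[OF subgroup_G group_euclidean_group])

sublocale \<Gamma>: group \<Gamma> by (rule group_\<Gamma>)
sublocale E2: group E2 by (rule group_euclidean_group)

lemma subgroup_S: "subgroup S E2"
  using space_group by (simp add: space_group_def discrete_subgroup_def)

lemma S_carrier: "g \<in> S \<Longrightarrow> g \<in> carrier E2"
  using subgroup.subset[OF subgroup_S] by blast

lemma G_cases:
  assumes "x \<in> G"
  obtains A g where "x = oplus A g" "A \<in> orthogonal_matrices d\<^sub>1" "g \<in> S" "g \<in> carrier E2" "p x = g"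
  using assms G_oplus S_carrier block_proj_oplus by blast

lemma p_mult:
  assumes "x \<in> G" and "y \<in> G"
  shows "p (x \<otimes>\<^bsub>\<Gamma>\<^esub> y) = p x \<otimes>\<^bsub>E2\<^esub> p y"
proof -
  obtain A g where x: "x = oplus A g" "A \<in> orthogonal_matrices d\<^sub>1" "g \<in> carrier E2" "p x = g"
    using G_cases[OF assms(1)] by metis
  obtain B h where y: "y = oplus B h" "B \<in> orthogonal_matrices d\<^sub>1" "h \<in> carrier E2" "p y = h"
    using G_cases[OF assms(2)] by metis
  \<comment> \<open>Closure of orthogonal matrices under products, read off from the group law of
    \<open>euclidean_group d\<^sub>1\<close> at zero translations.\<close>
  have "(A, 0\<^sub>v d\<^sub>1) \<otimes>\<^bsub>euclidean_group d\<^sub>1\<^esub> (B, 0\<^sub>v d\<^sub>1) \<in> carrier (euclidean_group d\<^sub>1)"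
    using x y by (intro monoid.m_closed group.is_monoid group_euclidean_group)
      (auto simp: euclidean_group_def)
  then have "A * B \<in> orthogonal_matrices d\<^sub>1" by (simp add: euclidean_group_def)
  then show ?thesis
    using x y oplus_mult[of A d\<^sub>1 B g d\<^sub>2 h] block_proj_oplus[OF _ E2.m_closed] by simp
qed

sublocale p: group_hom \<Gamma> E2 p
proof
  have "p x \<in> carrier E2" if "x \<in> G" for x
    using that S_carrier[of "p x"] proj_image by blast
  then show "p \<in> hom \<Gamma> E2"
    using p_mult by (intro homI) simp_all
qed

text \<open>The first \<open>d\<^sub>1\<close> components of the translation part vanish, so the
  projection controls all of it.\<close>

lemma snd_bound:
  assumes "x \<in> G" and "\<And>i. i < d\<^sub>2 \<Longrightarrow> \<bar>snd (p x) $ i\<bar> \<le> R" and "R \<ge> 0" and "i < d\<^sub>1 + d\<^sub>2"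
  shows "\<bar>snd x $ i\<bar> \<le> R"
proof -
  obtain A g where x: "x = oplus A g" "A \<in> orthogonal_matrices d\<^sub>1" "g \<in> carrier E2" "p x = g"
    using G_cases[OF assms(1)] by metis
  then have "snd x = 0\<^sub>v d\<^sub>1 @\<^sub>v snd g" "dim_vec (snd g) = d\<^sub>2"
    by (auto simp: oplus_def orthogonal_matrices_def euclidean_group_def)
  then show ?thesis using assms x by auto
qed

text \<open>The projection may forget an orthogonal block, but that block is bounded anyway. Hence a
  bound on the projected translation confines the element to a bounded part of the discrete
  group.\<close>

lemma finite_bounded:
  assumes "R \<ge> 0"
  shows "finite {x \<in> G. \<forall>i<d\<^sub>2. \<bar>snd (p x) $ i\<bar> \<le> R}"
  by (rule finite_subset[OF _ finite_bounded_discrete_subgroup[OF discrete, of R]])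
    (use snd_bound assms in blast)

text \<open>The kernel \<open>F\<close> is finite as the part of the group with zero translation.
  Commutators of \<open>H\<close> lie in it because translations commute, and \<open>T\<close> meets
  each of its cosets in \<open>H\<close> because \<open>T\<close> projects onto all translations of
  \<open>S\<close>.\<close>

lemma ex_normal_exponents:
  obtains M :: nat where "M \<ge> 1" "\<And>N. M dvd N \<Longrightarrow> set_pow \<Gamma> T N \<lhd> \<Gamma>"
proof -
  define H where "H = {x \<in> G. fst (p x) = 1\<^sub>m d\<^sub>2}"
  define F where "F = kernel \<Gamma> E2 p"
  have pE: "p x \<in> carrier E2" if "x \<in> G" for x using that p.hom_closed[of x] by simp
  have fst_mult: "fst (p (x \<otimes>\<^bsub>\<Gamma>\<^esub> y)) = fst (p x) * fst (p y)" if "x \<in> G" "y \<in> G" for x y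
    using p_mult[OF that] by (simp add: euclidean_group_def case_prod_beta)
  have fst_one: "fst (p \<one>\<^bsub>\<Gamma>\<^esub>) = 1\<^sub>m d\<^sub>2" using p.hom_one by (simp add: euclidean_group_def)
  have fst_carrier: "fst (p x) \<in> carrier_mat d\<^sub>2 d\<^sub>2" if "x \<in> G" for x
    using pE[OF that] by (auto simp: euclidean_group_def orthogonal_matrices_def)
  have cl: "x \<otimes>\<^bsub>\<Gamma>\<^esub> y \<in> G" "inv\<^bsub>\<Gamma>\<^esub> x \<in> G" if "x \<in> G" "y \<in> G" for x y
    using that \<Gamma>.m_closed[of x y] \<Gamma>.inv_closed[of x] by auto
  have fst_inv: "fst (p x) * fst (p (inv\<^bsub>\<Gamma>\<^esub> x)) = 1\<^sub>m d\<^sub>2" if "x \<in> G" for x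
    using fst_mult[of x "inv\<^bsub>\<Gamma>\<^esub> x"] that cl fst_one \<Gamma>.r_inv[of x] by simp
  have "subgroup H \<Gamma>"
  proof
    show "inv\<^bsub>\<Gamma>\<^esub> x \<in> H" if "x \<in> H" for x
      using that fst_inv[of x] cl[of x x] fst_carrier[of "inv\<^bsub>\<Gamma>\<^esub> x"] by (auto simp: H_def)
    show "x \<otimes>\<^bsub>\<Gamma>\<^esub> y \<in> H" if "x \<in> H" "y \<in> H" for x y
      using that fst_mult[of x y] cl[of x y] by (auto simp: H_def)
    show "\<one>\<^bsub>\<Gamma>\<^esub> \<in> H" using fst_one \<Gamma>.one_closed by (auto simp: H_def)
  qed (auto simp: H_def)
  moreover have "g \<otimes>\<^bsub>\<Gamma>\<^esub> x \<otimes>\<^bsub>\<Gamma>\<^esub> inv\<^bsub>\<Gamma>\<^esub> g \<in> H" if gx: "g \<in> G" "x \<in> H" for g x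
  proof -
    have x: "x \<in> G" "fst (p x) = 1\<^sub>m d\<^sub>2" using gx by (auto simp: H_def)
    have "fst (p (g \<otimes>\<^bsub>\<Gamma>\<^esub> x \<otimes>\<^bsub>\<Gamma>\<^esub> inv\<^bsub>\<Gamma>\<^esub> g)) = fst (p g) * fst (p (inv\<^bsub>\<Gamma>\<^esub> g))"
      using fst_mult[of "g \<otimes>\<^bsub>\<Gamma>\<^esub> x" "inv\<^bsub>\<Gamma>\<^esub> g"] fst_mult[of g x] cl gx x fst_carrier[of g] by simp
    moreover have "g \<otimes>\<^bsub>\<Gamma>\<^esub> x \<otimes>\<^bsub>\<Gamma>\<^esub> inv\<^bsub>\<Gamma>\<^esub> g \<in> G" by (intro cl) (use gx x in auto)
    ultimately show ?thesis using fst_inv[OF gx(1)] by (simp add: H_def)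
  qed
  ultimately have H: "H \<lhd> \<Gamma>" by (auto simp: \<Gamma>.normal_inv_iff)
  have F: "F \<lhd> \<Gamma>" unfolding F_def by (rule p.normal_kernel)
  have F_iff: "x \<in> F \<longleftrightarrow> x \<in> G \<and> p x = (1\<^sub>m d\<^sub>2, 0\<^sub>v d\<^sub>2)" for x
    by (auto simp: F_def kernel_def euclidean_group_def)
  have "F \<subseteq> H" by (auto simp: F_iff H_def)
  have "finite F"
    by (rule finite_subset[OF _ finite_bounded[of 0]]) (auto simp: F_iff)
  have pH: "\<exists>a. a \<in> carrier_vec d\<^sub>2 \<and> p x = (1\<^sub>m d\<^sub>2, a)" if "x \<in> H" for x
    using that pE[of x] by (cases "p x") (auto simp: H_def euclidean_group_def)
  have HG: "x \<in> G" if "x \<in> H" for x using that by (simp add: H_def)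
  \<comment> \<open>Elements with equal projections differ by a factor in the kernel. This supplies
    both the commutator factors and the decomposition of \<open>H\<close> by
    \<open>T\<close>.\<close>
  have quot: "inv\<^bsub>\<Gamma>\<^esub> y \<otimes>\<^bsub>\<Gamma>\<^esub> x \<in> F" if "x \<in> G" "y \<in> G" "p x = p y" for x y
  proof -
    have "p (inv\<^bsub>\<Gamma>\<^esub> y \<otimes>\<^bsub>\<Gamma>\<^esub> x) = inv\<^bsub>E2\<^esub> p y \<otimes>\<^bsub>E2\<^esub> p y"
      using p_mult[of "inv\<^bsub>\<Gamma>\<^esub> y" x] p.hom_inv[of y] cl[of y y] that by simp
    then show ?thesis using that cl pE by (simp add: F_def kernel_def)
  qed
  have comm: "\<exists>f\<in>F. x \<otimes>\<^bsub>\<Gamma>\<^esub> y = y \<otimes>\<^bsub>\<Gamma>\<^esub> x \<otimes>\<^bsub>\<Gamma>\<^esub> f" if xy: "x \<in> H" "y \<in> H" for x y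
  proof (rule bexI)
    obtain a b where "p x = (1\<^sub>m d\<^sub>2, a)" "p y = (1\<^sub>m d\<^sub>2, b)" "a \<in> carrier_vec d\<^sub>2" "b \<in> carrier_vec d\<^sub>2"
      using pH xy by meson
    then have "p (x \<otimes>\<^bsub>\<Gamma>\<^esub> y) = p (y \<otimes>\<^bsub>\<Gamma>\<^esub> x)"
      using p_mult[of x y] p_mult[of y x] xy HG
      by (simp add: euclidean_group_def comm_add_vec[of a d\<^sub>2 b])
    then show "inv\<^bsub>\<Gamma>\<^esub> (y \<otimes>\<^bsub>\<Gamma>\<^esub> x) \<otimes>\<^bsub>\<Gamma>\<^esub> (x \<otimes>\<^bsub>\<Gamma>\<^esub> y) \<in> F"
      using xy HG cl by (intro quot) auto
    have c: "x \<in> carrier \<Gamma>" "y \<in> carrier \<Gamma>" using xy HG by auto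
    then have "y \<otimes>\<^bsub>\<Gamma>\<^esub> x \<otimes>\<^bsub>\<Gamma>\<^esub> (inv\<^bsub>\<Gamma>\<^esub> (y \<otimes>\<^bsub>\<Gamma>\<^esub> x) \<otimes>\<^bsub>\<Gamma>\<^esub> (x \<otimes>\<^bsub>\<Gamma>\<^esub> y))
        = (y \<otimes>\<^bsub>\<Gamma>\<^esub> x \<otimes>\<^bsub>\<Gamma>\<^esub> inv\<^bsub>\<Gamma>\<^esub> (y \<otimes>\<^bsub>\<Gamma>\<^esub> x)) \<otimes>\<^bsub>\<Gamma>\<^esub> (x \<otimes>\<^bsub>\<Gamma>\<^esub> y)"
      by (intro \<Gamma>.m_assoc[symmetric] \<Gamma>.m_closed \<Gamma>.inv_closed)
    also have "\<dots> = x \<otimes>\<^bsub>\<Gamma>\<^esub> y"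
      by (simp only: \<Gamma>.r_inv[OF \<Gamma>.m_closed[OF c(2,1)]] \<Gamma>.l_one[OF \<Gamma>.m_closed[OF c]])
    finally show "x \<otimes>\<^bsub>\<Gamma>\<^esub> y = y \<otimes>\<^bsub>\<Gamma>\<^esub> x \<otimes>\<^bsub>\<Gamma>\<^esub> (inv\<^bsub>\<Gamma>\<^esub> (y \<otimes>\<^bsub>\<Gamma>\<^esub> x) \<otimes>\<^bsub>\<Gamma>\<^esub> (x \<otimes>\<^bsub>\<Gamma>\<^esub> y))" ..
  qed
  have pT: "p ` T = translation_subgroup d\<^sub>2 S" using T_bij by (simp add: bij_betw_def)
  then have TH: "T \<subseteq> H" using T_sub by (auto simp: H_def translation_subgroup_def)
  have tr: "\<exists>t\<in>T. \<exists>f\<in>F. x = t \<otimes>\<^bsub>\<Gamma>\<^esub> f" if x: "x \<in> H" for x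
  proof -
    have "p x \<in> translation_subgroup d\<^sub>2 S"
      using x proj_image by (auto simp: H_def translation_subgroup_def)
    then obtain t where t: "t \<in> T" "p x = p t" using pT by (metis imageE)
    have c: "x \<in> carrier \<Gamma>" "t \<in> carrier \<Gamma>" using x HG t T_sub by auto
    have "t \<otimes>\<^bsub>\<Gamma>\<^esub> (inv\<^bsub>\<Gamma>\<^esub> t \<otimes>\<^bsub>\<Gamma>\<^esub> x) = x"
      by (simp only: \<Gamma>.m_assoc[symmetric, OF c(2) \<Gamma>.inv_closed[OF c(2)] c(1)]
          \<Gamma>.r_inv[OF c(2)] \<Gamma>.l_one[OF c(1)])
    moreover have "inv\<^bsub>\<Gamma>\<^esub> t \<otimes>\<^bsub>\<Gamma>\<^esub> x \<in> F" using c t by (intro quot) auto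
    ultimately show ?thesis using t(1) by metis
  qed
  show ?thesis
    using \<Gamma>.normal_powers_of_transversal[OF H F \<open>F \<subseteq> H\<close> \<open>finite F\<close> comm TH tr] that by blast
qed

text \<open>If \<open>g\<close> projects to (A, a) and \<open>t\<close> to the translation by l,
  then the N-th power of \<open>t\<close> changes the translation part of \<open>g\<close> to a + N
  A l. This is \<open>A\<close> applied to the transpose of \<open>A\<close> times \<open>a\<close>,
  plus N l, and a suitable lattice vector l makes the latter bounded independently of
  \<open>g\<close>.\<close>

lemma finite_index:
  assumes "N \<ge> 1" and "set_pow \<Gamma> T N \<lhd> \<Gamma>"
  shows "finite (carrier (\<Gamma> Mod set_pow \<Gamma> T N))"
proof -
  interpret K: normal "set_pow \<Gamma> T N" \<Gamma> by fact
  define L where "L = snd ` translation_subgroup d\<^sub>2 S"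
  have L_iff: "l \<in> L \<longleftrightarrow> (1\<^sub>m d\<^sub>2, l) \<in> S" for l
    by (force simp: L_def translation_subgroup_def)
  have inv: "inv\<^bsub>E2\<^esub> (1\<^sub>m d\<^sub>2, l) = (1\<^sub>m d\<^sub>2, - l)" if "l \<in> carrier_vec d\<^sub>2" for l
    using that by (intro E2.inv_equality) (auto simp: euclidean_group_def orthogonal_matrices_def)
  have L: "L \<subseteq> carrier_vec d\<^sub>2" using S_carrier by (auto simp: L_iff euclidean_group_def)
  have L0: "0\<^sub>v d\<^sub>2 \<in> L"
    using subgroup.one_closed[OF subgroup_S] by (simp add: L_iff euclidean_group_def)
  have Ladd: "v + w \<in> L" if vw: "v \<in> L" "w \<in> L" for v w
  proof -
    have "(1\<^sub>m d\<^sub>2, v) \<otimes>\<^bsub>E2\<^esub> (1\<^sub>m d\<^sub>2, w) \<in> S"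
      using vw subgroup.m_closed[OF subgroup_S] unfolding L_iff by blast
    then show ?thesis using vw L by (auto simp: L_iff euclidean_group_def)
  qed
  have Lneg: "- v \<in> L" if "v \<in> L" for v
  proof -
    have v: "v \<in> carrier_vec d\<^sub>2" using that L by blast
    have "inv\<^bsub>E2\<^esub> (1\<^sub>m d\<^sub>2, v) \<in> S"
      using that subgroup.m_inv_closed[OF subgroup_S] unfolding L_iff by blast
    then show ?thesis by (simp add: L_iff inv[OF v])
  qed
  obtain B where B: "B \<subseteq> L" "finite B" "card B = d\<^sub>2"
    "\<not> LinearCombinations.module.lin_dep class_ring (module_vec TYPE(real) d\<^sub>2) B"
    using space_group unfolding space_group_def L_def by blast
  obtain R where R: "\<And>v. v \<in> carrier_vec d\<^sub>2 \<Longrightarrow> \<exists>l\<in>L. \<forall>i<d\<^sub>2. \<bar>v $ i + real N * l $ i\<bar> \<le> R"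
    using lattice_translate_bounded[OF L L0 Ladd Lneg B \<open>N \<ge> 1\<close>] by blast
  \<comment> \<open>The factor \<open>real d\<^sub>2\<close> is the cost of applying the orthogonal
    matrix \<open>A\<close> to a vector bounded by \<open>R\<close>; the absolute value supplies the
    nonnegative radius for \<open>finite_bounded\<close>.\<close>
  define X where "X = {x \<in> G. \<forall>i<d\<^sub>2. \<bar>snd (p x) $ i\<bar> \<le> \<bar>real d\<^sub>2 * R\<bar>}"
  have "carrier (\<Gamma> Mod set_pow \<Gamma> T N) \<subseteq> (\<lambda>x. set_pow \<Gamma> T N #>\<^bsub>\<Gamma>\<^esub> x) ` X"
  proof
    fix q assume "q \<in> carrier (\<Gamma> Mod set_pow \<Gamma> T N)"
    then obtain g where g: "g \<in> carrier \<Gamma>" "q = set_pow \<Gamma> T N #>\<^bsub>\<Gamma>\<^esub> g"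
      by (auto simp: FactGroup_def RCOSETS_def)
    then have gG: "g \<in> G" by simp
    obtain A a where pg: "p g = (A, a)" by fastforce
    have "p g \<in> carrier E2" using p.hom_closed[of g] gG by simp
    then have A: "A \<in> orthogonal_matrices d\<^sub>2" "a \<in> carrier_vec d\<^sub>2"
      by (auto simp: pg euclidean_group_def)
    then have m: "A \<in> carrier_mat d\<^sub>2 d\<^sub>2" "transpose_mat A * A = 1\<^sub>m d\<^sub>2" "transpose_mat A \<in> carrier_mat d\<^sub>2 d\<^sub>2"
      by (auto simp: orthogonal_matrices_def)
    have AAt: "A * transpose_mat A = 1\<^sub>m d\<^sub>2" by (rule mat_mult_left_right_inverse[OF m(3,1,2)])
    obtain l where l: "l \<in> L" "\<forall>i<d\<^sub>2. \<bar>(transpose_mat A *\<^sub>v a) $ i + real N * l $ i\<bar> \<le> R"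
      using R[of "transpose_mat A *\<^sub>v a"] m A by auto
    have lc: "l \<in> carrier_vec d\<^sub>2" using l L by blast
    have "(1\<^sub>m d\<^sub>2, l) \<in> translation_subgroup d\<^sub>2 S" using l by (simp add: L_iff translation_subgroup_def)
    \<comment> \<open>\<open>t\<close> is a lift of the translation and may have a nontrivial
      orthogonal block, so its powers are computed after projection.\<close>
    then obtain t where t: "t \<in> T" "p t = (1\<^sub>m d\<^sub>2, l)" using T_bij unfolding bij_betw_def by (metis imageE)
    have tG: "t \<in> carrier \<Gamma>" using t T_sub by auto
    define k where "k = t [^]\<^bsub>\<Gamma>\<^esub> N"
    have kK: "k \<in> set_pow \<Gamma> T N" using t by (simp add: set_pow_def k_def)
    have kG: "k \<in> carrier \<Gamma>" using tG \<Gamma>.nat_pow_closed k_def by blast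
    have "p t [^]\<^bsub>E2\<^esub> n = (1\<^sub>m d\<^sub>2, real n \<cdot>\<^sub>v l)" for n :: nat
    proof (induction n)
      case 0
      show ?case using lc by (auto simp: euclidean_group_def)
    next
      case (Suc n)
      have "p t [^]\<^bsub>E2\<^esub> Suc n = p t [^]\<^bsub>E2\<^esub> n \<otimes>\<^bsub>E2\<^esub> p t" by simp
      also have "\<dots> = (1\<^sub>m d\<^sub>2, real n \<cdot>\<^sub>v l + l)"
        unfolding Suc unfolding t(2) using lc by (simp add: euclidean_group_def)
      also have "real n \<cdot>\<^sub>v l + l = real (Suc n) \<cdot>\<^sub>v l"
        using lc by (intro eq_vecI) (auto simp: algebra_simps)
      finally show ?case .
    qed
    then have pk: "p k = (1\<^sub>m d\<^sub>2, real N \<cdot>\<^sub>v l)" using p.hom_nat_pow[OF tG, of N] by (simp add: k_def)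
    define x where "x = g \<otimes>\<^bsub>\<Gamma>\<^esub> k"
    have x: "x \<in> G" using \<Gamma>.m_closed[OF g(1) kG] by (simp add: x_def)
    have w: "transpose_mat A *\<^sub>v a + real N \<cdot>\<^sub>v l \<in> carrier_vec d\<^sub>2" using m A lc by simp
    have "A *\<^sub>v (transpose_mat A *\<^sub>v a + real N \<cdot>\<^sub>v l) = A *\<^sub>v (transpose_mat A *\<^sub>v a) + A *\<^sub>v (real N \<cdot>\<^sub>v l)"
      using m A lc by (intro mult_add_distrib_mat_vec) auto
    also have "A *\<^sub>v (transpose_mat A *\<^sub>v a) = a"
      using m A AAt by (simp add: assoc_mult_mat_vec[symmetric, of _ d\<^sub>2 d\<^sub>2 _ d\<^sub>2])
    finally have "snd (p x) = A *\<^sub>v (transpose_mat A *\<^sub>v a + real N \<cdot>\<^sub>v l)"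
      using p_mult[of g k] gG kG pk pg by (simp add: x_def euclidean_group_def)
    moreover have "\<bar>(A *\<^sub>v (transpose_mat A *\<^sub>v a + real N \<cdot>\<^sub>v l)) $ i\<bar> \<le> d\<^sub>2 * R" if "i < d\<^sub>2" for i
      using that l lc m A by (intro orthogonal_mult_vec_bound[OF A(1) w]) auto
    ultimately have "x \<in> X" using x unfolding X_def by force
    moreover have "x \<in> set_pow \<Gamma> T N #>\<^bsub>\<Gamma>\<^esub> g"
      using K.coset_eq g(1) kK by (auto simp: x_def l_coset_def)
    then have "q = set_pow \<Gamma> T N #>\<^bsub>\<Gamma>\<^esub> x"
      using \<Gamma>.repr_independence[OF _ g(1) K.subgroup_axioms] g(2) by blast
    ultimately show "q \<in> (\<lambda>x. set_pow \<Gamma> T N #>\<^bsub>\<Gamma>\<^esub> x) ` X" by blast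
  qed
  moreover have "finite X" unfolding X_def by (rule finite_bounded) simp
  ultimately show ?thesis using finite_surj by blast
qed

lemma normal_exponents_nonempty: "normal_exponents \<Gamma> T \<noteq> {}"
  using ex_normal_exponents by (metis (mono_tags, lifting) dvd_refl empty_iff mem_Collect_eq normal_exponents_def)

text \<open>Powers of \<open>T\<close> with exponent a multiple of k are powers of elements of T^k,
  and stay in it when T^k is a subgroup. The factor \<open>M\<close> in
  \<open>N\<^sub>1 * N\<^sub>2 * M\<close> guarantees normality of the common refinement.\<close>

lemma normal_exponents_directed:
  assumes "N\<^sub>1 \<in> normal_exponents \<Gamma> T" and "N\<^sub>2 \<in> normal_exponents \<Gamma> T"
  shows "\<exists>N\<in>normal_exponents \<Gamma> T. set_pow \<Gamma> T N \<subseteq> set_pow \<Gamma> T N\<^sub>1 \<inter> set_pow \<Gamma> T N\<^sub>2"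
proof -
  obtain M where M: "M \<ge> 1" "\<And>N. M dvd N \<Longrightarrow> set_pow \<Gamma> T N \<lhd> \<Gamma>" using ex_normal_exponents by blast
  have sub: "set_pow \<Gamma> T (k * l) \<subseteq> set_pow \<Gamma> T k" if "k \<in> normal_exponents \<Gamma> T" for k l
  proof
    have k: "subgroup (set_pow \<Gamma> T k) \<Gamma>"
      using that by (auto simp: normal_exponents_def normal_imp_subgroup)
    fix x assume "x \<in> set_pow \<Gamma> T (k * l)"
    then obtain t where t: "t \<in> T" "x = t [^]\<^bsub>\<Gamma>\<^esub> (k * l)" by (auto simp: set_pow_def)
    have "t \<in> carrier \<Gamma>" using t T_sub by auto
    then have "x = (t [^]\<^bsub>\<Gamma>\<^esub> k) [^]\<^bsub>\<Gamma>\<^esub> l" by (simp add: t \<Gamma>.nat_pow_pow)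
    moreover have "t [^]\<^bsub>\<Gamma>\<^esub> k \<in> set_pow \<Gamma> T k" using t by (simp add: set_pow_def)
    moreover have "y [^]\<^bsub>\<Gamma>\<^esub> n \<in> set_pow \<Gamma> T k" if "y \<in> set_pow \<Gamma> T k" for y and n :: nat
      by (induction n) (use that subgroup.one_closed[OF k] subgroup.m_closed[OF k] in auto)
    ultimately show "x \<in> set_pow \<Gamma> T k" by blast
  qed
  show ?thesis
  proof
    show "N\<^sub>1 * N\<^sub>2 * M \<in> normal_exponents \<Gamma> T"
      using assms M by (auto simp: normal_exponents_def Suc_le_eq)
    show "set_pow \<Gamma> T (N\<^sub>1 * N\<^sub>2 * M) \<subseteq> set_pow \<Gamma> T N\<^sub>1 \<inter> set_pow \<Gamma> T N\<^sub>2"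
      using sub[OF assms(1), of "N\<^sub>2 * M"] sub[OF assms(2), of "N\<^sub>1 * M"]
      by (simp add: ac_simps)
  qed
qed

end

lemma (in block_space_group) periodic_family_\<Gamma>:
  "periodic_family \<Gamma> (set_pow \<Gamma> T ` normal_exponents \<Gamma> T)"
proof (intro periodic_family.intro periodic_family_axioms.intro group_\<Gamma>)
  show "set_pow \<Gamma> T ` normal_exponents \<Gamma> T \<noteq> {}" using normal_exponents_nonempty by blast
  show "finite_index_normal K \<Gamma>" if "K \<in> set_pow \<Gamma> T ` normal_exponents \<Gamma> T" for K
    using that finite_index
    by (auto simp: normal_exponents_def finite_index_normal_def finite_index_normal_axioms_def)
  show "\<exists>M\<in>set_pow \<Gamma> T ` normal_exponents \<Gamma> T. M \<subseteq> K \<inter> L"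
    if K: "K \<in> set_pow \<Gamma> T ` normal_exponents \<Gamma> T" and L: "L \<in> set_pow \<Gamma> T ` normal_exponents \<Gamma> T" for K L
  proof -
    obtain N\<^sub>1 N\<^sub>2 where N: "N\<^sub>1 \<in> normal_exponents \<Gamma> T" "N\<^sub>2 \<in> normal_exponents \<Gamma> T"
      "K = set_pow \<Gamma> T N\<^sub>1" "L = set_pow \<Gamma> T N\<^sub>2" using K L by (elim imageE)
    then show ?thesis using normal_exponents_directed[OF N(1,2)] by auto
  qed
qed

theorem proposition5p11:
  fixes d d\<^sub>1 d\<^sub>2 m n :: nat
    and S G T :: "(real mat \<times> real vec) set"
    and \<E> :: "(real mat \<times> real vec \<Rightarrow> complex mat) set"
    and \<Gamma> :: "(real mat \<times> real vec) monoid"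
  assumes "d \<ge> 1" and "d = d\<^sub>1 + d\<^sub>2" and "m \<ge> 1" and "n \<ge> 1"
    and "space_group d\<^sub>2 S"
    and "discrete_subgroup d G"
    and "G \<subseteq> {oplus A g | A g. A \<in> orthogonal_matrices d\<^sub>1 \<and> g \<in> S}"
    and "block_proj d\<^sub>1 ` G = S"
    and "T \<subseteq> G" and "bij_betw (block_proj d\<^sub>1) T (translation_subgroup d\<^sub>2 S)"
    and "\<Gamma> = (euclidean_group d)\<lparr>carrier := G\<rparr>"
    and "representatives \<E> (periodic_dual \<Gamma> T)"
  shows "(\<forall>u \<in> L_per \<Gamma> T m n. \<forall>\<rho>\<in>\<E>. \<exists>!X. is_fourier \<Gamma> T m n u \<rho> X)
    \<and> bij_betw (\<lambda>u. \<lambda>\<rho>\<in>\<E>. fourier \<Gamma> T m n u \<rho>) (L_per \<Gamma> T m n) (fourier_codomain \<Gamma> \<E> m n)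
    \<and> (\<forall>u \<in> L_per \<Gamma> T m n. \<forall>v \<in> L_per \<Gamma> T m n. (\<exists>!c. is_inner_per \<Gamma> T u v c)
        \<and> ((\<lambda>\<rho>. of_nat (rep_dim \<Gamma> \<rho>) * frobenius (fourier \<Gamma> T m n u \<rho>) (fourier \<Gamma> T m n v \<rho>))
             has_sum inner_per \<Gamma> T u v) \<E>)"
proof -
  interpret B: block_space_group d\<^sub>1 d\<^sub>2 S G T
    using assms by unfold_locales simp_all
  have \<Gamma>: "\<Gamma> = B.\<Gamma>" using assms by simp
  have "periodic_reps \<Gamma> (set_pow \<Gamma> T ` normal_exponents \<Gamma> T) \<E>"
    using periodic_family.periodic_reps_representatives[OF B.periodic_family_\<Gamma> refl] assms(12)
    unfolding \<Gamma> by blast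
  then have "fourier_setting \<Gamma> T \<E>" by (simp add: fourier_setting_def)
  then show ?thesis by (rule fourier_setting.fourier_bijective_plancherel)
qed

end
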